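(* Let $0<d^-\leqslant d^+$ be real numbers and let $p$ be fixed with $\infty\geqslant p>\max\{2,1/d^-\}$. There is a constant $K>0$, depending only on $d^-,d^+,p$, such that the following holds. Let $(\hat d(j))_{j\geqslant1}$ be real numbers with $d^-\leqslant\hat d(j)\leqslant d^+$ for all $j$, let $n\geqslant1$, and let $h:S_n\to\mathbb{R}$ be the additive function determined by real numbers $\hat h_n(1),\dots,\hat h_n(n)$ satisfying the normalizing condition $$\sum_{k=1}^n\hat d(k)\frac{\hat h_n^2(k)}{k}=1.$$ Let $F_n(x)=\nu_{n,d}\bigl(h(\sigma)-A(n)<x\bigr)$. Then $$\sup_{x\in\mathbb{R}}\left|F_n(x)-\Phi(x)+\frac{1}{\sqrt{2\pi}}e^{-x^2/2}C_n\right|\leqslant K\left(L_{n,3}+L_{n,p}^{2/p}+L_{n,2}'\right),$$ where for $p=\infty$ the quantity $L_{n,p}^{2/p}$ is understood as $\bigl(\max_{1\leqslant j\leqslant n}|\hat h_n(j)|\bigr)^2$.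
   Context: $S_n$ is the symmetric group, and $\alpha_j(\sigma)$ is the number of cycles of length $j$ in $\sigma\in S_n$. The additive function determined by $\hat h_n(1),\dots,\hat h_n(n)$ is $h(\sigma)=\sum_{j=1}^n\hat h_n(j)\alpha_j(\sigma)$. With $d(\sigma)=\prod_{j=1}^n\hat d(j)^{\alpha_j(\sigma)}$, the probability measure $\nu_{n,d}$ on $S_n$ is $\nu_{n,d}(\sigma)=d(\sigma)/\sum_{\tau\in S_n}d(\tau)$. The numbers $p_j$ are defined by $\sum_{j\geqslant0}p_jz^j=\exp\{\sum_{j\geqslant1}\frac{\hat d(j)}{j}z^j\}$. Further $$A(n)=\sum_{k=1}^n\hat d(k)\frac{\hat h_n(k)}{k},\qquad C_n=\sum_{j=1}^n\hat d(j)\frac{\hat h_n(j)}{j}\left(\frac{p_{n-j}}{p_n}-1\right),$$ $$L_{n,r}=\sum_{k=1}^n\frac{|\hat h_n(k)|^r}{k}\ \ (\text{finite exponent } r),\qquad L_{n,2}'=\sum_{j=1}^n\frac{\hat h_n^2(j)}{j}\left|\frac{p_{n-j}}{p_n}-1\right|,$$ and $\Phi(x)=\frac1{\sqrt{2\pi}}\int_{-\infty}^xe^{-u^2/2}\,du$. *)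

theory Defs
  imports
    "HOL-Probability.Probability"
    "HOL-Combinatorics.Orbits"
    "HOL-Computational_Algebra.Formal_Power_Series"
begin

definition sym_group :: "nat \<Rightarrow> (nat \<Rightarrow> nat) set" where
  "sym_group n = {\<sigma>. \<sigma> permutes {1..n}}"

text \<open>A cycle is identified with the orbit it runs through; fixed points are cycles of length 1.\<close>

definition cycle_count :: "nat \<Rightarrow> nat \<Rightarrow> (nat \<Rightarrow> nat) \<Rightarrow> nat" where
  "cycle_count n j \<sigma> = card {c \<in> orbit \<sigma> ` {1..n}. card c = j}"

definition additive_fun :: "nat \<Rightarrow> (nat \<Rightarrow> real) \<Rightarrow> (nat \<Rightarrow> nat) \<Rightarrow> real" where
  "additive_fun n hh \<sigma> = (\<Sum>j=1..n. hh j * real (cycle_count n j \<sigma>))"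

definition mult_fun :: "nat \<Rightarrow> (nat \<Rightarrow> real) \<Rightarrow> (nat \<Rightarrow> nat) \<Rightarrow> real" where
  "mult_fun n dd \<sigma> = (\<Prod>j=1..n. dd j ^ cycle_count n j \<sigma>)"

definition nu :: "nat \<Rightarrow> (nat \<Rightarrow> real) \<Rightarrow> (nat \<Rightarrow> nat) measure" where
  "nu n dd = point_measure (sym_group n)
     (\<lambda>\<sigma>. ennreal (mult_fun n dd \<sigma> / (\<Sum>\<tau>\<in>sym_group n. mult_fun n dd \<tau>)))"

definition p_coeff :: "(nat \<Rightarrow> real) \<Rightarrow> nat \<Rightarrow> real" where
  "p_coeff dd j =
     fps_nth (fps_exp 1 oo Abs_fps (\<lambda>i. if i = 0 then 0 else dd i / real i)) j"

definition A_mean :: "nat \<Rightarrow> (nat \<Rightarrow> real) \<Rightarrow> (nat \<Rightarrow> real) \<Rightarrow> real" where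
  "A_mean n dd hh = (\<Sum>k=1..n. dd k * (hh k / real k))"

definition C_corr :: "nat \<Rightarrow> (nat \<Rightarrow> real) \<Rightarrow> (nat \<Rightarrow> real) \<Rightarrow> real" where
  "C_corr n dd hh =
     (\<Sum>j=1..n. dd j * (hh j / real j) * (p_coeff dd (n - j) / p_coeff dd n - 1))"

definition L_sum :: "nat \<Rightarrow> (nat \<Rightarrow> real) \<Rightarrow> real \<Rightarrow> real" where
  "L_sum n hh r = (\<Sum>k=1..n. \<bar>hh k\<bar> powr r / real k)"

text \<open>The quantity \<open>L\<^sub>n\<^sub>,\<^sub>p\<close> to the power \<open>2/p\<close>, for an exponent that may be infinite.\<close>

definition L_norm_sq :: "nat \<Rightarrow> (nat \<Rightarrow> real) \<Rightarrow> ereal \<Rightarrow> real" where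
  "L_norm_sq n hh p =
     (if p = \<infinity> then (Max ((\<lambda>j. \<bar>hh j\<bar>) ` {1..n}))\<^sup>2
      else L_sum n hh (real_of_ereal p) powr (2 / real_of_ereal p))"

definition L2' :: "nat \<Rightarrow> (nat \<Rightarrow> real) \<Rightarrow> (nat \<Rightarrow> real) \<Rightarrow> real" where
  "L2' n dd hh =
     (\<Sum>j=1..n. (hh j)\<^sup>2 / real j * \<bar>p_coeff dd (n - j) / p_coeff dd n - 1\<bar>)"

definition F_dist :: "nat \<Rightarrow> (nat \<Rightarrow> real) \<Rightarrow> (nat \<Rightarrow> real) \<Rightarrow> real \<Rightarrow> real" where
  "F_dist n dd hh x =
     measure (nu n dd) {\<sigma> \<in> space (nu n dd). additive_fun n hh \<sigma> - A_mean n dd hh < x}"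

definition Phi :: "real \<Rightarrow> real" where
  "Phi x = 1 / sqrt (2 * pi) * (LBINT u:{..x}. exp (- u\<^sup>2 / 2))"

lemma mult_fun_pos:
  assumes "\<And>j. j \<ge> 1 \<Longrightarrow> dd j > 0"
  shows "mult_fun n dd \<sigma> > 0"
  unfolding mult_fun_def by (intro prod_pos) (auto intro!: zero_less_power assms)

lemma finite_sym_group: "finite (sym_group n)"
  unfolding sym_group_def by (simp add: finite_permutations)

lemma sym_group_nonempty: "sym_group n \<noteq> {}"
  unfolding sym_group_def using permutes_id by blast

lemma prob_space_nu:
  assumes "\<And>j. j \<ge> 1 \<Longrightarrow> dd j > 0"
  shows "prob_space (nu n dd)"
proof
  let ?Z = "\<Sum>\<tau>\<in>sym_group n. mult_fun n dd \<tau>"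
  have pos: "mult_fun n dd \<sigma> > 0" for \<sigma>
    using assms by (rule mult_fun_pos)
  have Z: "?Z > 0"
    using finite_sym_group sym_group_nonempty pos by (intro sum_pos) auto
  have "emeasure (nu n dd) (space (nu n dd)) =
      (\<Sum>\<sigma>\<in>sym_group n. ennreal (mult_fun n dd \<sigma> / ?Z))"
    unfolding nu_def space_point_measure
    by (rule emeasure_point_measure_finite) (auto simp: finite_sym_group)
  also have "\<dots> = ennreal (\<Sum>\<sigma>\<in>sym_group n. mult_fun n dd \<sigma> / ?Z)"
    by (intro sum_ennreal divide_nonneg_nonneg less_imp_le pos Z)
  also have "(\<Sum>\<sigma>\<in>sym_group n. mult_fun n dd \<sigma> / ?Z) = 1"
    using Z by (simp flip: sum_divide_distrib)
  finally show "emeasure (nu n dd) (space (nu n dd)) = 1" by simp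
qed

lemma Phi_eq_cdf: "Phi x = cdf std_normal_distribution x"
proof -
  have int: "integrable lborel (\<lambda>u. std_normal_density u * indicator {..x} u)"
    by (intro integrable_real_mult_indicator integrable_normal_density) auto
  have "emeasure std_normal_distribution {..x} =
      (\<integral>\<^sup>+u. ennreal (std_normal_density u * indicator {..x} u) \<partial>lborel)"
    by (auto simp: emeasure_density indicator_def intro!: nn_integral_cong)
  also have "\<dots> = ennreal (LBINT u. std_normal_density u * indicator {..x} u)"
    by (intro nn_integral_eq_integral int) auto
  finally have "cdf std_normal_distribution x = (LBINT u. std_normal_density u * indicator {..x} u)"
    by (simp add: cdf_def measure_def)
  also have "\<dots> = (LBINT u. 1 / sqrt (2 * pi) * (indicator {..x} u * exp (- u\<^sup>2 / 2)))"
    by (simp add: std_normal_density_def mult_ac)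
  also have "\<dots> = Phi x"
    unfolding Phi_def set_lebesgue_integral_def real_scaleR_def by (rule integral_mult_right_zero)
  finally show ?thesis by simp
qed

end

theory Submission
  imports Defs
begin

text \<open>If the numbers of cycles of the various lengths were independent Poisson variables of mean \<open>d j / j\<close>,
the additive function would be a sum of independent terms with characteristic function \<open>exp (U t)\<close>,
\<open>U t = (\<Sum>j. d j * (exp (\<i> * t * h j) - 1) / j)\<close> (\<open>log_ratio\<close>), and the classical Berry--Esseen argument would
give an error of the order of the third absolute moment \<open>L\<^sub>3\<close>. The weighted measure on permutations is this Poisson
model conditioned on the total length \<open>n\<close>. The conditioning moves the mean by \<open>C\<close>, which is the
correction term in the theorem, and otherwise produces only errors of second order. The task is to prove
this without any regularity of \<open>d\<close> and \<open>h\<close>, and uniformly for \<open>t\<close> up to a multiple of \<open>1 / L\<^sub>3\<close>.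

The characteristic function of the additive function is \<open>M n / p n\<close>, where \<open>M m\<close> is the coefficient of \<open>z ^ m\<close> in
\<open>exp (\<Sum>j. d j * exp (\<i> * t * h j) * z ^ j / j)\<close> and \<open>p m\<close> is its value at \<open>t = 0\<close> (\<open>cycle_sum_eq_ecoef\<close>,
\<open>char_shifted_law\<close>). With \<open>\<omega> j\<close> the derivative in \<open>t\<close> of the exponent's \<open>j\<close>-th coefficient one
has \<open>(M m)' = (\<Sum>j. \<omega> j * M (m - j))\<close> and \<open>U' = (\<Sum>j. \<omega> j)\<close>, so the derivative of \<open>exp (- U) * M m\<close> is
\<open>exp (- U)\<close> times \<open>\<Sum>j. \<omega> j * (M (m - j) - M m)\<close>. Used twice, this gives
\<open>M n / p n = exp U * (1 + S) + remainder\<close>. Here \<open>S\<close> is the linear term, equal to \<open>\<i> * t * C\<close> up to \<open>L2'\<close>, and the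
remainder is a double sum over \<open>i\<close> and \<open>j\<close> of mixed second differences of \<open>M\<close> (\<open>twist_expansion\<close>).
A mixed difference is small by smoothness over the smaller of \<open>i\<close> and \<open>j\<close>, and this suffices to split the double
sum into two single sums. Each is bounded by \<open>L\<^sub>p powr (1 / p)\<close> with Hoelder's inequality, because the
singularity \<open>(1 - j / n) powr (\<beta> - 1)\<close> of the weights, for \<open>\<beta>\<close> below the lower bound of \<open>d\<close>, has a summable power of
conjugate exponent exactly if \<open>\<beta> > 1 / p\<close> (\<open>weighted_bound_L_norm\<close>).

What has to be known about \<open>M\<close> is that, relative to \<open>p n\<close>, it decays in \<open>t\<close> like a Gaussian and is Hoelder
continuous in the index. Both come from absolute values. The factor \<open>(1 - z) powr (- \<beta>)\<close> is taken out
of the series; convolution with its coefficients smooths what is left (\<open>conv_kern_smooth\<close>), and majorising this remaining factor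
costs no more than \<open>exp (K * t\<^sup>2)\<close>, since \<open>norm (d * f - \<beta>)\<close> exceeds \<open>d - \<beta>\<close> only by a multiple of \<open>1 - Re f\<close>
(\<open>norm_tilt_le\<close>). For the decay, the phases of the lengths up to \<open>m * exp (- G * t\<^sup>2)\<close> are kept together in a
factor that is in effect evaluated at \<open>z = 1\<close>, where its modulus is explicit; the longer cycles cost little because
\<open>t * h j\<close> is small for most \<open>j\<close> (\<open>twist_decay\<close>). Interpolation between smoothness with the loss
\<open>exp (K * t\<^sup>2)\<close> and decay yields both at once (\<open>twist_smooth\<close>).

The transfer to distribution functions is Esseen's smoothing inequality (\<open>esseen_smoothing\<close>) for the law centred
at its approximate mean \<open>A + C\<close>, followed by a Taylor expansion of \<open>Phi\<close> at \<open>x\<close>, whose error \<open>C\<^sup>2\<close> is of the order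
\<open>L\<^sub>p powr (2 / p)\<close>.\<close>

section \<open>Coefficients of exponentials of power series\<close>

text \<open>The coefficients of \<open>exp (\<Sum>j\<ge>1. w j * z ^ j / j)\<close>, given by the recursion that results from
differentiating the exponential. The recursion makes sense over every normed field and raises no
question of convergence, and absolute values can be taken in it term by term.\<close>

fun ecoef :: "(nat \<Rightarrow> 'a::real_normed_field) \<Rightarrow> nat \<Rightarrow> 'a" where
  "ecoef w 0 = 1"
| "ecoef w (Suc m) = (\<Sum>j\<le>m. w (Suc j) * ecoef w (m - j)) / of_nat (Suc m)"

declare ecoef.simps(2) [simp del]

lemma ecoef_rec: "of_nat m * ecoef w m = (\<Sum>j=1..m. w j * ecoef w (m - j))"
proof (cases m)
  case (Suc k)
  have "(\<Sum>j=1..Suc k. w j * ecoef w (Suc k - j)) = (\<Sum>j\<le>k. w (Suc j) * ecoef w (k - j))"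
    by (rule sum.reindex_bij_witness[of _ Suc "\<lambda>j. j - 1"]) auto
  then show ?thesis using Suc by (simp add: ecoef.simps(2) del: of_nat_Suc)
qed simp

lemma ecoef_unique:
  assumes "x 0 = 1" "\<And>m. m \<ge> 1 \<Longrightarrow> of_nat m * x m = (\<Sum>j=1..m. w j * x (m - j))"
  shows "x m = ecoef w m"
proof (induction m rule: less_induct)
  case (less m)
  show ?case
  proof (cases "m = 0")
    case False
    have "of_nat m * x m = (\<Sum>j=1..m. w j * ecoef w (m - j))"
      using assms(2)[of m] False less.IH by (auto intro!: sum.cong)
    also have "\<dots> = of_nat m * ecoef w m" by (simp add: ecoef_rec)
    finally show ?thesis using False by simp
  qed (simp add: assms)
qed

lemma ecoef_cong:
  assumes "\<And>j. 1 \<le> j \<Longrightarrow> j \<le> m \<Longrightarrow> w j = w' j"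
  shows "ecoef w m = ecoef w' m"
  using assms
proof (induction m rule: less_induct)
  case (less m)
  have "of_nat m * ecoef w m = of_nat m * ecoef w' m"
    unfolding ecoef_rec using less by (intro sum.cong) auto
  then show ?case by (cases "m = 0") auto
qed

text \<open>The differential equation \<open>X' = W * X\<close> with \<open>X 0 = 1\<close> determines all coefficients. In this form the
recursion is recognised in products and compositions of formal power series.\<close>

lemma ecoef_unique_fps:
  assumes "fps_nth X 0 = 1" "fps_deriv X = Abs_fps (\<lambda>n. w (Suc n)) * X"
  shows "fps_nth X m = ecoef w m"
proof (rule ecoef_unique)
  fix m :: nat assume "m \<ge> 1"
  then obtain k where k: "m = Suc k" by (cases m) auto
  have "of_nat m * fps_nth X m = fps_nth (fps_deriv X) k" by (simp add: k)
  also have "\<dots> = (\<Sum>i=0..k. w (Suc i) * fps_nth X (k - i))"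
    unfolding assms(2) by (simp add: fps_mult_nth)
  also have "\<dots> = (\<Sum>j=1..m. w j * fps_nth X (m - j))"
    unfolding k by (rule sum.reindex_bij_witness[of _ "\<lambda>j. j - 1" Suc]) auto
  finally show "of_nat m * fps_nth X m = (\<Sum>j=1..m. w j * fps_nth X (m - j))" .
qed (simp add: assms)

lemma fps_deriv_ecoef:
  "fps_deriv (Abs_fps (ecoef w)) = Abs_fps (\<lambda>n. w (Suc n)) * Abs_fps (ecoef w)"
proof (rule fps_ext)
  fix n
  have "of_nat (Suc n) * ecoef w (Suc n) = (\<Sum>i=0..n. w (Suc i) * ecoef w (n - i))"
    by (simp add: ecoef.simps(2) atLeast0AtMost del: of_nat_Suc)
  then show "fps_nth (fps_deriv (Abs_fps (ecoef w))) n =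
      fps_nth (Abs_fps (\<lambda>n. w (Suc n)) * Abs_fps (ecoef w)) n"
    by (simp add: fps_mult_nth)
qed

lemma ecoef_add:
  "ecoef (\<lambda>j. u j + v j) m = (\<Sum>k\<le>m. ecoef u k * ecoef v (m - k))"
proof -
  have "fps_nth (Abs_fps (ecoef u) * Abs_fps (ecoef v)) m = ecoef (\<lambda>j. u j + v j) m"
  proof (rule ecoef_unique_fps)
    have "Abs_fps (\<lambda>n. u (Suc n) + v (Suc n)) = Abs_fps (\<lambda>n. u (Suc n)) + Abs_fps (\<lambda>n. v (Suc n))"
      by (rule fps_ext) simp
    then show "fps_deriv (Abs_fps (ecoef u) * Abs_fps (ecoef v)) =
        Abs_fps (\<lambda>n. u (Suc n) + v (Suc n)) * (Abs_fps (ecoef u) * Abs_fps (ecoef v))"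
      by (simp add: fps_deriv_ecoef algebra_simps)
  qed simp
  then show ?thesis by (simp add: fps_mult_nth atLeast0AtMost)
qed

lemma p_coeff_eq_ecoef: "p_coeff dd m = ecoef dd m"
  unfolding p_coeff_def
proof (rule ecoef_unique_fps)
  let ?a = "Abs_fps (\<lambda>i. if i = 0 then 0 else dd i / real i)"
  have "fps_deriv ?a = Abs_fps (\<lambda>n. dd (Suc n))"
    by (rule fps_ext) (simp add: field_simps del: of_nat_Suc)
  moreover have "fps_nth ?a 0 = 0" by simp
  ultimately show "fps_deriv (fps_exp 1 oo ?a) = Abs_fps (\<lambda>n. dd (Suc n)) * (fps_exp 1 oo ?a)"
    by (simp add: fps_compose_deriv mult.commute)
qed (simp add: fps_compose_nth)

lemma norm_ecoef_le:
  assumes "\<And>j. 1 \<le> j \<Longrightarrow> j \<le> m \<Longrightarrow> norm (w j) \<le> v j"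
  shows "norm (ecoef w m) \<le> ecoef v m"
  using assms
proof (induction m rule: less_induct)
  case (less m)
  have "real m * norm (ecoef w m) = norm (of_nat m * ecoef w m)"
    by (simp add: norm_mult)
  also have "\<dots> \<le> (\<Sum>j=1..m. norm (w j) * norm (ecoef w (m - j)))"
    unfolding ecoef_rec by (rule order_trans[OF norm_sum]) (simp add: norm_mult)
  also have "\<dots> \<le> (\<Sum>j=1..m. v j * ecoef v (m - j))"
  proof (intro sum_mono mult_mono less)
    fix j assume "j \<in> {1..m}"
    then show "0 \<le> v j" by (intro order_trans[OF norm_ge_zero less.prems]) auto
  qed (use less.prems in auto)
  also have "\<dots> = real m * ecoef v m" by (simp add: ecoef_rec)
  finally show ?case by (cases "m = 0") auto
qed

lemma ecoef_nonneg:
  assumes "\<And>j. 1 \<le> j \<Longrightarrow> j \<le> m \<Longrightarrow> (0::real) \<le> v j"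
  shows "0 \<le> ecoef v m"
proof -
  have "norm (ecoef v m) \<le> ecoef v m"
    by (rule norm_ecoef_le) (use assms in auto)
  then show ?thesis by simp
qed

lemma ecoef_mono:
  assumes "\<And>j. 1 \<le> j \<Longrightarrow> j \<le> m \<Longrightarrow> 0 \<le> u j \<and> u j \<le> (v j :: real)"
  shows "ecoef u m \<le> ecoef v m"
  using norm_ecoef_le[of m u v] assms by (smt (verit) real_norm_def)

lemma ecoef_of_real: "ecoef (\<lambda>j. of_real (w j) :: 'a::real_normed_field) m = of_real (ecoef w m)"
proof (rule sym, rule ecoef_unique)
  fix m :: nat
  have "(of_nat m :: 'a) * of_real (ecoef w m) = of_real (real m * ecoef w m)" by simp
  also have "\<dots> = (\<Sum>j=1..m. of_real (w j) * of_real (ecoef w (m - j)))"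
    unfolding ecoef_rec by simp
  finally show "(of_nat m :: 'a) * of_real (ecoef w m) = (\<Sum>j=1..m. of_real (w j) * of_real (ecoef w (m - j)))" .
qed simp

lemma ecoef_single:
  assumes "J \<ge> 1"
  shows "ecoef (\<lambda>i. if i = J then c else 0) m =
    (if J dvd m then (c / of_nat J) ^ (m div J) / fact (m div J) else 0)"
proof (rule sym, rule ecoef_unique)
  fix m :: nat assume m: "m \<ge> 1"
  let ?s = "\<lambda>m. if J dvd m then (c / of_nat J) ^ (m div J) / fact (m div J) else 0 :: 'a"
  have "(\<Sum>j=1..m. (if j = J then c else 0) * ?s (m - j)) =
      (\<Sum>j=1..m. if j = J then c * ?s (m - J) else 0)"
    by (intro sum.cong) auto
  also have "\<dots> = (if J \<le> m then c * ?s (m - J) else 0)" using assms by simp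
  also have "\<dots> = of_nat m * ?s m"
  proof (cases "J dvd m")
    case True
    then obtain q where q: "m = J * q" by auto
    with m obtain r where r: "q = Suc r" by (cases q) auto
    have mJ: "m - J = J * r" by (simp add: q r)
    have fr: "(fact (Suc r) :: 'a) = of_nat (Suc r) * fact r" by (simp del: of_nat_Suc)
    have nz: "(of_nat (Suc r) :: 'a) \<noteq> 0" "(of_nat J :: 'a) \<noteq> 0" using assms by (auto simp del: of_nat_Suc)
    have "of_nat (J * Suc r) * ((c / of_nat J) ^ Suc r / fact (Suc r)) = c * ((c / of_nat J) ^ r / fact r)"
      unfolding fr of_nat_mult power_Suc using nz by (simp add: field_simps del: of_nat_Suc)
    then show ?thesis using True assms m unfolding mJ unfolding q r
      by (simp del: of_nat_Suc of_nat_mult power_Suc fact_Suc)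
  next
    case False
    then have "\<not> (J dvd m - J \<and> J \<le> m)" using dvd_diffD1[of J m J] by (auto simp: dvd_minus_self)
    then show ?thesis using False by auto
  qed
  finally show "of_nat m * ?s m = (\<Sum>j=1..m. (if j = J then c else 0) * ?s (m - j))" by simp
qed simp

lemma ecoef_single_sums:
  fixes c :: "'a::{real_normed_field,banach}"
  assumes "J \<ge> 1"
  defines "w \<equiv> \<lambda>i. if i = J then c else 0"
  shows "summable (\<lambda>m. norm (ecoef w m))" "ecoef w sums exp (c / of_nat J)"
proof -
  have sm: "strict_mono (\<lambda>q. J * q)" using assms by (auto simp: strict_mono_def)
  have z: "ecoef w m = 0" if "m \<notin> range (\<lambda>q. J * q)" for m
  proof -
    have "\<not> J dvd m" using that by (auto simp: dvd_def image_def)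
    then show ?thesis unfolding w_def by (simp add: ecoef_single[OF assms(1)])
  qed
  have e: "ecoef w (J * q) = (c / of_nat J) ^ q /\<^sub>R fact q" for q
    unfolding w_def using assms(1)
    by (simp add: ecoef_single scaleR_conv_of_real divide_inverse mult.commute)
  show "ecoef w sums exp (c / of_nat J)"
    using sums_mono_reindex[OF sm, of "ecoef w" "exp (c / of_nat J)"] z exp_converges[of "c / of_nat J"]
    unfolding e by simp
  show "summable (\<lambda>m. norm (ecoef w m))"
    using summable_mono_reindex[OF sm, of "\<lambda>m. norm (ecoef w m)"] z summable_norm_exp[of "c / of_nat J"]
    unfolding e by simp
qed

lemma ecoef_zero: "ecoef (\<lambda>_. 0) m = (if m = 0 then 1 else 0)"
  by (rule sym, rule ecoef_unique) (auto intro!: sum.neutral)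

text \<open>For a polynomial exponent the series converges at \<open>z = 1\<close>: it is a finite Cauchy product of the
series of \<open>exp (w J * z ^ J / J)\<close>, one for each index in the support.\<close>

lemma ecoef_sums:
  fixes w :: "nat \<Rightarrow> 'a::{real_normed_field,banach}"
  assumes "\<And>j. j > N \<Longrightarrow> w j = 0"
  shows "summable (\<lambda>m. norm (ecoef w m))" "ecoef w sums exp (\<Sum>j=1..N. w j / of_nat j)"
proof -
  have "summable (\<lambda>m. norm (ecoef w m)) \<and> ecoef w sums exp (\<Sum>j=1..N. w j / of_nat j)"
    using assms
  proof (induction N arbitrary: w)
    case 0
    have e: "ecoef w = (\<lambda>m. if m = 0 then 1 else 0)"
      using ecoef_cong[of _ w "\<lambda>_. 0"] 0 by (auto simp: ecoef_zero fun_eq_iff)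
    have "(\<lambda>m. if m = 0 then 1 else 0 :: 'a) sums 1" using sums_single[of 0 "\<lambda>_. 1::'a"] by simp
    moreover have "summable (\<lambda>m. norm (if m = 0 then 1 else 0 :: 'a))"
      by (rule summable_finite[of "{0}"]) auto
    ultimately show ?case unfolding e by simp
  next
    case (Suc N)
    define u where "u j = (if j = Suc N then 0 else w j)" for j
    define s where "s j = (if j = Suc N then w (Suc N) else 0)" for j
    have u: "summable (\<lambda>m. norm (ecoef u m))" "ecoef u sums exp (\<Sum>j=1..N. u j / of_nat j)"
      using Suc.IH[of u] Suc.prems by (metis Suc_lessI u_def)+
    have s: "summable (\<lambda>m. norm (ecoef s m))" "ecoef s sums exp (w (Suc N) / of_nat (Suc N))"
      using ecoef_single_sums[of "Suc N" "w (Suc N)"] unfolding s_def[abs_def] by auto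
    have conv: "ecoef w m = (\<Sum>k\<le>m. ecoef u k * ecoef s (m - k))" for m
    proof -
      have "w = (\<lambda>j. u j + s j)" by (auto simp: u_def s_def)
      then show ?thesis by (metis ecoef_add)
    qed
    have "(\<Sum>j=1..N. u j / of_nat j) = (\<Sum>j=1..N. w j / of_nat j)"
      by (intro sum.cong) (auto simp: u_def)
    then have ex: "exp (\<Sum>j=1..N. u j / of_nat j) * exp (w (Suc N) / of_nat (Suc N)) =
        exp (\<Sum>j=1..Suc N. w j / of_nat j)"
      by (simp add: exp_add del: of_nat_Suc)
    have "(\<lambda>m. \<Sum>k\<le>m. ecoef u k * ecoef s (m - k)) sums
        ((\<Sum>k. ecoef u k) * (\<Sum>k. ecoef s k))"
      by (rule Cauchy_product_sums) (use u s in auto)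
    then have "ecoef w sums exp (\<Sum>j=1..Suc N. w j / of_nat j)"
      using sums_unique[OF u(2)] sums_unique[OF s(2)] ex by (simp add: conv[abs_def])
    moreover have "summable (\<lambda>m. norm (ecoef w m))"
    proof (rule summable_comparison_test')
      show "summable (\<lambda>m. \<Sum>k\<le>m. norm (ecoef u k) * norm (ecoef s (m - k)))"
        by (rule summable_Cauchy_product) (use u s in auto)
      show "norm (norm (ecoef w m)) \<le> (\<Sum>k\<le>m. norm (ecoef u k) * norm (ecoef s (m - k)))"
        if "m \<ge> 0" for m
        unfolding conv by (simp, rule order_trans[OF norm_sum]) (simp add: norm_mult)
    qed
    ultimately show ?case by blast
  qed
  then show "summable (\<lambda>m. norm (ecoef w m))" "ecoef w sums exp (\<Sum>j=1..N. w j / of_nat j)"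
    by auto
qed

abbreviation esum :: "(nat \<Rightarrow> real) \<Rightarrow> nat \<Rightarrow> real" where
  "esum v m \<equiv> (\<Sum>k\<le>m. ecoef v k)"

lemma esum_mono_index:
  assumes "\<And>j. (0::real) \<le> v j" "l \<le> m"
  shows "esum v l \<le> esum v m"
  by (rule sum_mono2) (use assms in \<open>auto intro: ecoef_nonneg\<close>)

text \<open>Cutting \<open>v\<close> off at \<open>m\<close> leaves the first \<open>m\<close> coefficients unchanged and makes the whole series
summable to the right-hand side.\<close>

lemma esum_le_exp:
  assumes "\<And>j. (0::real) \<le> v j"
  shows "esum v m \<le> exp (\<Sum>j=1..m. v j / real j)"
proof -
  define u where "u j = (if j \<le> m then v j else 0)" for j
  have u: "summable (\<lambda>k. norm (ecoef u k))" "ecoef u sums exp (\<Sum>j=1..m. u j / of_nat j)"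
    using ecoef_sums[of m u] by (auto simp: u_def)
  have nn: "0 \<le> ecoef u k" for k using assms by (intro ecoef_nonneg) (auto simp: u_def)
  have "esum v m = esum u m" by (intro sum.cong ecoef_cong) (auto simp: u_def)
  also have "\<dots> \<le> (\<Sum>k. ecoef u k)"
    by (rule sum_le_suminf) (use u nn in \<open>auto simp: sums_iff\<close>)
  also have "\<dots> = exp (\<Sum>j=1..m. u j / of_nat j)" using u(2) by (simp add: sums_iff)
  also have "(\<Sum>j=1..m. u j / of_nat j) = (\<Sum>j=1..m. v j / real j)"
    by (intro sum.cong) (auto simp: u_def)
  finally show ?thesis .
qed

lemma conv_sum_le:
  fixes m :: nat
  assumes "\<And>i. (0::real) \<le> a i" "\<And>i. (0::real) \<le> b i"
  shows "(\<Sum>k\<le>m. \<Sum>i\<le>k. a i * b (k - i)) \<le> (\<Sum>i\<le>m. a i) * (\<Sum>i\<le>m. b i)"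
proof -
  have "(\<Sum>k\<le>m. \<Sum>i\<le>k. a i * b (k - i)) = (\<Sum>(i,j)\<in>{(i,j). i + j \<le> m}. a i * b j)"
    by (simp add: sum.triangle_reindex_eq)
  also have "\<dots> \<le> (\<Sum>(i,j)\<in>{..m} \<times> {..m}. a i * b j)"
    by (rule sum_mono2) (auto simp: assms)
  also have "\<dots> = (\<Sum>i\<le>m. a i) * (\<Sum>i\<le>m. b i)" by (simp add: sum_product sum.cartesian_product)
  finally show ?thesis .
qed

lemma esum_add_le:
  assumes "\<And>j. (0::real) \<le> u j" "\<And>j. (0::real) \<le> v j"
  shows "esum (\<lambda>j. u j + v j) m \<le> esum u m * esum v m"
  unfolding ecoef_add by (intro conv_sum_le ecoef_nonneg assms)

text \<open>The recursion averages earlier coefficients, so a coefficient is at most of the order of their mean.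
This is the only pointwise information about nonnegative exponents that is available without any
regularity of \<open>v\<close>.\<close>

lemma ecoef_pointwise:
  assumes "\<And>j. 0 \<le> v j \<and> v j \<le> (E::real)" "k \<le> m"
  shows "real k * ecoef v k \<le> E * esum v m"
proof -
  have nn: "0 \<le> ecoef v k" for k using assms by (auto intro: ecoef_nonneg)
  have E: "0 \<le> E" using assms(1)[of 0] by linarith
  have "real k * ecoef v k \<le> (\<Sum>j=1..k. E * ecoef v (k - j))"
    unfolding ecoef_rec[of k v] using assms nn by (intro sum_mono mult_right_mono) auto
  also have "\<dots> = E * (\<Sum>j=1..k. ecoef v (k - j))" by (simp add: sum_distrib_left)
  also have "(\<Sum>j=1..k. ecoef v (k - j)) = (\<Sum>i<k. ecoef v i)"
    by (rule sum.reindex_bij_witness[of _ "\<lambda>i. k - i" "\<lambda>i. k - i"]) auto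
  also have "\<dots> \<le> esum v m" by (rule sum_mono2) (use assms nn in auto)
  finally show ?thesis using E by (simp add: mult_left_mono)
qed

section \<open>Convolution with the binomial series\<close>

lemma powr_le_linear:
  fixes y s :: real
  assumes "0 < y" "0 \<le> s" "s \<le> 1"
  shows "y powr s \<le> 1 + s * (y - 1)"
  using Youngs_inequality_0[of s "1 - s" y 1] assms by (simp add: algebra_simps)

lemma one_minus_le_powr:
  fixes x s :: real
  assumes "0 \<le> x" "0 \<le> s"
  shows "1 - s * x \<le> (1 + x) powr (- s)"
proof -
  have "s * ln (1 + x) \<le> s * x" using assms by (intro mult_left_mono ln_add_one_self_le_self) auto
  then have "1 - s * x \<le> 1 + (- s * ln (1 + x))" by simp
  also have "\<dots> \<le> exp (- s * ln (1 + x))" by (rule exp_ge_add_one_self)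
  finally show ?thesis using assms by (simp add: powr_def)
qed

text \<open>The coefficients of \<open>(1 - z) powr (- \<beta>)\<close>. For \<open>0 < \<beta> \<le> 1\<close> they decrease and are of the order
\<open>i powr (\<beta> - 1)\<close>; a general exponent inherits its regularity from the convolution with them.\<close>

abbreviation kern :: "real \<Rightarrow> nat \<Rightarrow> real" where
  "kern \<beta> \<equiv> ecoef (\<lambda>_. \<beta>)"

lemma kern_sum: "\<beta> * (\<Sum>k\<le>m. kern \<beta> k) = real (Suc m) * kern \<beta> (Suc m)"
proof -
  have "real (Suc m) * kern \<beta> (Suc m) = \<beta> * (\<Sum>j=1..Suc m. kern \<beta> (Suc m - j))"
    unfolding ecoef_rec by (simp only: sum_distrib_left)
  also have "(\<Sum>j=1..Suc m. kern \<beta> (Suc m - j)) = (\<Sum>k\<le>m. kern \<beta> k)"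
    by (rule sum.reindex_bij_witness[of _ "\<lambda>k. Suc m - k" "\<lambda>j. Suc m - j"]) auto
  finally show ?thesis by simp
qed

lemma kern_Suc: "kern \<beta> (Suc m) = kern \<beta> m * (real m + \<beta>) / (real m + 1)"
proof (cases m)
  case 0 then show ?thesis using kern_sum[of \<beta> 0] by simp
next
  case (Suc k)
  have "(real m + 1) * kern \<beta> (Suc m) = \<beta> * (\<Sum>k\<le>m. kern \<beta> k)"
    using kern_sum[of \<beta> m] by (simp add: algebra_simps)
  also have "\<dots> = (real m + \<beta>) * kern \<beta> m"
    using kern_sum[of \<beta> k] Suc by (simp add: algebra_simps)
  finally show ?thesis by (simp add: field_simps)
qed

context
  fixes \<beta> :: real
  assumes \<beta>: "0 < \<beta>" "\<beta> \<le> 1"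
begin

lemma kern_pos: "0 < kern \<beta> i"
  by (induction i) (use \<beta> in \<open>auto simp: kern_Suc intro!: divide_pos_pos mult_pos_pos add_nonneg_pos\<close>)

text \<open>This bound and \<open>kern_ge_powr\<close> compare quotients of consecutive values: those of the kernel are
\<open>1 - (1 - \<beta>) / (i + 1)\<close>, those of the power are \<open>(1 + x) powr (\<beta> - 1)\<close>, and Bernoulli's inequality
separates them.\<close>

lemma kern_le_powr: "kern \<beta> i \<le> (real i + 1) powr (\<beta> - 1)"
proof (induction i)
  case (Suc i)
  have "(real i + \<beta>) / (real i + 1) = 1 - (1 - \<beta>) * (1 / (real i + 1))" by (simp add: field_simps)
  also have "\<dots> \<le> (1 + 1 / (real i + 1)) powr (- (1 - \<beta>))"
    by (rule one_minus_le_powr) (use \<beta> in auto)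
  also have "1 + 1 / (real i + 1) = (real i + 2) / (real i + 1)" by (simp add: field_simps)
  finally have r: "(real i + \<beta>) / (real i + 1) \<le> ((real i + 2) / (real i + 1)) powr (\<beta> - 1)" by simp
  have "kern \<beta> (Suc i) = kern \<beta> i * ((real i + \<beta>) / (real i + 1))" by (simp add: kern_Suc)
  also have "\<dots> \<le> (real i + 1) powr (\<beta> - 1) * ((real i + 2) / (real i + 1)) powr (\<beta> - 1)"
    using Suc r \<beta> by (intro mult_mono) auto
  also have "\<dots> = (real (Suc i) + 1) powr (\<beta> - 1)"
    by (simp add: powr_mult[symmetric] add.commute)
  finally show ?case .
qed simp

lemma kern_ge_powr: "\<beta> * (real i + 1) powr (\<beta> - 1) \<le> kern \<beta> i"
proof (cases "i = 0")
  case False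
  have "\<beta> * real i powr (\<beta> - 1) \<le> kern \<beta> i" if "i \<ge> 1" for i
    using that
  proof (induction i rule: dec_induct)
    case base then show ?case using kern_Suc[of \<beta> 0] by simp
  next
    case (step i)
    have i: "0 < real i" using step by simp
    have "(real i / (real i + 1)) powr (1 - \<beta>) \<le> 1 + (1 - \<beta>) * (real i / (real i + 1) - 1)"
      by (rule powr_le_linear) (use \<beta> i in auto)
    also have "\<dots> = (real i + \<beta>) / (real i + 1)" by (simp add: field_simps)
    finally have r: "(real i / (real i + 1)) powr (1 - \<beta>) \<le> (real i + \<beta>) / (real i + 1)" .
    have "(real i + 1) powr (\<beta> - 1) = real i powr (\<beta> - 1) * (real i / (real i + 1)) powr (1 - \<beta>)"
      using i powr_minus_divide[of "real i + 1" "1 - \<beta>"] powr_add[of "real i" "\<beta> - 1" "1 - \<beta>"]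
      by (simp add: powr_divide)
    then have "\<beta> * (real i + 1) powr (\<beta> - 1) = \<beta> * real i powr (\<beta> - 1) * (real i / (real i + 1)) powr (1 - \<beta>)"
      by simp
    also have "\<dots> \<le> kern \<beta> i * ((real i + \<beta>) / (real i + 1))"
      using step.IH r kern_pos[of i] by (intro mult_mono) auto
    also have "\<dots> = kern \<beta> (Suc i)" by (simp add: kern_Suc)
    finally show ?case by (simp add: add.commute)
  qed
  moreover have "(real i + 1) powr (\<beta> - 1) \<le> real i powr (\<beta> - 1)"
    using False \<beta> by (intro powr_mono2') auto
  ultimately have "\<beta> * real i powr (\<beta> - 1) \<le> kern \<beta> i" "\<beta> * (real i + 1) powr (\<beta> - 1) \<le> \<beta> * real i powr (\<beta> - 1)"
    using False \<beta> by (auto intro!: mult_left_mono)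
  then show ?thesis by linarith
qed (use \<beta> in auto)

lemma kern_decrement:
  shows "0 \<le> kern \<beta> i - kern \<beta> (Suc i)" "kern \<beta> i - kern \<beta> (Suc i) \<le> (real i + 1) powr (\<beta> - 2)"
proof -
  have e: "kern \<beta> i - kern \<beta> (Suc i) = (1 - \<beta>) / (real i + 1) * kern \<beta> i"
    by (simp add: kern_Suc field_simps)
  show "0 \<le> kern \<beta> i - kern \<beta> (Suc i)" unfolding e using \<beta> kern_pos[of i] by simp
  have "(1 - \<beta>) / (real i + 1) * kern \<beta> i \<le> 1 / (real i + 1) * (real i + 1) powr (\<beta> - 1)"
    using \<beta> kern_pos[of i] kern_le_powr[of i] by (intro mult_mono divide_right_mono) auto
  also have "\<dots> = (real i + 1) powr (\<beta> - 2)"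
    using powr_mult_base[of "real i + 1" "\<beta> - 2"] by (simp add: field_simps)
  finally show "kern \<beta> i - kern \<beta> (Suc i) \<le> (real i + 1) powr (\<beta> - 2)" unfolding e .
qed

lemma kern_antimono: "i \<le> j \<Longrightarrow> kern \<beta> j \<le> kern \<beta> i"
  by (rule lift_Suc_antimono_le[of "kern \<beta>"]) (use kern_decrement in auto)

lemma kern_sum_le: "(\<Sum>i<j. kern \<beta> i) \<le> real j powr \<beta> / \<beta>"
proof (cases j)
  case (Suc m)
  have "\<beta> * (\<Sum>k<j. kern \<beta> k) = (real m + 1) * kern \<beta> (Suc m)"
    using kern_sum[of \<beta> m] Suc by (simp add: lessThan_Suc_atMost add.commute)
  also have "\<dots> \<le> (real m + 1) * (real m + 1) powr (\<beta> - 1)"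
    using kern_antimono[of m "Suc m"] kern_le_powr[of m] by (intro mult_left_mono) auto
  also have "\<dots> = real j powr \<beta>"
    using powr_mult_base[of "real j" "\<beta> - 1"] Suc by (simp add: add.commute)
  finally show ?thesis using \<beta> by (simp add: field_simps)
qed simp

lemma kern_diff_le:
  assumes "\<And>s. l \<le> s \<Longrightarrow> s < l + i \<Longrightarrow> (real s + 1) powr (\<beta> - 2) \<le> B"
  shows "kern \<beta> l - kern \<beta> (l + i) \<le> real i * B"
proof -
  have "kern \<beta> l - kern \<beta> (l + i) = (\<Sum>s=l..<l+i. kern \<beta> s - kern \<beta> (Suc s))"
    by (simp add: sum_Suc_diff'[of l "l+i" "\<lambda>s. - kern \<beta> s", simplified])
  also have "\<dots> \<le> (\<Sum>s=l..<l+i. B)"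
    using kern_decrement(2) assms by (intro sum_mono) (meson atLeastLessThan_iff order_trans)
  finally show ?thesis by simp
qed

context
  fixes E :: real and v :: "nat \<Rightarrow> real" and b :: "nat \<Rightarrow> complex"
  assumes v: "\<And>j. 0 \<le> v j \<and> v j \<le> E"
    and b: "\<And>k. norm (b k) \<le> ecoef v k"
begin

text \<open>The sum is split at \<open>m / 2\<close>. For small \<open>k\<close> the kernel is at its typical size
\<open>m powr (\<beta> - 1)\<close>; for large \<open>k\<close> the coefficient of the majorant is at most of the order of the mean of all
of them, and the kernel is summed.\<close>

lemma conv_kern_bound:
  "norm (\<Sum>k\<le>m. b k * of_real (kern \<beta> (m - k))) \<le>
     (2 + 2 * E / \<beta>) * (real m + 1) powr (\<beta> - 1) * esum v m"
proof -
  define M where "M = real m + 1"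
  have M: "M \<ge> 1" by (simp add: M_def)
  have g: "0 \<le> ecoef v k" for k using v by (auto intro: ecoef_nonneg)
  have E: "0 \<le> E" using v[of 0] by linarith
  have S: "0 \<le> esum v m" by (intro sum_nonneg g)
  have t: "norm (b k * of_real (kern \<beta> (m - k))) \<le>
      2 * M powr (\<beta> - 1) * ecoef v k + 2 * E * esum v m / M * kern \<beta> (m - k)" if k: "k \<le> m" for k
  proof (cases "2 * k \<le> m")
    case True
    have "kern \<beta> (m - k) \<le> (M / 2) powr (\<beta> - 1)"
      using True \<beta> by (intro order_trans[OF kern_le_powr] powr_mono2') (auto simp: M_def of_nat_diff)
    also have "\<dots> = M powr (\<beta> - 1) * 2 powr (1 - \<beta>)"
      using M by (simp add: powr_divide powr_diff field_simps)
    also have "\<dots> \<le> M powr (\<beta> - 1) * 2 powr 1" using \<beta> by (intro mult_left_mono powr_mono) auto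
    finally have "ecoef v k * kern \<beta> (m - k) \<le> ecoef v k * (2 * M powr (\<beta> - 1))"
      using g by (intro mult_left_mono) auto
    moreover have "norm (b k * of_real (kern \<beta> (m - k))) \<le> ecoef v k * kern \<beta> (m - k)"
      using b[of k] kern_pos[of "m - k"] by (simp add: norm_mult mult_right_mono)
    moreover have "0 \<le> 2 * E * esum v m / M * kern \<beta> (m - k)"
      using E S M kern_pos[of "m - k"] by simp
    ultimately show ?thesis by (simp add: mult_ac)
  next
    case False
    then have kM: "real k \<ge> M / 2" by (simp add: M_def)
    have "M / 2 * ecoef v k \<le> real k * ecoef v k" using kM g by (intro mult_right_mono)
    also have "\<dots> \<le> E * esum v m" using ecoef_pointwise[of v E k m] v k by blast
    finally have "ecoef v k \<le> 2 * E * esum v m / M" using M by (simp add: field_simps)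
    then have "norm (b k * of_real (kern \<beta> (m - k))) \<le> 2 * E * esum v m / M * kern \<beta> (m - k)"
      using b[of k] kern_pos[of "m - k"] unfolding norm_mult
      by (intro mult_mono) (auto intro: order_trans[OF g])
    then show ?thesis using g[of k] M by (smt (verit) mult_nonneg_nonneg powr_ge_zero)
  qed
  have "norm (\<Sum>k\<le>m. b k * of_real (kern \<beta> (m - k))) \<le>
      (\<Sum>k\<le>m. 2 * M powr (\<beta> - 1) * ecoef v k + 2 * E * esum v m / M * kern \<beta> (m - k))"
    by (intro sum_norm_le) (use t in auto)
  also have "\<dots> = 2 * M powr (\<beta> - 1) * esum v m + 2 * E * esum v m / M * (\<Sum>k\<le>m. kern \<beta> (m - k))"
    by (simp add: sum.distrib sum_distrib_left)
  also have "(\<Sum>k\<le>m. kern \<beta> (m - k)) = (\<Sum>k<Suc m. kern \<beta> k)"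
    by (rule sum.reindex_bij_witness[of _ "\<lambda>k. m - k" "\<lambda>k. m - k"]) auto
  also have "2 * M powr (\<beta> - 1) * esum v m + 2 * E * esum v m / M * (\<Sum>k<Suc m. kern \<beta> k) \<le>
      2 * M powr (\<beta> - 1) * esum v m + 2 * E * esum v m / M * (M powr \<beta> / \<beta>)"
    using kern_sum_le[of "Suc m"] E S M
    by (intro add_left_mono mult_left_mono divide_nonneg_nonneg mult_nonneg_nonneg) (auto simp: M_def add.commute)
  also have "\<dots> = (2 + 2 * E / \<beta>) * M powr (\<beta> - 1) * esum v m"
    using M \<beta> by (simp add: powr_diff field_simps)
  finally show ?thesis by (simp add: M_def)
qed

text \<open>Convolution with the kernel turns an arbitrary majorised sequence into one that is Hoelder continuous
of order \<open>\<beta>\<close> in the index, at the scale \<open>m\<close>. For small \<open>k\<close> this is the size \<open>i * m powr (\<beta> - 2)\<close> of the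
increments of the kernel. For large \<open>k\<close> the coefficients are bounded by their mean, and the differences
of the decreasing kernel telescope to its first \<open>i\<close> values, whose sum is of the order \<open>i powr \<beta>\<close>.\<close>

lemma conv_kern_smooth:
  assumes i: "i \<le> m"
  shows "norm ((\<Sum>k\<le>m. b k * of_real (kern \<beta> (m - k))) -
      (\<Sum>k\<le>m - i. b k * of_real (kern \<beta> (m - i - k)))) \<le>
     (16 + 8 * E / \<beta>) * (real i / (real m + 1)) powr \<beta> *
       (real (m - i) + 1) powr (\<beta> - 1) * esum v m"
proof -
  define M where "M = real m + 1"
  define Sm where "Sm = esum v m"
  define l where "l = m - i"
  define L where "L = real l + 1"
  let ?u = "\<lambda>m. \<Sum>k\<le>m. b k * of_real (kern \<beta> (m - k))"
  define G where "G = (real i / M) powr \<beta> * L powr (\<beta> - 1)"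
  have M: "M \<ge> 1" and L: "L \<ge> 1" "L \<le> M" and MeqL: "M = L + real i"
    using i by (auto simp: M_def L_def l_def of_nat_diff)
  have g: "0 \<le> ecoef v k" for k using v by (auto intro: ecoef_nonneg)
  have E: "0 \<le> E" using v[of 0] by linarith
  have S: "0 \<le> Sm" unfolding Sm_def by (intro sum_nonneg g)
  have Sl: "esum v l \<le> Sm" unfolding Sm_def using v by (intro esum_mono_index) (auto simp: l_def)
  have G: "0 \<le> G" by (simp add: G_def)
  have "norm (?u m - ?u l) \<le> (16 + 8 * E / \<beta>) * G * Sm"
  \<comment> \<open>a shift of the order of \<open>m\<close> leaves nothing to gain beyond the triangle inequality\<close>
  proof (cases "2 * real i \<ge> M")
    case True
    have "1 / 2 \<le> (1 / 2) powr \<beta>"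
      using powr_mono'[of \<beta> 1 "1/2"] \<beta> by simp
    also have "\<dots> \<le> (real i / M) powr \<beta>"
      using True M \<beta> by (intro powr_mono2) (auto simp: field_simps)
    finally have "1 / 2 * L powr (\<beta> - 1) \<le> G" unfolding G_def by (intro mult_right_mono) auto
    then have LG: "L powr (\<beta> - 1) \<le> 2 * G" by simp
    have "norm (?u m) \<le> (2 + 2 * E / \<beta>) * M powr (\<beta> - 1) * Sm"
      unfolding M_def Sm_def by (rule conv_kern_bound)
    also have "\<dots> \<le> (2 + 2 * E / \<beta>) * L powr (\<beta> - 1) * Sm"
      using M L E \<beta> S by (intro mult_right_mono mult_left_mono powr_mono2') auto
    finally have 1: "norm (?u m) \<le> (2 + 2 * E / \<beta>) * L powr (\<beta> - 1) * Sm" .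
    have "norm (?u l) \<le> (2 + 2 * E / \<beta>) * L powr (\<beta> - 1) * esum v l"
      using conv_kern_bound[of l] unfolding L_def .
    also have "\<dots> \<le> (2 + 2 * E / \<beta>) * L powr (\<beta> - 1) * Sm"
      using E \<beta> Sl by (intro mult_left_mono) auto
    finally have 2: "norm (?u l) \<le> (2 + 2 * E / \<beta>) * L powr (\<beta> - 1) * Sm" .
    have "norm (?u m - ?u l) \<le> (2 + 2 * E / \<beta>) * L powr (\<beta> - 1) * Sm + (2 + 2 * E / \<beta>) * L powr (\<beta> - 1) * Sm"
      by (rule order_trans[OF norm_triangle_ineq4 add_mono[OF 1 2]])
    also have "\<dots> = 2 * ((2 + 2 * E / \<beta>) * L powr (\<beta> - 1) * Sm)" by simp
    also have "\<dots> \<le> 2 * ((2 + 2 * E / \<beta>) * (2 * G) * Sm)"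
      using LG E \<beta> S by (intro mult_left_mono mult_right_mono) auto
    also have "\<dots> = (8 + 8 * E / \<beta>) * G * Sm" by (simp add: field_simps)
    also have "\<dots> \<le> (16 + 8 * E / \<beta>) * G * Sm"
      using S G by (intro mult_right_mono) auto
    finally show ?thesis .
  next
    case False
    then have i2: "2 * real i < M" by simp
    have Gi: "real i powr \<beta> / M \<le> G"
    proof -
      have "real i powr \<beta> / M = (real i / M) powr \<beta> * M powr (\<beta> - 1)"
        using M by (simp add: powr_divide powr_diff)
      also have "\<dots> \<le> G" unfolding G_def using L \<beta> by (intro mult_left_mono powr_mono2') auto
      finally show ?thesis .
    qed
    have Gi2: "real i * M powr (\<beta> - 2) \<le> G"
    proof -
      have "real i * M powr (\<beta> - 2) = (real i / M) powr 1 * M powr (\<beta> - 1)"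
        using M powr_mult_base[of M "\<beta> - 2"] by (simp add: field_simps)
      also have "\<dots> \<le> (real i / M) powr \<beta> * L powr (\<beta> - 1)"
        using L M i2 \<beta> by (intro mult_mono powr_mono2' powr_mono') auto
      finally show ?thesis by (simp add: G_def)
    qed
    have pw: "ecoef v k \<le> 4 * E * Sm / M" if k: "k \<le> m" "real k \<ge> M / 4" for k
    proof -
      have "M / 4 * ecoef v k \<le> real k * ecoef v k" using k g by (intro mult_right_mono) auto
      also have "\<dots> \<le> E * Sm" unfolding Sm_def using ecoef_pointwise[of v E k m] v k by blast
      finally show ?thesis using M by (simp add: field_simps)
    qed
    \<comment> \<open>the terms present in both sums: increments of the kernel\<close>
    have t: "norm (b k * of_real (kern \<beta> (l - k) - kern \<beta> (m - k))) \<le>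
        16 * G * ecoef v k + 4 * E * Sm / M * (kern \<beta> (l - k) - kern \<beta> (m - k))"
      if k: "k \<le> l" for k
    proof -
      have kd: "0 \<le> kern \<beta> (l - k) - kern \<beta> (m - k)"
        using kern_antimono[of "l - k" "m - k"] by (simp add: l_def)
      have n: "norm (b k * of_real (kern \<beta> (l - k) - kern \<beta> (m - k))) =
          norm (b k) * (kern \<beta> (l - k) - kern \<beta> (m - k))"
        using kd by (simp only: norm_mult norm_of_real abs_of_nonneg)
      show ?thesis
      proof (cases "2 * k \<le> l")
        case True
        have mk: "m - k = (l - k) + i" using k i by (simp add: l_def)
        have "(real s + 1) powr (\<beta> - 2) \<le> 16 * M powr (\<beta> - 2)" if s: "l - k \<le> s" for s
        proof -
          have "real s + 1 \<ge> M / 4" using s True i2 MeqL L k by (simp add: L_def)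
          then have "(real s + 1) powr (\<beta> - 2) \<le> (M / 4) powr (\<beta> - 2)"
            using \<beta> M by (intro powr_mono2') auto
          also have "\<dots> = M powr (\<beta> - 2) * 4 powr (2 - \<beta>)"
            using M by (simp add: powr_divide powr_diff field_simps)
          also have "\<dots> \<le> M powr (\<beta> - 2) * 4 powr 2" using \<beta> by (intro mult_left_mono powr_mono) auto
          finally show ?thesis by simp
        qed
        then have "kern \<beta> (l - k) - kern \<beta> (m - k) \<le> real i * (16 * M powr (\<beta> - 2))"
          unfolding mk by (intro kern_diff_le) auto
        also have "\<dots> \<le> 16 * G" using Gi2 by simp
        finally have "norm (b k) * (kern \<beta> (l - k) - kern \<beta> (m - k)) \<le> ecoef v k * (16 * G)"
          using b[of k] kd by (intro mult_mono) (auto intro: g)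
        moreover have "0 \<le> 4 * E * Sm / M * (kern \<beta> (l - k) - kern \<beta> (m - k))"
          using E S M kd by (intro mult_nonneg_nonneg divide_nonneg_nonneg) auto
        ultimately show ?thesis unfolding n by (simp add: mult_ac)
      next
        case False
        then have "ecoef v k \<le> 4 * E * Sm / M"
          using k i i2 MeqL L by (intro pw) (auto simp: l_def L_def)
        then have "norm (b k) * (kern \<beta> (l - k) - kern \<beta> (m - k)) \<le>
            4 * E * Sm / M * (kern \<beta> (l - k) - kern \<beta> (m - k))"
          using b[of k] kd by (intro mult_right_mono) auto
        then show ?thesis unfolding n using G g[of k] by (smt (verit) mult_nonneg_nonneg)
      qed
    qed
    \<comment> \<open>the terms of the longer sum only: the kernel at its first \<open>i\<close> arguments\<close>
    have t2: "norm (b k * of_real (kern \<beta> (m - k))) \<le> 4 * E * Sm / M * kern \<beta> (m - k)"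
      if k: "l < k" "k \<le> m" for k
    proof -
      have "ecoef v k \<le> 4 * E * Sm / M"
        using k i i2 MeqL L by (intro pw) (auto simp: l_def L_def)
      then show ?thesis using b[of k] kern_pos[of "m - k"] unfolding norm_mult
        by (intro mult_mono) (auto intro: order_trans[OF g])
    qed
    have lin: "(\<Sum>k\<le>l. X * f k + Y * h k) + (\<Sum>k\<in>{l<..m}. Y * q k) =
        X * (\<Sum>k\<le>l. f k) + Y * ((\<Sum>k\<le>l. h k) + (\<Sum>k\<in>{l<..m}. q k))"
      for X Y :: real and f h q :: "nat \<Rightarrow> real"
      by (simp add: sum.distrib sum_distrib_left ring_distribs)
    have nm: "norm (y - x) \<le> norm a + norm c" if "x - y = a - c" for x y a c :: complex
      using norm_triangle_ineq4[of a c] unfolding that[symmetric] by (simp add: norm_minus_commute)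
    have im: "{..m} = {..l} \<union> {l<..m}" by (auto simp: l_def)
    have split: "(\<Sum>k\<le>m. f k) = (\<Sum>k\<le>l. f k) + (\<Sum>k\<in>{l<..m}. f k)" for f :: "nat \<Rightarrow> 'b::comm_monoid_add"
      unfolding im by (rule sum.union_disjoint) auto
    have "?u l - ?u m = (\<Sum>k\<le>l. b k * of_real (kern \<beta> (l - k) - kern \<beta> (m - k))) -
        (\<Sum>k\<in>{l<..m}. b k * of_real (kern \<beta> (m - k)))"
      unfolding split by (simp add: algebra_simps sum_subtractf)
    from nm[OF this] have "norm (?u m - ?u l) \<le>
        norm (\<Sum>k\<le>l. b k * of_real (kern \<beta> (l - k) - kern \<beta> (m - k))) +
        norm (\<Sum>k\<in>{l<..m}. b k * of_real (kern \<beta> (m - k)))"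
      .
    also have "\<dots> \<le> (\<Sum>k\<le>l. 16 * G * ecoef v k + 4 * E * Sm / M * (kern \<beta> (l - k) - kern \<beta> (m - k)))
        + (\<Sum>k\<in>{l<..m}. 4 * E * Sm / M * kern \<beta> (m - k))"
      by (intro add_mono sum_norm_le) (use t t2 in auto)
    also have "\<dots> = 16 * G * esum v l + 4 * E * Sm / M *
        ((\<Sum>k\<le>l. kern \<beta> (l - k) - kern \<beta> (m - k)) + (\<Sum>k\<in>{l<..m}. kern \<beta> (m - k)))"
      by (rule lin)
    also have "\<dots> \<le> 16 * G * Sm + 4 * E * Sm / M * (2 * (real i powr \<beta> / \<beta>))"
    proof -
      have r: "(\<Sum>k\<le>l. kern \<beta> (l - k)) = (\<Sum>s\<le>l. kern \<beta> s)" for l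
        by (rule sum.reindex_bij_witness[of _ "\<lambda>k. l - k" "\<lambda>k. l - k"]) auto
      have q: "(\<Sum>k\<in>{l<..m}. kern \<beta> (m - k)) = (\<Sum>s<i. kern \<beta> s)"
        by (rule sum.reindex_bij_witness[of _ "\<lambda>s. m - s" "\<lambda>k. m - k"]) (use i in \<open>auto simp: l_def\<close>)
      have "(\<Sum>k\<le>l. kern \<beta> (m - k)) + (\<Sum>k\<in>{l<..m}. kern \<beta> (m - k)) = (\<Sum>s\<le>m. kern \<beta> s)"
        using split[of "\<lambda>k. kern \<beta> (m - k)"] r[of m] by simp
      moreover have "(\<Sum>s\<le>l. kern \<beta> s) \<le> (\<Sum>s\<le>m. kern \<beta> s)"
        by (rule sum_mono2) (use kern_pos in \<open>auto simp: l_def less_imp_le\<close>)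
      ultimately have "(\<Sum>k\<le>l. kern \<beta> (l - k) - kern \<beta> (m - k)) + (\<Sum>k\<in>{l<..m}. kern \<beta> (m - k))
          \<le> 2 * (\<Sum>s<i. kern \<beta> s)"
        using q r[of l] by (simp add: sum_subtractf)
      also have "\<dots> \<le> 2 * (real i powr \<beta> / \<beta>)" using kern_sum_le[of i] by simp
      finally have "(\<Sum>k\<le>l. kern \<beta> (l - k) - kern \<beta> (m - k)) + (\<Sum>k\<in>{l<..m}. kern \<beta> (m - k))
          \<le> 2 * (real i powr \<beta> / \<beta>)" .
      moreover have "0 \<le> 4 * E * Sm / M" using E S M by simp
      moreover have "0 \<le> 16 * G" using G by simp
      ultimately show ?thesis using Sl by (intro add_mono mult_left_mono)
    qed
    also have "\<dots> = 16 * G * Sm + 8 * E / \<beta> * Sm * (real i powr \<beta> / M)"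
      by (simp add: field_simps)
    also have "\<dots> \<le> 16 * G * Sm + 8 * E / \<beta> * Sm * G"
      using Gi E \<beta> S by (intro add_left_mono mult_left_mono) auto
    also have "\<dots> = (16 + 8 * E / \<beta>) * G * Sm" by (simp add: algebra_simps)
    finally show ?thesis .
  qed
  then show ?thesis by (simp add: G_def M_def L_def l_def Sm_def mult.assoc)
qed

end
end

section \<open>Finitely supported exponents and two-sided bounds\<close>

lemma powr_ratio:
  fixes X Y s :: real
  assumes "0 < X" "0 < Y"
  shows "X powr (s - 1) = (Y / X) powr (1 - s) * Y powr (s - 1)"
proof -
  have "(Y / X) powr (1 - s) = X powr (s - 1) / Y powr (s - 1)"
    using assms powr_minus_divide[of "Y / X" "s - 1"] by (simp add: powr_divide)
  then show ?thesis using assms by simp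
qed

lemma harmonic_diff_le:
  assumes "a \<le> b"
  shows "(\<Sum>j=a+1..b. 1 / real j) \<le> 1 + ln ((real b + 1) / (real a + 1))"
proof -
  have "(\<Sum>j=a+1..b. 1 / real j) \<le> 1 / (real a + 1) - 1 / (real b + 1) + ln ((real b + 1) / (real a + 1))"
    using assms
  proof (induction b rule: dec_induct)
    case (step b)
    have "ln (1 - 1 / (real b + 2)) \<le> - (1 / (real b + 2))"
      using ln_le_minus_one[of "1 - 1 / (real b + 2)"] by (simp add: field_simps)
    moreover have "1 - 1 / (real b + 2) = (real b + 1) / (real b + 2)" by (simp add: field_simps)
    ultimately have "1 / (real b + 2) \<le> ln (real b + 2) - ln (real b + 1)" by (simp add: ln_div)
    moreover have "(\<Sum>j=a+1..Suc b. 1 / real j) = (\<Sum>j=a+1..b. 1 / real j) + 1 / (real b + 1)"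
      using step by (simp add: add.commute)
    ultimately show ?case using step.IH by (simp add: ln_div add.commute)
  qed simp
  moreover have "1 / (real a + 1) \<le> 1" "0 \<le> 1 / (real b + 1)" by auto
  ultimately show ?thesis by linarith
qed

lemma sum_from_1_split:
  fixes x :: "nat \<Rightarrow> 'a::ab_group_add"
  assumes "m0 \<le> m"
  shows "(\<Sum>j=1..m. x j) = (\<Sum>j=1..m0. x j) + (\<Sum>j=m0+1..m. x j)"
  using sum.ub_add_nat[of 1 m0 x "m - m0"] assms by simp

context
  fixes v :: "nat \<Rightarrow> real" and E :: real and N :: nat
  assumes v: "\<And>j. 0 \<le> v j \<and> v j \<le> E" and supp: "\<And>j. j > N \<Longrightarrow> v j = 0"
begin

text \<open>Up to the factor \<open>exp (\<Sum>j. v j / j)\<close>, the coefficients are the law of \<open>\<Sum>j. j * Z j\<close> with independent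
Poisson variables \<open>Z j\<close> of mean \<open>v j / j\<close>. The expectation of this sum is \<open>\<Sum>j. v j \<le> E * N\<close>, whatever
the size of the exponent; the tail bounds below are Markov's inequality for it.\<close>

lemma finite_support_first_moment:
  "(\<Sum>k\<le>K. real k * ecoef v k) \<le> E * real N * exp (\<Sum>j=1..N. v j / real j)"
proof -
  define u where "u j = (if j = 0 then 0 else v j)" for j
  have E: "0 \<le> E" using v[of 0] by linarith
  have nn: "0 \<le> ecoef v k" for k using v by (auto intro: ecoef_nonneg)
  have su: "summable (\<lambda>m. norm (ecoef v m))" "ecoef v sums exp (\<Sum>j=1..N. v j / of_nat j)"
    using ecoef_sums[of N v] supp by auto
  have "real k * ecoef v k = (\<Sum>i\<le>k. u i * ecoef v (k - i))" for k
  proof -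
    have "(\<Sum>i\<le>k. u i * ecoef v (k - i)) = (\<Sum>i\<in>{1..k}. u i * ecoef v (k - i))"
      by (rule sum.mono_neutral_right) (auto simp: u_def)
    then show ?thesis unfolding ecoef_rec by (auto simp: u_def intro!: sum.cong)
  qed
  then have "(\<Sum>k\<le>K. real k * ecoef v k) = (\<Sum>k\<le>K. \<Sum>i\<le>k. u i * ecoef v (k - i))" by simp
  also have "\<dots> \<le> (\<Sum>i\<le>K. u i) * (\<Sum>i\<le>K. ecoef v i)"
    by (rule conv_sum_le) (use v nn in \<open>auto simp: u_def\<close>)
  also have "\<dots> \<le> (E * real N) * exp (\<Sum>j=1..N. v j / real j)"
  proof (rule mult_mono)
    have "(\<Sum>i\<le>K. u i) \<le> (\<Sum>i\<in>{..K} \<inter> {1..N}. u i)"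
      by (rule eq_refl, rule sum.mono_neutral_right) (use supp in \<open>auto simp: u_def\<close>)
    also have "\<dots> \<le> (\<Sum>i\<in>{..K} \<inter> {1..N}. E)" using v E by (intro sum_mono) (auto simp: u_def)
    also have "\<dots> \<le> (\<Sum>i\<in>{1..N}. E)" by (rule sum_mono2) (use E in auto)
    finally show "(\<Sum>i\<le>K. u i) \<le> E * real N" by (simp add: mult.commute)
    have "(\<Sum>i\<le>K. ecoef v i) \<le> (\<Sum>i. ecoef v i)"
      by (rule sum_le_suminf) (use su nn in \<open>auto simp: sums_iff\<close>)
    then show "(\<Sum>i\<le>K. ecoef v i) \<le> exp (\<Sum>j=1..N. v j / real j)" using su by (simp add: sums_iff)
  qed (use E nn in \<open>auto intro: sum_nonneg\<close>)
  finally show ?thesis .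
qed

lemma finite_support_tail:
  fixes a :: "nat \<Rightarrow> 'a::real_normed_vector"
  assumes "\<And>k. norm (a k) \<le> ecoef v k" "a sums A"
  shows "norm (A - (\<Sum>k\<le>m. a k)) \<le> E * real N * exp (\<Sum>j=1..N. v j / real j) / (real m + 1)"
proof -
  have nn: "0 \<le> ecoef v k" for k using v by (auto intro: ecoef_nonneg)
  have "(\<lambda>K. \<Sum>k\<le>K. a k) \<longlonglongrightarrow> A" using assms(2) by (simp add: sums_def_le)
  then have "(\<lambda>K. norm ((\<Sum>k\<le>K. a k) - (\<Sum>k\<le>m. a k))) \<longlonglongrightarrow> norm (A - (\<Sum>k\<le>m. a k))"
    by (intro tendsto_intros)
  then show ?thesis
  proof (rule LIMSEQ_le_const2, intro exI allI impI)
    fix K assume K: "m \<le> K"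
    have "(\<Sum>k\<le>K. a k) = (\<Sum>k\<le>m. a k) + (\<Sum>k\<in>{m<..K}. a k)"
      using K by (subst sum.union_disjoint[symmetric]) (auto intro!: sum.cong)
    then have "norm ((\<Sum>k\<le>K. a k) - (\<Sum>k\<le>m. a k)) = norm (\<Sum>k\<in>{m<..K}. a k)" by simp
    also have "\<dots> \<le> (\<Sum>k\<in>{m<..K}. real k * ecoef v k / (real m + 1))"
    proof (rule sum_norm_le)
      fix k assume k: "k \<in> {m<..K}"
      then have "(real m + 1) * ecoef v k \<le> real k * ecoef v k" using nn by (intro mult_right_mono) auto
      then have "ecoef v k \<le> real k * ecoef v k / (real m + 1)" by (simp add: field_simps)
      then show "norm (a k) \<le> real k * ecoef v k / (real m + 1)" using assms(1)[of k] by linarith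
    qed
    also have "\<dots> \<le> (\<Sum>k\<le>K. real k * ecoef v k / (real m + 1))"
      by (rule sum_mono2) (use nn in auto)
    also have "\<dots> = (\<Sum>k\<le>K. real k * ecoef v k) / (real m + 1)" by (simp add: sum_divide_distrib)
    also have "\<dots> \<le> E * real N * exp (\<Sum>j=1..N. v j / real j) / (real m + 1)"
      using finite_support_first_moment[of K] by (intro divide_right_mono) auto
    finally show "norm ((\<Sum>k\<le>K. a k) - (\<Sum>k\<le>m. a k)) \<le> E * real N * exp (\<Sum>j=1..N. v j / real j) / (real m + 1)" .
  qed
qed

text \<open>The recursion expresses a coefficient beyond the support through the \<open>N\<close> preceding ones, and Markov's
inequality bounds their total mass.\<close>

lemma finite_support_coef_decay:
  assumes "N < k"
  shows "real k * ecoef v k * (real k - real N) \<le> E * (E * real N * exp (\<Sum>j=1..N. v j / real j))"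
proof -
  have nn: "0 \<le> ecoef v k" for k using v by (auto intro: ecoef_nonneg)
  have E: "0 \<le> E" using v[of 0] by linarith
  have "real k * ecoef v k = (\<Sum>j\<in>{1..N}. v j * ecoef v (k - j))"
    unfolding ecoef_rec by (rule sum.mono_neutral_right) (use assms supp in auto)
  also have "\<dots> \<le> (\<Sum>j\<in>{1..N}. E * ecoef v (k - j))"
    using v nn by (intro sum_mono mult_right_mono) auto
  also have "\<dots> = E * (\<Sum>i\<in>{k-N..<k}. ecoef v i)"
    unfolding sum_distrib_left[symmetric]
    by (rule arg_cong[where f="\<lambda>x. E * x"], rule sum.reindex_bij_witness[of _ "\<lambda>i. k - i" "\<lambda>j. k - j"])
      (use assms in auto)
  finally have "real k * ecoef v k * (real k - real N) \<le> E * (\<Sum>i\<in>{k-N..<k}. ecoef v i) * (real k - real N)"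
    using assms by (intro mult_right_mono) auto
  also have "\<dots> = E * (\<Sum>i\<in>{k-N..<k}. (real k - real N) * ecoef v i)"
    by (simp add: sum_distrib_left mult_ac)
  also have "\<dots> \<le> E * (\<Sum>i\<in>{k-N..<k}. real i * ecoef v i)"
    using nn E assms by (intro mult_left_mono sum_mono mult_right_mono) auto
  also have "\<dots> \<le> E * (\<Sum>i\<le>k. real i * ecoef v i)"
    using nn E by (intro mult_left_mono sum_mono2) auto
  also have "\<dots> \<le> E * (E * real N * exp (\<Sum>j=1..N. v j / real j))"
    using finite_support_first_moment[of k] E by (intro mult_left_mono)
  finally show ?thesis .
qed

end

text \<open>The converse of \<open>esum_le_exp\<close> up to a constant. If the exponent is cut off at \<open>m / (2 * (E + 1))\<close>, the mean
length is at most \<open>m / 2\<close>, and Markov's inequality leaves half of the mass below \<open>m\<close>. The indices that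
were cut off add only a bounded amount to the exponent.\<close>

lemma esum_ge_exp:
  fixes E :: real
  assumes "0 \<le> E"
  obtains c where "0 < c" "\<And>v m. (\<And>j. 0 \<le> v j \<and> v j \<le> E) \<Longrightarrow>
    c * exp (\<Sum>j=1..m. v j / real j) \<le> esum v m"
proof
  define E' where "E' = E + 1"
  define W where "W = E * (1 + ln (2 * E' + 1))"
  define c where "c = exp (- W) / 2"
  show "0 < c" by (simp add: c_def)
  fix v :: "nat \<Rightarrow> real" and m :: nat
  assume v: "\<And>j. 0 \<le> v j \<and> v j \<le> E"
  define m1 where "m1 = nat \<lfloor>real m / (2 * E')\<rfloor>"
  have E': "1 \<le> E'" "E \<le> E'" using assms by (auto simp: E'_def)
  have m1: "real m1 \<le> real m / (2 * E')" "real m / (2 * E') < real m1 + 1"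
    using E' unfolding m1_def by (auto simp: of_nat_nat)
  have m1': "2 * E' * real m1 \<le> real m" "real m \<le> 2 * E' * (real m1 + 1)"
    using m1 E' by (auto simp: field_simps)
  have "real m1 \<le> 2 * E' * real m1" using E' mult_right_mono[of 1 "2 * E'" "real m1"] by simp
  then have m1m: "m1 \<le> m" using m1' by linarith
  define u where "u j = (if j \<le> m1 then v j else 0)" for j
  have u: "0 \<le> u j \<and> u j \<le> E" for j using v assms by (auto simp: u_def)
  define X where "X = exp (\<Sum>j=1..m1. u j / real j)"
  have X: "0 < X" by (simp add: X_def)
  have us: "ecoef u sums X" using ecoef_sums(2)[of m1 u] by (simp add: u_def X_def)
  have "norm (X - (\<Sum>k\<le>m. ecoef u k)) \<le> E * real m1 * exp (\<Sum>j=1..m1. u j / real j) / (real m + 1)"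
    by (rule finite_support_tail[of u E m1 "ecoef u" X m])
      (use u us in \<open>auto intro: ecoef_nonneg simp: u_def[abs_def] assms v\<close>)
  also have "\<dots> = (E * real m1 / (real m + 1)) * X" by (simp add: X_def)
  also have "\<dots> \<le> 1 / 2 * X"
  proof (rule mult_right_mono)
    have "2 * (E * real m1) \<le> 2 * E' * real m1" using E' by (simp add: mult_right_mono)
    then show "E * real m1 / (real m + 1) \<le> 1 / 2" using m1' by (simp add: field_simps)
  qed (use X in auto)
  finally have "X - esum u m \<le> 1 / 2 * X" unfolding real_norm_def abs_le_iff by blast
  then have "X / 2 \<le> esum u m" by simp
  also have "esum u m \<le> esum v m" using v by (intro sum_mono ecoef_mono) (auto simp: u_def)
  finally have 1: "X / 2 \<le> esum v m" .
  have "(\<Sum>j=1..m. v j / real j) = (\<Sum>j=1..m1. v j / real j) + (\<Sum>j=m1+1..m. v j / real j)"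
    by (rule sum_from_1_split[OF m1m])
  also have "(\<Sum>j=1..m1. v j / real j) = ln X" by (auto simp: X_def u_def intro!: sum.cong)
  also have "(\<Sum>j=m1+1..m. v j / real j) \<le> (\<Sum>j=m1+1..m. E * (1 / real j))"
    using v by (intro sum_mono) (auto simp: divide_right_mono)
  also have "\<dots> = E * (\<Sum>j=m1+1..m. 1 / real j)" by (simp add: sum_distrib_left)
  also have "\<dots> \<le> E * (1 + ln ((real m + 1) / (real m1 + 1)))"
    using harmonic_diff_le[OF m1m] assms by (intro mult_left_mono)
  also have "\<dots> \<le> E * (1 + ln (2 * E' + 1))"
  proof -
    have "real m + 1 \<le> (2 * E' + 1) * (real m1 + 1)" using m1'(2) by (simp add: algebra_simps)
    then have "(real m + 1) / (real m1 + 1) \<le> 2 * E' + 1" by (simp add: field_simps)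
    moreover have "0 < (real m + 1) / (real m1 + 1)" by simp
    ultimately have "ln ((real m + 1) / (real m1 + 1)) \<le> ln (2 * E' + 1)"
      using E' by (subst ln_le_cancel_iff) auto
    then show ?thesis using assms by (intro mult_left_mono add_left_mono)
  qed
  also have "\<dots> = W" by (simp add: W_def)
  finally have "(\<Sum>j=1..m. v j / real j) \<le> ln X + W" by simp
  then have "exp (\<Sum>j=1..m. v j / real j) \<le> exp (ln X + W)" by simp
  also have "\<dots> = X * exp W" using X by (simp add: exp_add)
  finally have "exp (\<Sum>j=1..m. v j / real j) \<le> X * exp W" .
  then have "c * exp (\<Sum>j=1..m. v j / real j) \<le> c * (X * exp W)"
    by (intro mult_left_mono) (auto simp: c_def)
  also have "\<dots> = X / 2" by (simp add: c_def exp_minus field_simps)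
  finally show "c * exp (\<Sum>j=1..m. v j / real j) \<le> esum v m" using 1 by linarith
qed

context
  fixes \<beta> D :: real and d :: "nat \<Rightarrow> real"
  assumes \<beta>: "0 < \<beta>" "\<beta> \<le> 1" and d: "\<And>j. \<beta> \<le> d j \<and> d j \<le> D"
begin

lemma ecoef_shift_conv: "ecoef d n = (\<Sum>k\<le>n. ecoef (\<lambda>j. d j - \<beta>) k * kern \<beta> (n - k))"
  using ecoef_add[of "\<lambda>j. d j - \<beta>" "\<lambda>_. \<beta>" n] by simp

text \<open>Together with the upper bound this determines the order of the coefficients: that of
\<open>n powr (\<beta> - 1)\<close> times a partial sum that increases with \<open>n\<close>. Quotients of coefficients are therefore
controlled without any regularity of \<open>d\<close>.\<close>

lemma ecoef_lower: "\<beta> * (real n + 1) powr (\<beta> - 1) * esum (\<lambda>j. d j - \<beta>) n \<le> ecoef d n"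
proof -
  have nn: "0 \<le> ecoef (\<lambda>j. d j - \<beta>) k" for k using d by (intro ecoef_nonneg) auto
  have "\<beta> * (real n + 1) powr (\<beta> - 1) * esum (\<lambda>j. d j - \<beta>) n =
      (\<Sum>k\<le>n. ecoef (\<lambda>j. d j - \<beta>) k * (\<beta> * (real n + 1) powr (\<beta> - 1)))"
    by (simp add: sum_distrib_left mult_ac)
  also have "\<dots> \<le> (\<Sum>k\<le>n. ecoef (\<lambda>j. d j - \<beta>) k * kern \<beta> (n - k))"
    using nn \<beta> by (intro sum_mono mult_left_mono order_trans[OF kern_ge_powr kern_antimono]) auto
  finally show ?thesis by (simp add: ecoef_shift_conv)
qed

lemma ecoef_upper: "ecoef d n \<le> (2 + 2 * D / \<beta>) * (real n + 1) powr (\<beta> - 1) * esum (\<lambda>j. d j - \<beta>) n"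
proof -
  have nn: "0 \<le> ecoef (\<lambda>j. d j - \<beta>) k" for k using d by (intro ecoef_nonneg) auto
  have b: "0 \<le> d j - \<beta> \<and> d j - \<beta> \<le> D" for j using d[of j] \<beta> by auto
  have "norm (\<Sum>k\<le>n. complex_of_real (ecoef (\<lambda>j. d j - \<beta>) k) * of_real (kern \<beta> (n - k))) \<le>
     (2 + 2 * D / \<beta>) * (real n + 1) powr (\<beta> - 1) * esum (\<lambda>j. d j - \<beta>) n"
    by (rule conv_kern_bound[OF \<beta> b]) (use nn in auto)
  also have "(\<Sum>k\<le>n. complex_of_real (ecoef (\<lambda>j. d j - \<beta>) k) * of_real (kern \<beta> (n - k))) = of_real (ecoef d n)"
    by (simp add: ecoef_shift_conv)
  finally show ?thesis by simp
qed

lemma ecoef_ratio_le: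
  assumes "m \<le> n"
  shows "ecoef d m \<le> (2 + 2 * D / \<beta>) / \<beta> * ((real n + 1) / (real m + 1)) powr (1 - \<beta>) * ecoef d n"
proof -
  have D: "0 \<le> D" using d[of 0] \<beta> by linarith
  have "ecoef d m \<le> (2 + 2 * D / \<beta>) * (real m + 1) powr (\<beta> - 1) * esum (\<lambda>j. d j - \<beta>) m"
    by (rule ecoef_upper)
  also have "\<dots> \<le> (2 + 2 * D / \<beta>) * (real m + 1) powr (\<beta> - 1) * esum (\<lambda>j. d j - \<beta>) n"
    using D \<beta> d assms by (intro mult_left_mono esum_mono_index) auto
  also have "\<dots> = (2 + 2 * D / \<beta>) / \<beta> * ((real n + 1) / (real m + 1)) powr (1 - \<beta>) *
      (\<beta> * (real n + 1) powr (\<beta> - 1) * esum (\<lambda>j. d j - \<beta>) n)"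
    using \<beta> powr_ratio[of "real m + 1" "real n + 1" \<beta>] by simp
  also have "\<dots> \<le> (2 + 2 * D / \<beta>) / \<beta> * ((real n + 1) / (real m + 1)) powr (1 - \<beta>) * ecoef d n"
    using D \<beta> by (intro mult_left_mono ecoef_lower) auto
  finally show ?thesis .
qed

end

section \<open>Absolute bounds for twisted coefficients\<close>

text \<open>The triangle inequality would lose a term of the order \<open>norm (1 - f)\<close>, which is of first order in the
argument of \<open>f\<close>. The computation with squares loses only a multiple of \<open>1 - Re f\<close>, which is of second
order, so that passing to absolute values costs a Gaussian factor and no more. The subtracted \<open>\<beta>\<close> has to
stay strictly below \<open>x\<close>.\<close>

lemma norm_tilt_le:
  fixes f :: complex
  assumes "0 < \<beta>" "\<beta> < \<theta>" "\<theta> \<le> x" "norm f \<le> 1"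
  shows "norm (of_real x * f - of_real \<beta>) \<le> (x - \<beta>) + \<beta> / (\<theta> - \<beta>) * (x * (1 - Re f))"
proof (rule power2_le_imp_le)
  define y where "y = x * (1 - Re f)"
  have y: "0 \<le> y" using assms complex_Re_le_cmod[of f] by (auto simp: y_def)
  have f2: "(Re f)\<^sup>2 + (Im f)\<^sup>2 \<le> 1"
    using assms(4) by (metis cmod_power2 norm_ge_zero power_le_one)
  have "(norm (of_real x * f - of_real \<beta>))\<^sup>2 = x\<^sup>2 * ((Re f)\<^sup>2 + (Im f)\<^sup>2) - 2 * \<beta> * x * Re f + \<beta>\<^sup>2"
    unfolding cmod_power2 by (simp add: power2_eq_square algebra_simps)
  also have "\<dots> \<le> x\<^sup>2 * 1 - 2 * \<beta> * x * Re f + \<beta>\<^sup>2"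
    using f2 by (intro add_right_mono diff_right_mono mult_left_mono) auto
  also have "\<dots> = (x - \<beta>)\<^sup>2 + 2 * \<beta> * y" by (simp add: y_def power2_eq_square algebra_simps)
  also have "\<dots> \<le> (x - \<beta>)\<^sup>2 + 2 * (\<beta> * (x - \<beta>) / (\<theta> - \<beta>)) * y"
  proof -
    have "\<beta> * 1 \<le> \<beta> * ((x - \<beta>) / (\<theta> - \<beta>))" using assms by (intro mult_left_mono) auto
    then show ?thesis using y by (intro add_left_mono mult_right_mono mult_left_mono) auto
  qed
  also have "\<dots> = (x - \<beta>)\<^sup>2 + 2 * (x - \<beta>) * (\<beta> / (\<theta> - \<beta>) * y)" by simp
  also have "\<dots> \<le> ((x - \<beta>) + \<beta> / (\<theta> - \<beta>) * y)\<^sup>2"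
    unfolding power2_sum by simp
  finally show "(norm (of_real x * f - of_real \<beta>))\<^sup>2 \<le> ((x - \<beta>) + \<beta> / (\<theta> - \<beta>) * (x * (1 - Re f)))\<^sup>2"
    by (simp add: y_def)
  show "0 \<le> (x - \<beta>) + \<beta> / (\<theta> - \<beta>) * (x * (1 - Re f))"
    using assms y by (auto simp: y_def)
qed

text \<open>With \<open>d\<close> the weights of the cycle lengths, \<open>twist d f n / ecoef d n\<close> is the mean of
\<open>\<Prod>j. f j ^ cycle_count n j \<sigma>\<close> over the weighted permutations of \<open>n\<close> points.\<close>

definition twist :: "(nat \<Rightarrow> real) \<Rightarrow> (nat \<Rightarrow> complex) \<Rightarrow> nat \<Rightarrow> complex" where
  "twist d f = ecoef (\<lambda>j. of_real (d j) * f j)"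

text \<open>The modulus of \<open>exp (\<Sum>j=1..k. d j * (f j - 1) / j)\<close> is \<open>exp (- defect d f k)\<close>: this is how much the
lengths up to \<open>k\<close> would damp the mean if their cycle counts were independent Poisson variables.\<close>

definition defect :: "(nat \<Rightarrow> real) \<Rightarrow> (nat \<Rightarrow> complex) \<Rightarrow> nat \<Rightarrow> real" where
  "defect d f k = (\<Sum>j=1..k. d j * (1 - Re (f j)) / real j)"

text \<open>A first-moment substitute for Jensen's inequality: the moment of order \<open>s\<close> follows from the mean once
\<open>y\<close> is put at the scale of the variable.\<close>

lemma powr_le_linear_split:
  fixes x y s :: real
  assumes "0 < y" "0 \<le> x" "0 \<le> s" "s \<le> 1"
  shows "x powr s \<le> y powr s + x * y powr (s - 1)"
proof (cases "x \<le> y")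
  case True
  then show ?thesis using assms powr_mono2[of s x y] by (simp add: add_increasing2)
next
  case False
  then have "x powr s = x * x powr (s - 1)" using assms powr_mult_base[of x "s - 1"] by simp
  also have "\<dots> \<le> x * y powr (s - 1)"
    using False assms by (intro mult_left_mono powr_mono2') auto
  finally show ?thesis by (simp add: add_increasing)
qed

lemma sum_powr_le:
  assumes "0 < \<beta>" "\<beta> \<le> 1"
  shows "(\<Sum>k\<le>m. (real (m - k) + 1) powr (\<beta> - 1)) \<le> (real m + 1) powr \<beta> / \<beta>\<^sup>2"
proof -
  have "(\<Sum>k\<le>m. (real (m - k) + 1) powr (\<beta> - 1)) = (\<Sum>k<Suc m. (real k + 1) powr (\<beta> - 1))"
    by (rule sum.reindex_bij_witness[of _ "\<lambda>i. m - i" "\<lambda>j. m - j"]) auto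
  also have "\<dots> \<le> (\<Sum>k<Suc m. kern \<beta> k / \<beta>)"
    using kern_ge_powr[OF assms] assms by (intro sum_mono) (simp add: field_simps)
  also have "\<dots> = (\<Sum>k<Suc m. kern \<beta> k) / \<beta>" by (simp only: sum_divide_distrib)
  also have "\<dots> \<le> (real (Suc m) powr \<beta> / \<beta>) / \<beta>"
    using kern_sum_le[OF assms, of "Suc m"] assms by (intro divide_right_mono) (auto simp del: sum.lessThan_Suc)
  finally show ?thesis by (simp add: power2_eq_square add.commute)
qed

context
  fixes \<beta> \<theta> D :: real
  assumes params: "0 < \<beta>" "\<beta> < \<theta>" "\<theta> \<le> 1" "\<theta> \<le> D"
begin

text \<open>The loss per unit of defect when absolute values are taken after removal of the factor
\<open>(1 - z) powr (- \<beta>)\<close>, and a bound on the resulting majorant \<open>tiltv\<close>.\<close>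

definition tiltc :: real where "tiltc = \<beta> / (\<theta> - \<beta>)"
definition tiltE :: real where "tiltE = D * (1 + 2 * tiltc)"

lemma tiltc_pos: "0 < tiltc" using params by (auto simp: tiltc_def)
lemma tiltE_ge: "D \<le> tiltE" "0 < tiltE"
  using params tiltc_pos by (auto simp: tiltE_def algebra_simps intro!: add_pos_pos mult_pos_pos)

definition decayC :: real where
  "decayC = (2 + 2 * tiltE / \<beta>) * (1 + tiltE) +
     (16 + 8 * tiltE / \<beta>) * (2 * (1 + tiltE) + 8 * tiltE\<^sup>2 / \<beta>\<^sup>2)"

lemma decayC_nonneg: "0 \<le> decayC"
  using tiltE_ge params unfolding decayC_def
  by (intro add_nonneg_nonneg mult_nonneg_nonneg divide_nonneg_nonneg) auto

context
  fixes d :: "nat \<Rightarrow> real" and f :: "nat \<Rightarrow> complex"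
  assumes d: "\<And>j. \<theta> \<le> d j \<and> d j \<le> D" and f: "\<And>j. norm (f j) \<le> 1"
begin

text \<open>The majorant of \<open>norm (d j * f j - \<beta>)\<close> that \<open>norm_tilt_le\<close> provides.\<close>

definition tiltv :: "nat \<Rightarrow> real" where
  "tiltv j = (d j - \<beta>) + tiltc * (d j * (1 - Re (f j)))"

lemma one_minus_Re: "0 \<le> 1 - Re (f j)" "1 - Re (f j) \<le> 2"
  using complex_Re_le_cmod[of "f j"] complex_Re_le_cmod[of "- f j"] f[of j] by auto

lemma tiltv_bounds: "0 \<le> tiltv j \<and> tiltv j \<le> tiltE"
proof
  have dj: "0 \<le> d j" "\<beta> \<le> d j" "d j \<le> D" using d[of j] params by auto
  show "0 \<le> tiltv j" unfolding tiltv_def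
    using dj tiltc_pos one_minus_Re by (intro add_nonneg_nonneg mult_nonneg_nonneg) auto
  have "tiltc * (d j * (1 - Re (f j))) \<le> tiltc * (D * 2)"
    using dj tiltc_pos one_minus_Re by (intro mult_left_mono mult_mono) auto
  then show "tiltv j \<le> tiltE" unfolding tiltv_def tiltE_def using dj params by (simp add: algebra_simps)
qed

lemma norm_tilt_le_tiltv: "norm (of_real (d j) * f j - of_real \<beta>) \<le> tiltv j"
  unfolding tiltv_def tiltc_def using params d[of j] f[of j] by (intro norm_tilt_le) auto

lemma defect_mono: "k \<le> l \<Longrightarrow> defect d f k \<le> defect d f l"
  unfolding defect_def
  by (rule sum_mono2) (use one_minus_Re d params in \<open>auto intro!: divide_nonneg_nonneg mult_nonneg_nonneg intro: order_trans[of 0 \<theta>]\<close>)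

lemma sum_tiltv: "(\<Sum>j=1..k. tiltv j / real j) = (\<Sum>j=1..k. (d j - \<beta>) / real j) + tiltc * defect d f k"
  by (simp add: tiltv_def defect_def add_divide_distrib sum.distrib sum_distrib_left)

lemma esum_tiltv_le: "esum tiltv m \<le> esum (\<lambda>j. d j - \<beta>) m * exp (tiltc * defect d f m)"
proof -
  have nn: "0 \<le> d j - \<beta>" "0 \<le> tiltc * (d j * (1 - Re (f j)))" for j
    using d[of j] params tiltc_pos one_minus_Re[of j] by auto
  have "esum tiltv m \<le> esum (\<lambda>j. d j - \<beta>) m * esum (\<lambda>j. tiltc * (d j * (1 - Re (f j)))) m"
    using esum_add_le[of "\<lambda>j. d j - \<beta>" "\<lambda>j. tiltc * (d j * (1 - Re (f j)))" m] nn
    by (simp add: tiltv_def[abs_def])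
  also have "\<dots> \<le> esum (\<lambda>j. d j - \<beta>) m * exp (\<Sum>j=1..m. tiltc * (d j * (1 - Re (f j))) / real j)"
    using nn by (intro mult_left_mono esum_le_exp sum_nonneg ecoef_nonneg) auto
  also have "(\<Sum>j=1..m. tiltc * (d j * (1 - Re (f j))) / real j) = tiltc * defect d f m"
    by (simp add: defect_def sum_distrib_left)
  finally show ?thesis .
qed

lemma norm_twist_le: "norm (twist d f m) \<le> ecoef d m"
  unfolding twist_def
proof (rule norm_ecoef_le)
  fix j
  have "norm (complex_of_real (d j) * f j) = d j * norm (f j)"
    using d[of j] params by (simp add: norm_mult)
  then show "norm (complex_of_real (d j) * f j) \<le> d j"
    using f[of j] d[of j] params mult_left_mono[of "norm (f j)" 1 "d j"] by simp
qed

lemma ecoef_d_pos: "0 < ecoef d m"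
proof -
  have b: "\<beta> \<le> d j \<and> d j \<le> D" for j using d[of j] params by auto
  have "0 < \<beta> * (real m + 1) powr (\<beta> - 1)" using params by simp
  also have "\<dots> \<le> \<beta> * (real m + 1) powr (\<beta> - 1) * esum (\<lambda>j. d j - \<beta>) m"
  proof -
    have "1 \<le> esum (\<lambda>j. d j - \<beta>) m"
      using esum_mono_index[of "\<lambda>j. d j - \<beta>" 0 m] b by simp
    then show ?thesis using mult_left_mono[of 1 "esum (\<lambda>j. d j - \<beta>) m" "\<beta> * (real m + 1) powr (\<beta> - 1)"] params by simp
  qed
  also have "\<dots> \<le> ecoef d m" by (rule ecoef_lower) (use params b in auto)
  finally show ?thesis .
qed

lemma twist_conv:
  "twist d f m = (\<Sum>k\<le>m. ecoef (\<lambda>j. of_real (d j) * f j - of_real \<beta>) k * of_real (kern \<beta> (m - k)))"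
  using ecoef_add[of "\<lambda>j. of_real (d j) * f j - of_real \<beta>" "\<lambda>_. complex_of_real \<beta>" m]
  by (simp add: twist_def ecoef_of_real)

text \<open>Smoothness in the index by absolute values alone: the factor \<open>(1 - z) powr (- \<beta>)\<close> is taken out, the
remaining exponent is replaced by \<open>tiltv\<close>, and the convolution with the kernel smooths. The price is the
factor \<open>exp (tiltc * defect)\<close>, which \<open>twist_smooth\<close> compensates by decay.\<close>

lemma twist_crude_smooth:
  assumes "i \<le> m" "m \<le> n"
  shows "norm (twist d f m - twist d f (m - i)) \<le>
    (16 + 8 * tiltE / \<beta>) / \<beta> * (real i / (real m + 1)) powr \<beta> *
      ((real n + 1) / (real (m - i) + 1)) powr (1 - \<beta>) * ecoef d n * exp (tiltc * defect d f n)"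
proof -
  have b: "\<beta> \<le> d j \<and> d j \<le> D" "0 \<le> d j - \<beta>" for j using d[of j] params by auto
  define K where "K = 16 + 8 * tiltE / \<beta>"
  have K: "0 < K" using tiltE_ge params by (simp add: K_def add_pos_pos)
  define X where "X = (real i / (real m + 1)) powr \<beta>"
  define l where "l = real (m - i) + 1"
  have l: "0 < l" by (simp add: l_def)
  have "norm (twist d f m - twist d f (m - i)) \<le> K * X * l powr (\<beta> - 1) * esum tiltv m"
    unfolding twist_conv K_def X_def l_def
    by (rule conv_kern_smooth[OF _ _ tiltv_bounds _ assms(1)])
       (use params norm_tilt_le_tiltv in \<open>auto intro: norm_ecoef_le\<close>)
  also have "\<dots> \<le> K * X * l powr (\<beta> - 1) * (esum (\<lambda>j. d j - \<beta>) n * exp (tiltc * defect d f n))"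
  proof (rule mult_left_mono)
    have "esum tiltv m \<le> esum tiltv n" using tiltv_bounds assms by (intro esum_mono_index) auto
    also have "\<dots> \<le> esum (\<lambda>j. d j - \<beta>) n * exp (tiltc * defect d f n)" by (rule esum_tiltv_le)
    finally show "esum tiltv m \<le> esum (\<lambda>j. d j - \<beta>) n * exp (tiltc * defect d f n)" .
  qed (use K in \<open>auto simp: X_def\<close>)
  also have "\<dots> = K / \<beta> * X * ((real n + 1) / l) powr (1 - \<beta>) * exp (tiltc * defect d f n) *
      (\<beta> * (real n + 1) powr (\<beta> - 1) * esum (\<lambda>j. d j - \<beta>) n)"
    using powr_ratio[of l "real n + 1" \<beta>] l params by simp
  also have "\<dots> \<le> K / \<beta> * X * ((real n + 1) / l) powr (1 - \<beta>) * exp (tiltc * defect d f n) * ecoef d n"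
    using K params b by (intro mult_left_mono ecoef_lower) (auto simp: X_def)
  finally show ?thesis by (simp add: K_def X_def l_def mult_ac)
qed

text \<open>The error when the coefficients of an exponent supported on \<open>{1..m0}\<close> are regarded as a point mass at \<open>0\<close>,
measured by the modulus of continuity of \<open>conv_kern_smooth\<close>. Up to \<open>m / 2\<close> the first moment applies;
beyond, the coefficients are of the order \<open>m0 / m\<^sup>2\<close>.\<close>

lemma finite_support_weighted_sum:
  assumes v: "\<And>j. 0 \<le> v j \<and> v j \<le> tiltE" and supp: "\<And>j. j > m0 \<Longrightarrow> v j = 0"
    and m0: "4 * m0 \<le> m"
  defines "X \<equiv> exp (\<Sum>j=1..m0. v j / real j)"
  shows "(\<Sum>k\<le>m. ecoef v k * (real k powr \<beta> * (real (m - k) + 1) powr (\<beta> - 1))) \<le>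
    (2 * (1 + tiltE) + 8 * tiltE\<^sup>2 / \<beta>\<^sup>2) * real m0 powr \<beta> * (real m + 1) powr (\<beta> - 1) * X"
proof (cases "m0 = 0")
  case True
  have "ecoef v k = (if k = 0 then 1 else 0)" for k
    using ecoef_cong[of k v "\<lambda>_. 0"] supp True by (auto simp: ecoef_zero)
  then show ?thesis using True by (simp add: sum.neutral)
next
  case False
  define M where "M = real m + 1"
  define E where "E = tiltE"
  define n0 where "n0 = real m0"
  have n0: "n0 \<ge> 1" "4 * n0 < M" using False m0 by (auto simp: n0_def M_def)
  have E: "0 < E" using tiltE_ge by (simp add: E_def)
  have X: "0 < X" by (simp add: X_def)
  have nn: "0 \<le> ecoef v k" for k using v by (auto intro: ecoef_nonneg)
  have fm: "(\<Sum>k\<le>m. real k * ecoef v k) \<le> E * n0 * X"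
    using finite_support_first_moment[of v tiltE m0 m] v supp by (simp add: X_def E_def n0_def)
  have tot: "(\<Sum>k\<le>m. ecoef v k) \<le> X"
  proof -
    have "esum v m \<le> (\<Sum>k. ecoef v k)"
      by (rule sum_le_suminf) (use ecoef_sums(1)[of m0 v] supp nn in auto)
    then show ?thesis using ecoef_sums(2)[of m0 v] supp by (simp add: sums_iff X_def)
  qed
  define B where "B = 8 * E\<^sup>2 * n0 * X / M\<^sup>2 * M powr \<beta>"
  have B: "0 \<le> B" using n0 X by (simp add: B_def)
  have t: "ecoef v k * (real k powr \<beta> * (real (m - k) + 1) powr (\<beta> - 1)) \<le>
      2 * M powr (\<beta> - 1) * (n0 powr \<beta> * ecoef v k + n0 powr (\<beta> - 1) * (real k * ecoef v k)) +
      B * (real (m - k) + 1) powr (\<beta> - 1)" if k: "k \<le> m" for k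
  proof (cases "2 * k \<le> m")
    case True
    have "(real (m - k) + 1) powr (\<beta> - 1) \<le> (M / 2) powr (\<beta> - 1)"
      using True params by (intro powr_mono2') (auto simp: M_def of_nat_diff)
    also have "\<dots> = M powr (\<beta> - 1) * 2 powr (1 - \<beta>)"
      using powr_minus_divide[of 2 "\<beta> - 1"] by (simp add: powr_divide M_def)
    also have "\<dots> \<le> M powr (\<beta> - 1) * 2 powr 1" using params by (intro mult_left_mono powr_mono) auto
    finally have 1: "(real (m - k) + 1) powr (\<beta> - 1) \<le> 2 * M powr (\<beta> - 1)" by simp
    have 2: "real k powr \<beta> \<le> n0 powr \<beta> + real k * n0 powr (\<beta> - 1)"
      using n0 params by (intro powr_le_linear_split) auto
    have "ecoef v k * (real k powr \<beta> * (real (m - k) + 1) powr (\<beta> - 1)) \<le>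
        ecoef v k * ((n0 powr \<beta> + real k * n0 powr (\<beta> - 1)) * (2 * M powr (\<beta> - 1)))"
      using 1 2 nn by (intro mult_left_mono mult_mono) auto
    also have "\<dots> = 2 * M powr (\<beta> - 1) * (n0 powr \<beta> * ecoef v k + n0 powr (\<beta> - 1) * (real k * ecoef v k))"
      by (simp add: algebra_simps)
    finally show ?thesis using B by (simp add: add_increasing2)
  next
    case False
    have kM: "real k \<ge> M / 2" "real k - n0 \<ge> M / 4" "n0 < real k" using False n0 by (auto simp: M_def)
    have "ecoef v k * (M\<^sup>2 / 8) \<le> real k * ecoef v k * (real k - n0)"
    proof -
      have "ecoef v k * (M / 2 * (M / 4)) \<le> ecoef v k * (real k * (real k - n0))"
        using kM nn n0 by (intro mult_left_mono mult_mono) (auto simp: M_def)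
      then show ?thesis by (simp add: power2_eq_square mult_ac)
    qed
    also have "\<dots> \<le> E * (E * n0 * X)"
      using finite_support_coef_decay[of v tiltE m0 k] v supp kM by (simp add: X_def E_def n0_def)
    finally have 1: "ecoef v k \<le> 8 * E\<^sup>2 * n0 * X / M\<^sup>2"
      using kM n0 by (simp add: field_simps power2_eq_square)
    have "real k powr \<beta> \<le> M powr \<beta>" using k params by (intro powr_mono2) (auto simp: M_def)
    then have "ecoef v k * (real k powr \<beta> * (real (m - k) + 1) powr (\<beta> - 1)) \<le>
        8 * E\<^sup>2 * n0 * X / M\<^sup>2 * (M powr \<beta> * (real (m - k) + 1) powr (\<beta> - 1))"
      using 1 X n0 by (intro mult_mono mult_right_mono) (auto intro: nn)
    also have "\<dots> = B * (real (m - k) + 1) powr (\<beta> - 1)" by (simp add: B_def mult_ac)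
    finally show ?thesis using nn[of k] by (simp add: add_increasing)
  qed
  have "(\<Sum>k\<le>m. ecoef v k * (real k powr \<beta> * (real (m - k) + 1) powr (\<beta> - 1))) \<le>
      (\<Sum>k\<le>m. 2 * M powr (\<beta> - 1) * (n0 powr \<beta> * ecoef v k + n0 powr (\<beta> - 1) * (real k * ecoef v k)) +
      B * (real (m - k) + 1) powr (\<beta> - 1))"
    by (intro sum_mono t) auto
  also have "\<dots> = 2 * M powr (\<beta> - 1) * (n0 powr \<beta> * esum v m + n0 powr (\<beta> - 1) * (\<Sum>k\<le>m. real k * ecoef v k))
      + B * (\<Sum>k\<le>m. (real (m - k) + 1) powr (\<beta> - 1))"
    by (simp add: sum.distrib sum_distrib_left ring_distribs mult.assoc)
  also have "\<dots> \<le> 2 * M powr (\<beta> - 1) * (n0 powr \<beta> * X + n0 powr (\<beta> - 1) * (E * n0 * X))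
      + B * (M powr \<beta> / \<beta>\<^sup>2)"
    using tot fm B sum_powr_le[of \<beta> m] params
    by (intro add_mono mult_left_mono) (auto simp: M_def)
  also have "n0 powr (\<beta> - 1) * (E * n0 * X) = E * n0 powr \<beta> * X"
    using n0 powr_mult_base[of n0 "\<beta> - 1"] by (simp add: mult_ac)
  also have "B * (M powr \<beta> / \<beta>\<^sup>2) \<le> 8 * E\<^sup>2 / \<beta>\<^sup>2 * (n0 powr \<beta> * M powr (\<beta> - 1) * X)"
  proof -
    have Mp: "M > 0" by (simp add: M_def)
    have "n0 = n0 powr \<beta> * n0 powr (1 - \<beta>)" using n0 by (simp add: powr_add[symmetric])
    also have "\<dots> \<le> n0 powr \<beta> * M powr (1 - \<beta>)"
      using n0 params by (intro mult_left_mono powr_mono2) auto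
    finally have "8 * E\<^sup>2 / \<beta>\<^sup>2 * (n0 * (M powr \<beta> * M powr \<beta> / M\<^sup>2) * X) \<le>
        8 * E\<^sup>2 / \<beta>\<^sup>2 * ((n0 powr \<beta> * M powr (1 - \<beta>)) * (M powr \<beta> * M powr \<beta> / M\<^sup>2) * X)"
      using X by (intro mult_left_mono mult_right_mono) auto
    also have "M powr (1 - \<beta>) * (M powr \<beta> * M powr \<beta> / M\<^sup>2) = M powr (\<beta> - 1)"
      using Mp by (simp add: powr_diff power2_eq_square)
    then have "(n0 powr \<beta> * M powr (1 - \<beta>)) * (M powr \<beta> * M powr \<beta> / M\<^sup>2) = n0 powr \<beta> * M powr (\<beta> - 1)"
      by (simp only: mult.assoc)
    finally show ?thesis by (simp add: B_def mult_ac)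
  qed
  finally show ?thesis
    unfolding E_def[symmetric] n0_def[symmetric] M_def[symmetric] by (simp add: ring_distribs mult_ac)
qed

text \<open>Absolute values destroy the cancellation between the phases, so the lengths up to \<open>m0\<close> are kept together
in one factor. Its coefficients live on the scale \<open>m0\<close>, on which the other factor hardly varies;
in effect it is evaluated at \<open>z = 1\<close>, where its modulus is \<open>exp (- defect d f m0)\<close> times its value
for \<open>f = 1\<close>. The error carries \<open>(m0 / m) powr \<beta>\<close>, and the lengths above \<open>m0\<close> are estimated by
absolute values.\<close>

lemma split_decay_raw:
  assumes m0: "4 * m0 \<le> m"
  shows "norm (twist d f m) \<le> decayC * ((real m + 1) powr (\<beta> - 1) * exp (\<Sum>j=1..m. (d j - \<beta>) / real j)) *
    (exp (- defect d f m0) + (real m0 / (real m + 1)) powr \<beta> * exp (tiltc * defect d f m0)) *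
    exp (tiltc * (defect d f m - defect d f m0))"
proof -
  \<comment> \<open>\<open>wa\<close> and \<open>wb\<close> are the exponents of the two factors, \<open>va\<close> and \<open>vb\<close> their majorants; the kernel
    joins the second factor in \<open>b\<close>\<close>
  define wa where "wa j = (if j \<le> m0 then of_real (d j) * f j - of_real \<beta> else 0)" for j
  define wb where "wb j = (if j \<le> m0 then 0 else of_real (d j) * f j - of_real \<beta>)" for j
  define va where "va j = (if j \<le> m0 then tiltv j else 0)" for j
  define vb where "vb j = (if j \<le> m0 then 0 else tiltv j)" for j
  define M where "M = real m + 1"
  define C1 where "C1 = 2 + 2 * tiltE / \<beta>"
  define C2 where "C2 = 16 + 8 * tiltE / \<beta>"
  define C3 where "C3 = 2 * (1 + tiltE) + 8 * tiltE\<^sup>2 / \<beta>\<^sup>2"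
  define S where "S = esum vb m"
  define X where "X = exp (\<Sum>j=1..m0. va j / real j)"
  define A where "A = exp (\<Sum>j=1..m0. wa j / of_nat j)"
  define a where "a = ecoef wa"
  define b where "b m = (\<Sum>k\<le>m. ecoef wb k * of_real (kern \<beta> (m - k)))" for m
  define R where "R = (real m0 / M) powr \<beta>"
  have dC: "decayC = C1 * (1 + tiltE) + C2 * C3" by (simp add: decayC_def C1_def C2_def C3_def)
  have C: "0 < C1" "0 < C2" "0 < C3" using tiltE_ge params
    by (auto simp: C1_def C2_def C3_def intro!: add_pos_nonneg divide_nonneg_nonneg)
  have va: "0 \<le> va j \<and> va j \<le> tiltE" and vb: "0 \<le> vb j \<and> vb j \<le> tiltE" for j
    using tiltv_bounds[of j] tiltE_ge by (auto simp: va_def vb_def)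
  have na: "norm (a k) \<le> ecoef va k" and nb: "norm (ecoef wb k) \<le> ecoef vb k" for k
    unfolding a_def using norm_tilt_le_tiltv by (auto intro!: norm_ecoef_le simp: wa_def wb_def va_def vb_def)
  have nn: "0 \<le> ecoef va k" "0 \<le> ecoef vb k" for k using va vb by (auto intro: ecoef_nonneg)
  have S0: "0 \<le> S" unfolding S_def by (intro sum_nonneg nn)
  have M: "M \<ge> 1" by (simp add: M_def)
  have X0: "0 < X" by (simp add: X_def)
  have tw: "twist d f m = (\<Sum>k\<le>m. a k * b (m - k))"
  proof -
    have e: "ecoef (\<lambda>j. wb j + complex_of_real \<beta>) l = b l" for l
      unfolding b_def ecoef_add by (simp add: ecoef_of_real)
    have "(\<lambda>j. of_real (d j) * f j) = (\<lambda>j. wa j + (wb j + of_real \<beta>))"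
      by (auto simp: wa_def wb_def)
    then have "twist d f m = ecoef (\<lambda>j. wa j + (wb j + of_real \<beta>)) m" by (simp add: twist_def)
    then show ?thesis unfolding ecoef_add[of wa] e a_def .
  qed
  have b1: "norm (b m) \<le> C1 * M powr (\<beta> - 1) * S"
    unfolding b_def C1_def M_def S_def
    by (rule conv_kern_bound[OF _ _ vb nb]) (use params in auto)
  have b2: "norm (b m - b (m - k)) \<le> C2 * (real k / M) powr \<beta> * (real (m - k) + 1) powr (\<beta> - 1) * S"
    if "k \<le> m" for k
    unfolding b_def C2_def M_def S_def
    by (rule conv_kern_smooth[OF _ _ vb nb that]) (use params in auto)
  have as: "a sums A" unfolding a_def A_def by (rule ecoef_sums) (simp add: wa_def)
  have tail: "norm (A - (\<Sum>k\<le>m. a k)) \<le> tiltE * R * X"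
  proof -
    have "norm (A - (\<Sum>k\<le>m. a k)) \<le> tiltE * real m0 * exp (\<Sum>j=1..m0. va j / real j) / (real m + 1)"
      by (rule finite_support_tail[OF va _ na as]) (simp add: va_def)
    also have "\<dots> = tiltE * (real m0 / M) powr 1 * X" using M by (simp add: X_def M_def)
    also have "\<dots> \<le> tiltE * R * X" unfolding R_def
      using m0 params M X0 tiltE_ge by (intro mult_right_mono mult_left_mono powr_mono') (auto simp: M_def)
    finally show ?thesis .
  qed
  have third: "norm (\<Sum>k\<le>m. a k * (b m - b (m - k))) \<le> C2 * C3 * R * X * M powr (\<beta> - 1) * S"
  proof -
    have "norm (\<Sum>k\<le>m. a k * (b m - b (m - k))) \<le>
      (\<Sum>k\<le>m. C2 * S / M powr \<beta> * (ecoef va k * (real k powr \<beta> * (real (m - k) + 1) powr (\<beta> - 1))))"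
    proof (rule sum_norm_le)
      fix k assume k: "k \<in> {..m}"
      have "norm (a k * (b m - b (m - k))) \<le> ecoef va k *
          (C2 * (real k / M) powr \<beta> * (real (m - k) + 1) powr (\<beta> - 1) * S)"
        unfolding norm_mult using na b2 k nn by (intro mult_mono) auto
      also have "\<dots> = C2 * S / M powr \<beta> * (ecoef va k * (real k powr \<beta> * (real (m - k) + 1) powr (\<beta> - 1)))"
        by (simp add: powr_divide)
      finally show "norm (a k * (b m - b (m - k))) \<le> \<dots>" .
    qed
    also have "\<dots> = C2 * S / M powr \<beta> * (\<Sum>k\<le>m. ecoef va k * (real k powr \<beta> * (real (m - k) + 1) powr (\<beta> - 1)))"
      by (simp only: sum_distrib_left)
    also have "\<dots> \<le> C2 * S / M powr \<beta> * (C3 * real m0 powr \<beta> * (real m + 1) powr (\<beta> - 1) * X)"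
      unfolding C3_def X_def
      by (intro mult_left_mono finite_support_weighted_sum) (use va m0 C S0 in \<open>auto simp: va_def\<close>)
    also have "\<dots> = C2 * C3 * R * X * M powr (\<beta> - 1) * S"
      by (simp add: R_def M_def powr_divide)
    finally show ?thesis .
  qed
  \<comment> \<open>the coefficients \<open>a k\<close> act as a point mass \<open>A\<close> at \<open>0\<close>, up to the tail of their sum and the
    variation of \<open>b\<close>\<close>
  have "twist d f m = b m * A - b m * (A - (\<Sum>k\<le>m. a k)) - (\<Sum>k\<le>m. a k * (b m - b (m - k)))"
    unfolding tw by (simp add: algebra_simps sum_subtractf sum_distrib_left sum_distrib_right)
  also have "norm \<dots> \<le> norm (b m * A) + norm (b m * (A - (\<Sum>k\<le>m. a k))) + norm (\<Sum>k\<le>m. a k * (b m - b (m - k)))"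
    by (intro order_trans[OF norm_triangle_ineq4] add_right_mono norm_triangle_ineq4)
  also have "\<dots> \<le> C1 * M powr (\<beta> - 1) * S * norm A + C1 * M powr (\<beta> - 1) * S * (tiltE * R * X)
      + C2 * C3 * R * X * M powr (\<beta> - 1) * S"
    unfolding norm_mult using b1 tail third C S0 by (intro add_mono mult_mono) auto
  also have "\<dots> = M powr (\<beta> - 1) * S * (C1 * norm A + (C1 * tiltE + C2 * C3) * (R * X))"
    by (simp add: algebra_simps)
  also have "\<dots> \<le> M powr (\<beta> - 1) * S * (decayC * norm A + decayC * (R * X))"
  proof -
    have "C1 \<le> decayC" "C1 * tiltE + C2 * C3 \<le> decayC"
      using C tiltE_ge by (auto simp: dC algebra_simps)
    then show ?thesis using S0 X0 by (intro mult_left_mono add_mono mult_right_mono) (auto simp: R_def)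
  qed
  also have "\<dots> = decayC * M powr (\<beta> - 1) * S * (norm A + R * X)" by (simp add: algebra_simps)
  also have "norm A = exp (\<Sum>j=1..m0. (d j - \<beta>) / real j) * exp (- defect d f m0)"
  proof -
    have "Re (\<Sum>j=1..m0. wa j / of_nat j) = (\<Sum>j=1..m0. (d j - \<beta>) / real j - d j * (1 - Re (f j)) / real j)"
      by (simp add: wa_def Re_divide_of_nat diff_divide_distrib[symmetric] algebra_simps)
    also have "\<dots> = (\<Sum>j=1..m0. (d j - \<beta>) / real j) + - defect d f m0"
      by (simp add: defect_def sum_subtractf)
    finally show ?thesis unfolding A_def norm_exp_eq_Re exp_add[symmetric] by simp
  qed
  also have "X = exp (\<Sum>j=1..m0. (d j - \<beta>) / real j) * exp (tiltc * defect d f m0)"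
  proof -
    have "(\<Sum>j=1..m0. va j / real j) = (\<Sum>j=1..m0. tiltv j / real j)" by (simp add: va_def)
    then show ?thesis unfolding X_def exp_add[symmetric] sum_tiltv by simp
  qed
  finally have "norm (twist d f m) \<le> decayC * M powr (\<beta> - 1) * S *
      (exp (\<Sum>j=1..m0. (d j - \<beta>) / real j) * (exp (- defect d f m0) + R * exp (tiltc * defect d f m0)))"
    by (simp add: algebra_simps)
  also have "\<dots> = decayC * M powr (\<beta> - 1) * (S * exp (\<Sum>j=1..m0. (d j - \<beta>) / real j)) *
      (exp (- defect d f m0) + R * exp (tiltc * defect d f m0))"
    by (simp add: mult_ac)
  also have "\<dots> \<le> decayC * M powr (\<beta> - 1) * (exp (\<Sum>j=1..m. (d j - \<beta>) / real j) * exp (tiltc * (defect d f m - defect d f m0))) *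
      (exp (- defect d f m0) + R * exp (tiltc * defect d f m0))"
  proof -
    have sp: "(\<Sum>j=1..m. x j) = (\<Sum>j=1..m0. x j) + (\<Sum>j=m0+1..m. x j)" for x :: "nat \<Rightarrow> real"
      by (rule sum_from_1_split) (use m0 in auto)
    have "S \<le> exp (\<Sum>j=1..m. vb j / real j)" unfolding S_def using vb by (intro esum_le_exp) auto
    also have "(\<Sum>j=1..m. vb j / real j) = (\<Sum>j=m0+1..m. tiltv j / real j)"
      unfolding sp by (simp add: vb_def)
    finally have "S * exp (\<Sum>j=1..m0. (d j - \<beta>) / real j) \<le> exp ((\<Sum>j=m0+1..m. tiltv j / real j) + (\<Sum>j=1..m0. (d j - \<beta>) / real j))"
      unfolding exp_add by (intro mult_right_mono) auto
    also have "(\<Sum>j=m0+1..m. tiltv j / real j) + (\<Sum>j=1..m0. (d j - \<beta>) / real j) =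
        (\<Sum>j=1..m. (d j - \<beta>) / real j) + tiltc * (defect d f m - defect d f m0)"
      using sp[of "\<lambda>j. tiltv j / real j"] sum_tiltv[of m] sum_tiltv[of m0] by (simp add: algebra_simps)
    finally have "S * exp (\<Sum>j=1..m0. (d j - \<beta>) / real j) \<le>
        exp (\<Sum>j=1..m. (d j - \<beta>) / real j) * exp (tiltc * (defect d f m - defect d f m0))"
      by (simp add: exp_add)
    moreover have "0 \<le> decayC" using C tiltE_ge by (auto simp: dC)
    ultimately show ?thesis by (intro mult_right_mono mult_left_mono) (auto simp: R_def)
  qed
  finally show ?thesis by (simp add: M_def R_def mult_ac)
qed

end
end

section \<open>Decay and smoothness in the index\<close>

lemma one_minus_cos_le_square: "1 - cos x \<le> x\<^sup>2 / 2" for x :: real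
proof -
  have "norm (iexp x - (\<Sum>k\<le>1. (\<i> * x) ^ k / fact k)) \<le> \<bar>x\<bar> ^ 2 / 2"
    using iexp_approx1[of x 1] by (simp add: numeral_2_eq_2)
  then have "\<bar>Re (iexp x - (\<Sum>k\<le>1. (\<i> * x) ^ k / fact k))\<bar> \<le> \<bar>x\<bar> ^ 2 / 2"
    using abs_Re_le_cmod order_trans by blast
  then show ?thesis by (simp add: cis_conv_exp[symmetric])
qed

lemma one_minus_cos_ge: "x\<^sup>2 / 2 - \<bar>x\<bar> ^ 3 / 6 \<le> 1 - cos x" for x :: real
proof -
  have "norm (iexp x - (\<Sum>k\<le>2. (\<i> * x) ^ k / fact k)) \<le> \<bar>x\<bar> ^ 3 / 6"
    using iexp_approx1[of x 2] by (simp add: numeral_3_eq_3 numeral_2_eq_2)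
  then have "\<bar>Re (iexp x - (\<Sum>k\<le>2. (\<i> * x) ^ k / fact k))\<bar> \<le> \<bar>x\<bar> ^ 3 / 6"
    using abs_Re_le_cmod order_trans by blast
  then have "\<bar>cos x - (1 - x\<^sup>2 / 2)\<bar> \<le> \<bar>x\<bar> ^ 3 / 6"
    by (simp add: cis_conv_exp[symmetric] numeral_2_eq_2 power_mult_distrib)
  then show ?thesis using abs_ge_minus_self[of "cos x - (1 - x\<^sup>2 / 2)"] by linarith
qed

text \<open>For \<open>\<bar>x\<bar>\<close> beyond \<open>\<epsilon>\<close> the trivial bound \<open>2\<close> is paid by the cubic term. Summed over the lengths, the
exceptional ones are thus controlled by the third absolute moment.\<close>

lemma one_minus_cos_le_split:
  fixes x \<epsilon> :: real
  assumes "0 < \<epsilon>"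
  shows "1 - cos x \<le> \<epsilon>\<^sup>2 / 2 + 2 * \<bar>x\<bar> ^ 3 / \<epsilon> ^ 3"
proof (cases "\<bar>x\<bar> \<le> \<epsilon>")
  case True
  then have "x\<^sup>2 \<le> \<epsilon>\<^sup>2" using assms by (simp add: abs_le_square_iff[symmetric])
  moreover have "0 \<le> 2 * \<bar>x\<bar> ^ 3 / \<epsilon> ^ 3" using assms by simp
  ultimately show ?thesis using one_minus_cos_le_square[of x] by linarith
next
  case False
  then have "\<epsilon> ^ 3 \<le> \<bar>x\<bar> ^ 3" using assms by (intro power_mono) auto
  then have "2 \<le> 2 * \<bar>x\<bar> ^ 3 / \<epsilon> ^ 3" using assms by (simp add: field_simps)
  moreover have "1 - cos x \<le> 2" using cos_ge_minus_one[of x] by linarith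
  moreover have "0 \<le> \<epsilon>\<^sup>2 / 2" by simp
  ultimately show ?thesis by linarith
qed

lemma interpolate_le:
  fixes z Q a b s :: real
  assumes "z \<le> Q * a" "z \<le> Q * b" "0 \<le> Q" "0 < a" "0 < b" "0 \<le> s" "s \<le> 1"
  shows "z \<le> Q * (a powr s * b powr (1 - s))"
proof -
  have "min a b = min a b powr s * min a b powr (1 - s)" using assms by (simp add: powr_add[symmetric])
  also have "\<dots> \<le> a powr s * b powr (1 - s)" using assms by (intro mult_mono powr_mono2) auto
  finally have "Q * min a b \<le> Q * (a powr s * b powr (1 - s))" using assms by (intro mult_left_mono)
  moreover have "z \<le> Q * min a b" using assms by (auto simp: min_def)
  ultimately show ?thesis by linarith
qed

abbreviation phase :: "(nat \<Rightarrow> real) \<Rightarrow> real \<Rightarrow> nat \<Rightarrow> complex" where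
  "phase h t \<equiv> \<lambda>j. iexp (t * h j)"

text \<open>The third Lyapunov sum with an integer power, the form in which Taylor remainders produce it.\<close>

definition third :: "(nat \<Rightarrow> real) \<Rightarrow> nat \<Rightarrow> real" where
  "third h n = (\<Sum>k=1..n. \<bar>h k\<bar> ^ 3 / real k)"

lemma third_nonneg: "0 \<le> third h n"
  unfolding third_def by (intro sum_nonneg) auto

lemma defect_phase: "defect d (phase h t) k = (\<Sum>j=1..k. d j * (1 - cos (t * h j)) / real j)"
  by (simp add: defect_def Re_exp)

context
  fixes d h :: "nat \<Rightarrow> real" and n :: nat and D :: real
  assumes d: "\<And>j. 0 \<le> d j \<and> d j \<le> D" and unit: "(\<Sum>k=1..n. d k * ((h k)\<^sup>2 / real k)) = 1"
begin

lemma defect_phase_le: "defect d (phase h t) n \<le> t\<^sup>2 / 2"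
proof -
  have "defect d (phase h t) n \<le> (\<Sum>j=1..n. t\<^sup>2 / 2 * (d j * ((h j)\<^sup>2 / real j)))"
    unfolding defect_phase
  proof (rule sum_mono)
    fix j
    have "d j * (1 - cos (t * h j)) / real j \<le> d j * ((t * h j)\<^sup>2 / 2) / real j"
      using d by (intro divide_right_mono mult_left_mono one_minus_cos_le_square) auto
    then show "d j * (1 - cos (t * h j)) / real j \<le> t\<^sup>2 / 2 * (d j * ((h j)\<^sup>2 / real j))"
      by (simp add: power_mult_distrib mult_ac)
  qed
  also have "\<dots> = t\<^sup>2 / 2" unfolding sum_distrib_left[symmetric] unit by simp
  finally show ?thesis .
qed

lemma defect_phase_ge: "t\<^sup>2 / 2 - D * \<bar>t\<bar> ^ 3 * third h n / 6 \<le> defect d (phase h t) n"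
proof -
  have "t\<^sup>2 / 2 - D * \<bar>t\<bar> ^ 3 * third h n / 6 =
      (\<Sum>j=1..n. t\<^sup>2 / 2 * (d j * ((h j)\<^sup>2 / real j)) - D * \<bar>t\<bar> ^ 3 / 6 * (\<bar>h j\<bar> ^ 3 / real j))"
    unfolding sum_subtractf sum_distrib_left[symmetric] unit third_def by simp
  also have "\<dots> \<le> defect d (phase h t) n"
    unfolding defect_phase
  proof (rule sum_mono)
    fix j
    have "d j * (\<bar>t * h j\<bar> ^ 3 / 6 / real j) \<le> D * (\<bar>t * h j\<bar> ^ 3 / 6 / real j)"
      using d by (intro mult_right_mono) auto
    moreover have "d j * ((t * h j)\<^sup>2 / 2 - \<bar>t * h j\<bar> ^ 3 / 6) / real j \<le> d j * (1 - cos (t * h j)) / real j"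
      using d by (intro divide_right_mono mult_left_mono one_minus_cos_ge) auto
    ultimately show "t\<^sup>2 / 2 * (d j * ((h j)\<^sup>2 / real j)) - D * \<bar>t\<bar> ^ 3 / 6 * (\<bar>h j\<bar> ^ 3 / real j)
        \<le> d j * (1 - cos (t * h j)) / real j"
      by (simp add: power_mult_distrib abs_mult right_diff_distrib diff_divide_distrib mult_ac)
  qed
  finally show ?thesis .
qed

text \<open>A long range of lengths costs little: \<open>\<epsilon>\<close> can be chosen so that the first term, which grows
with the logarithm of \<open>n / k\<close>, has a small coefficient.\<close>

lemma defect_phase_diff_le:
  assumes "k \<le> n" "0 < \<epsilon>"
  shows "defect d (phase h t) n - defect d (phase h t) k \<le>
    D * (\<epsilon>\<^sup>2 / 2 * (1 + ln ((real n + 1) / (real k + 1))) + 2 * \<bar>t\<bar> ^ 3 * third h n / \<epsilon> ^ 3)"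
proof -
  have D: "0 \<le> D" using d[of 0] by linarith
  have "defect d (phase h t) n - defect d (phase h t) k = (\<Sum>j=k+1..n. d j * (1 - cos (t * h j)) / real j)"
    unfolding defect_phase using sum_from_1_split[OF assms(1), of "\<lambda>j. d j * (1 - cos (t * h j)) / real j"] by simp
  also have "\<dots> \<le> (\<Sum>j=k+1..n. D * (\<epsilon>\<^sup>2 / 2 * (1 / real j)) + D * (2 * \<bar>t\<bar> ^ 3 / \<epsilon> ^ 3 * (\<bar>h j\<bar> ^ 3 / real j)))"
  proof (rule sum_mono)
    fix j
    have "d j * (1 - cos (t * h j)) / real j \<le> D * (\<epsilon>\<^sup>2 / 2 + 2 * \<bar>t * h j\<bar> ^ 3 / \<epsilon> ^ 3) / real j"
      using d D assms by (intro divide_right_mono mult_mono one_minus_cos_le_split) auto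
    then show "d j * (1 - cos (t * h j)) / real j \<le> D * (\<epsilon>\<^sup>2 / 2 * (1 / real j)) + D * (2 * \<bar>t\<bar> ^ 3 / \<epsilon> ^ 3 * (\<bar>h j\<bar> ^ 3 / real j))"
      by (simp add: power_mult_distrib abs_mult add_divide_distrib distrib_left mult_ac)
  qed
  also have "\<dots> = D * (\<epsilon>\<^sup>2 / 2 * (\<Sum>j=k+1..n. 1 / real j)) + D * (2 * \<bar>t\<bar> ^ 3 / \<epsilon> ^ 3 * (\<Sum>j=k+1..n. \<bar>h j\<bar> ^ 3 / real j))"
    by (simp only: sum.distrib sum_distrib_left)
  also have "\<dots> \<le> D * (\<epsilon>\<^sup>2 / 2 * (1 + ln ((real n + 1) / (real k + 1)))) + D * (2 * \<bar>t\<bar> ^ 3 / \<epsilon> ^ 3 * third h n)"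
    unfolding third_def using D assms harmonic_diff_le[OF assms(1)]
    by (intro add_mono mult_left_mono sum_mono2) auto
  finally show ?thesis by (simp add: algebra_simps)
qed

end

text \<open>The normalizing sum is the variance of \<open>\<Sum>k. h k * Z k\<close> with independent Poisson variables \<open>Z k\<close> of mean
\<open>d k / k\<close>.\<close>

definition admissible :: "real \<Rightarrow> real \<Rightarrow> (nat \<Rightarrow> real) \<Rightarrow> (nat \<Rightarrow> real) \<Rightarrow> nat \<Rightarrow> bool" where
  "admissible \<theta> D d h n \<longleftrightarrow>
    (\<forall>j. \<theta> \<le> d j \<and> d j \<le> D) \<and> (\<Sum>k=1..n. d k * ((h k)\<^sup>2 / real k)) = 1"

lemma admissibleD:
  assumes "admissible \<theta> D d h n"
  shows "\<theta> \<le> d j \<and> d j \<le> D" "(\<Sum>k=1..n. d k * ((h k)\<^sup>2 / real k)) = 1"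
  using assms by (auto simp: admissible_def)

context
  fixes \<beta> \<theta> D :: real
  assumes params: "0 < \<beta>" "\<beta> < \<theta>" "\<theta> \<le> 1" "\<theta> \<le> D"
begin

text \<open>The split of \<open>split_decay_raw\<close> is made at \<open>m0 = m * exp (- G * t\<^sup>2)\<close>. The error then carries
\<open>exp (- \<beta> * G * t\<^sup>2)\<close>, which outweighs the loss \<open>exp (tiltc * t\<^sup>2 / 2)\<close> from absolute values.
The main part is damped by the defect of the lengths up to \<open>m0\<close>, which misses that of all lengths, about
\<open>t\<^sup>2 / 2\<close>, only by the contribution of the range from \<open>m0\<close> to \<open>n\<close>. Since \<open>\<bar>t\<bar> * third h n\<close> is small,
\<open>t * h j\<close> is small for most \<open>j\<close> in that range, and the range costs a small multiple of \<open>t\<^sup>2\<close> and of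
\<open>ln (n / m)\<close>; the latter becomes the factor \<open>(n / m) powr (\<theta> - \<beta>)\<close>.\<close>

lemma twist_decay:
  obtains C c where "0 < C" "0 < c"
    "\<And>d h n t m. admissible \<theta> D d h n \<Longrightarrow>
      \<bar>t\<bar> * third h n \<le> c \<Longrightarrow> m \<le> n \<Longrightarrow>
      norm (twist d (phase h t) m) \<le> C * ((real n + 1) / (real m + 1)) powr (\<theta> - \<beta>) * exp (- t\<^sup>2 / 8) * ecoef d m"
proof -
  define \<tau> where "\<tau> = tiltc \<beta> \<theta>"
  have tau: "0 < \<tau>" unfolding \<tau>_def using params by (intro tiltc_pos)
  have D: "0 < D" using params by linarith
  obtain c0 where c0: "0 < c0" "\<And>v m. (\<And>j. 0 \<le> v j \<and> v j \<le> D) \<Longrightarrow>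
      c0 * exp (\<Sum>j=1..m. v j / real j) \<le> esum v m"
    using esum_ge_exp[of D] D by auto
  define C' where "C' = decayC \<beta> \<theta> D / (\<beta> * c0)"
  \<comment> \<open>\<open>G\<close> satisfies \<open>\<beta> * G = \<tau> / 2 + 1\<close>, so that the error of the split is at most \<open>exp (- t\<^sup>2)\<close>\<close>
  define G where "G = (\<tau> / 2 + 1) / \<beta>"
  define B where "B = (1 + \<tau>) * D"
  \<comment> \<open>the two bounds on \<open>\<epsilon>\<close> make the lengths beyond the split cost, up to a constant, at most
    \<open>(\<theta> - \<beta>) * ln (n / m)\<close> and \<open>t\<^sup>2 / 16\<close>\<close>
  define \<epsilon> where "\<epsilon> = sqrt (min (2 * (\<theta> - \<beta>) / B) (1 / (8 * B * G)))"
  \<comment> \<open>the first bound pays for the exceptional lengths with another \<open>t\<^sup>2 / 16\<close>, the second makes the total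
    defect at least \<open>t\<^sup>2 / 4\<close>\<close>
  define c where "c = min (\<epsilon> ^ 3 / (32 * B)) (3 / (2 * D))"
  define q where "q = exp (- (ln 4 / G) / 8)"
  define C where "C = 1 / q + 2 * C' * exp (2 * (\<theta> - \<beta>))"
  have G: "0 < G" using tau params by (simp add: G_def add_pos_pos)
  have B: "0 < B" using tau D by (simp add: B_def)
  have e2: "0 < \<epsilon>" "\<epsilon>\<^sup>2 = min (2 * (\<theta> - \<beta>) / B) (1 / (8 * B * G))"
    using B G params by (auto simp: \<epsilon>_def)
  have eB: "B * (\<epsilon>\<^sup>2 / 2) \<le> \<theta> - \<beta>" "B * (\<epsilon>\<^sup>2 / 2) * G \<le> 1 / 16"
  proof -
    have "\<epsilon>\<^sup>2 \<le> 2 * (\<theta> - \<beta>) / B" "\<epsilon>\<^sup>2 \<le> 1 / (8 * B * G)" unfolding e2(2) by auto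
    then show "B * (\<epsilon>\<^sup>2 / 2) \<le> \<theta> - \<beta>" "B * (\<epsilon>\<^sup>2 / 2) * G \<le> 1 / 16" using B G by (auto simp: field_simps)
  qed
  have c: "0 < c" "c \<le> \<epsilon> ^ 3 / (32 * B)" "c \<le> 3 / (2 * D)" using e2 B D by (auto simp: c_def)
  have q: "0 < q" by (simp add: q_def)
  have dC: "0 \<le> decayC \<beta> \<theta> D" by (rule decayC_nonneg[OF params])
  have C': "0 \<le> C'" using dC c0 params by (simp add: C'_def)
  have C: "0 < C" "1 / q \<le> C" "2 * C' * exp (2 * (\<theta> - \<beta>)) \<le> C" using q C' by (auto simp: C_def add_pos_nonneg)
  show thesis
  proof (rule that[OF C(1) c(1)])
    fix d h :: "nat \<Rightarrow> real" and n m :: nat and t :: real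
    assume ad: "admissible \<theta> D d h n"
      and t: "\<bar>t\<bar> * third h n \<le> c" and m: "m \<le> n"
    note d = admissibleD(1)[OF ad] and unit = admissibleD(2)[OF ad]
    define f where "f = phase h t"
    have f: "norm (f j) \<le> 1" for j by (simp add: f_def)
    have d0: "0 \<le> d j \<and> d j \<le> D" for j using d[of j] params by auto
    define W where "W = ((real n + 1) / (real m + 1)) powr (\<theta> - \<beta>)"
    have W: "1 \<le> W" unfolding W_def using m params by (intro ge_one_powr_ge_zero) auto
    have p: "0 < ecoef d m" by (rule ecoef_d_pos[OF params d f])
    have ntw: "norm (twist d f m) \<le> ecoef d m" by (rule norm_twist_le[OF params d f])
    define m0 where "m0 = nat \<lfloor>real m * exp (- G * t\<^sup>2)\<rfloor>"
    have m0: "real m0 \<le> real m * exp (- G * t\<^sup>2)" "real m * exp (- G * t\<^sup>2) < real m0 + 1"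
      unfolding m0_def by (auto simp: of_nat_nat)
    have ex1: "exp (- G * t\<^sup>2) \<le> 1" using G by simp
    show "norm (twist d (phase h t) m) \<le> C * ((real n + 1) / (real m + 1)) powr (\<theta> - \<beta>) * exp (- t\<^sup>2 / 8) * ecoef d m"
    \<comment> \<open>otherwise \<open>t\<close> is bounded and \<open>norm_twist_le\<close> suffices\<close>
    proof (cases "4 * m0 \<le> m")
      case False
      then have "real m / 4 < real m * exp (- G * t\<^sup>2)" using m0 by linarith
      then have "1 / 4 < exp (- G * t\<^sup>2)" by (cases "m = 0") (auto simp: field_simps)
      then have "ln (1 / 4) < ln (exp (- G * t\<^sup>2))" by (subst ln_less_cancel_iff) auto
      then have "G * t\<^sup>2 < ln 4" by (simp add: ln_div)
      then have "t\<^sup>2 < ln 4 / G" using G by (simp add: field_simps)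
      then have "q \<le> exp (- t\<^sup>2 / 8)" by (simp add: q_def)
      then have "1 \<le> 1 / q * exp (- t\<^sup>2 / 8)" using q by (simp add: field_simps)
      also have "\<dots> \<le> C * W * exp (- t\<^sup>2 / 8)"
        using C W mult_mono[of "1/q" C 1 W] q by (intro mult_right_mono) auto
      finally have "1 * ecoef d m \<le> C * W * exp (- t\<^sup>2 / 8) * ecoef d m" using p by (intro mult_right_mono) auto
      then show ?thesis using ntw by (simp add: W_def f_def)
    next
      case True
      define Df where "Df = defect d f"
      define \<delta> where "\<delta> = Df n - Df m0"
      have Dmono: "k \<le> l \<Longrightarrow> Df k \<le> Df l" for k l
        unfolding Df_def by (rule defect_mono[OF params d f])
      have delta: "0 \<le> \<delta>" "Df m - Df m0 \<le> \<delta>" using Dmono[of m n] Dmono[of m0 n] m True by (auto simp: \<delta>_def)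
      have Dn: "Df n \<le> t\<^sup>2 / 2" unfolding Df_def f_def by (rule defect_phase_le[OF d0 unit])
      have t3: "\<bar>t\<bar> ^ 3 * third h n \<le> c * t\<^sup>2"
        using mult_right_mono[OF t, of "t\<^sup>2"] by (simp add: power3_eq_cube power2_eq_square mult_ac)
      have Dn2: "t\<^sup>2 / 4 \<le> Df n"
      proof -
        have "D * \<bar>t\<bar> ^ 3 * third h n / 6 \<le> D * (c * t\<^sup>2) / 6"
          using t3 D by (simp add: mult.assoc)
        also have "\<dots> \<le> D * (3 / (2 * D) * t\<^sup>2) / 6" using c D by (intro divide_right_mono mult_left_mono mult_right_mono) auto
        also have "\<dots> = t\<^sup>2 / 4" using D by simp
        finally show ?thesis using defect_phase_ge[OF d0 unit, of t] unfolding Df_def f_def by linarith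
      qed
      have P: "exp (\<Sum>j=1..m. (d j - \<beta>) / real j) * (real m + 1) powr (\<beta> - 1) \<le> ecoef d m / (\<beta> * c0)"
      proof -
        have "0 \<le> d j - \<beta> \<and> d j - \<beta> \<le> D" for j using d[of j] params by auto
        then have "c0 * exp (\<Sum>j=1..m. (d j - \<beta>) / real j) \<le> esum (\<lambda>j. d j - \<beta>) m" by (rule c0(2))
        then have "\<beta> * (real m + 1) powr (\<beta> - 1) * (c0 * exp (\<Sum>j=1..m. (d j - \<beta>) / real j)) \<le>
            \<beta> * (real m + 1) powr (\<beta> - 1) * esum (\<lambda>j. d j - \<beta>) m"
          using params by (intro mult_left_mono) auto
        also have "\<dots> \<le> ecoef d m"
          by (rule ecoef_lower[where D=D]) (use params d in \<open>auto intro: order_trans[of \<beta> \<theta>]\<close>)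
        finally show ?thesis using params c0 by (simp add: field_simps)
      qed
      have R: "(real m0 / (real m + 1)) powr \<beta> * exp (\<tau> * Df m0) \<le> exp (- t\<^sup>2)"
      proof -
        have "real m0 / (real m + 1) \<le> exp (- G * t\<^sup>2)"
        proof -
          have "real m0 \<le> (real m + 1) * exp (- G * t\<^sup>2)"
            using m0(1) exp_ge_zero[of "- G * t\<^sup>2"] unfolding distrib_right by linarith
          then show ?thesis by (simp add: divide_le_eq mult.commute)
        qed
        then have "(real m0 / (real m + 1)) powr \<beta> \<le> exp (- G * t\<^sup>2) powr \<beta>"
          using params by (intro powr_mono2) auto
        also have "\<dots> = exp (- (\<beta> * G) * t\<^sup>2)" by (simp add: exp_powr_real mult_ac)
        also have "\<beta> * G = \<tau> / 2 + 1" using params by (simp add: G_def)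
        finally have 1: "(real m0 / (real m + 1)) powr \<beta> \<le> exp (- (\<tau> / 2 + 1) * t\<^sup>2)" .
        have "Df m0 \<le> t\<^sup>2 / 2" using Dmono[of m0 n] True m Dn by linarith
        then have "\<tau> * Df m0 \<le> \<tau> * (t\<^sup>2 / 2)" using tau by (intro mult_left_mono) auto
        then have "(real m0 / (real m + 1)) powr \<beta> * exp (\<tau> * Df m0) \<le> exp (- (\<tau> / 2 + 1) * t\<^sup>2) * exp (\<tau> * (t\<^sup>2 / 2))"
          using 1 by (intro mult_mono) auto
        also have "\<dots> = exp (- t\<^sup>2)" unfolding exp_add[symmetric] by (simp add: algebra_simps)
        finally show ?thesis .
      qed
      have E1: "exp (- Df m0) \<le> exp (- t\<^sup>2 / 4 + \<delta>)" using Dn2 by (simp add: \<delta>_def)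
      have "- t\<^sup>2 \<le> - t\<^sup>2 / 4 + \<delta>" using delta(1) zero_le_power2[of t] by linarith
      then have E2: "exp (- t\<^sup>2) \<le> exp (- t\<^sup>2 / 4 + \<delta>)" by simp
      have E3: "exp (\<tau> * (Df m - Df m0)) \<le> exp (\<tau> * \<delta>)" using delta tau by simp
      have bd: "(1 + \<tau>) * \<delta> \<le> 2 * (\<theta> - \<beta>) + t\<^sup>2 / 8 + (\<theta> - \<beta>) * ln ((real n + 1) / (real m + 1))"
      proof -
        have "(real m + 1) * exp (- G * t\<^sup>2) \<le> 2 * (real m0 + 1)"
        proof -
          have "(x + 1) * e \<le> 2 * (y + 1)" if "x * e < y + 1" "e \<le> 1" "0 \<le> y" for x y e :: real
            using that by (simp add: algebra_simps)
          from this[OF m0(2) ex1] show ?thesis by simp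
        qed
        then have "(real n + 1) / (real m0 + 1) \<le> 2 * exp (G * t\<^sup>2) * ((real n + 1) / (real m + 1))"
        proof -
          assume a: "(real m + 1) * exp (- G * t\<^sup>2) \<le> 2 * (real m0 + 1)"
          have "(real m + 1) = (real m + 1) * exp (- G * t\<^sup>2) * exp (G * t\<^sup>2)" by (simp add: exp_minus)
          also have "\<dots> \<le> 2 * (real m0 + 1) * exp (G * t\<^sup>2)" using a by (intro mult_right_mono) auto
          finally have "(real n + 1) * (real m + 1) \<le> (real n + 1) * (2 * (real m0 + 1) * exp (G * t\<^sup>2))"
            by (intro mult_left_mono) auto
          then show ?thesis by (simp add: field_simps)
        qed
        then have "ln ((real n + 1) / (real m0 + 1)) \<le> ln (2 * exp (G * t\<^sup>2) * ((real n + 1) / (real m + 1)))"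
          by (subst ln_le_cancel_iff) (auto intro!: mult_pos_pos)
        also have "\<dots> = ln 2 + G * t\<^sup>2 + ln ((real n + 1) / (real m + 1))"
        proof -
          have "ln (2 * exp x * y) = ln 2 + x + ln y" if "0 < y" for x y :: real
            using that by (simp add: ln_mult_pos)
          from this[of "(real n + 1) / (real m + 1)" "G * t\<^sup>2"] show ?thesis by simp
        qed
        finally have L: "1 + ln ((real n + 1) / (real m0 + 1)) \<le> 2 + G * t\<^sup>2 + ln ((real n + 1) / (real m + 1))"
          using ln_2_less_1 by linarith
        have "\<delta> \<le> D * (\<epsilon>\<^sup>2 / 2 * (1 + ln ((real n + 1) / (real m0 + 1))) + 2 * \<bar>t\<bar> ^ 3 * third h n / \<epsilon> ^ 3)"
          unfolding \<delta>_def Df_def f_def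
          by (rule defect_phase_diff_le[OF d0 unit]) (use True m e2 in auto)
        then have "(1 + \<tau>) * \<delta> \<le> (1 + \<tau>) * (D * (\<epsilon>\<^sup>2 / 2 * (1 + ln ((real n + 1) / (real m0 + 1))) + 2 * \<bar>t\<bar> ^ 3 * third h n / \<epsilon> ^ 3))"
          using tau by (intro mult_left_mono) auto
        also have "\<dots> = B * (\<epsilon>\<^sup>2 / 2) * (1 + ln ((real n + 1) / (real m0 + 1))) + B * (2 / \<epsilon> ^ 3) * (\<bar>t\<bar> ^ 3 * third h n)"
          unfolding mult.assoc[of "1 + \<tau>" D, symmetric] B_def[symmetric] distrib_left[of B] by simp
        also have "\<dots> \<le> B * (\<epsilon>\<^sup>2 / 2) * (2 + G * t\<^sup>2 + ln ((real n + 1) / (real m + 1))) + B * (2 / \<epsilon> ^ 3) * (\<epsilon> ^ 3 / (32 * B) * t\<^sup>2)"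
        proof (rule add_mono)
          show "B * (\<epsilon>\<^sup>2 / 2) * (1 + ln ((real n + 1) / (real m0 + 1))) \<le>
              B * (\<epsilon>\<^sup>2 / 2) * (2 + G * t\<^sup>2 + ln ((real n + 1) / (real m + 1)))"
            by (rule mult_left_mono[OF L]) (use B in simp)
          have "\<bar>t\<bar> ^ 3 * third h n \<le> \<epsilon> ^ 3 / (32 * B) * t\<^sup>2"
            by (rule order_trans[OF t3 mult_right_mono[OF c(2)]]) simp
          then show "B * (2 / \<epsilon> ^ 3) * (\<bar>t\<bar> ^ 3 * third h n) \<le> B * (2 / \<epsilon> ^ 3) * (\<epsilon> ^ 3 / (32 * B) * t\<^sup>2)"
            by (rule mult_left_mono) (use B e2 in simp)
        qed
        also have "\<dots> = B * (\<epsilon>\<^sup>2 / 2) * 2 + B * (\<epsilon>\<^sup>2 / 2) * G * t\<^sup>2 + B * (\<epsilon>\<^sup>2 / 2) * ln ((real n + 1) / (real m + 1)) + t\<^sup>2 / 16"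
          using B e2(1) by (simp add: algebra_simps)
        also have "\<dots> \<le> (\<theta> - \<beta>) * 2 + 1 / 16 * t\<^sup>2 + (\<theta> - \<beta>) * ln ((real n + 1) / (real m + 1)) + t\<^sup>2 / 16"
          using eB m by (intro add_mono mult_right_mono) auto
        finally show ?thesis by simp
      qed
      have "exp (- t\<^sup>2 / 4 + \<delta>) * exp (\<tau> * \<delta>) = exp (- t\<^sup>2 / 4 + (1 + \<tau>) * \<delta>)"
        unfolding exp_add[symmetric] by (simp add: algebra_simps)
      also have "\<dots> \<le> exp (2 * (\<theta> - \<beta>) + (- t\<^sup>2 / 8) + (\<theta> - \<beta>) * ln ((real n + 1) / (real m + 1)))"
        using bd by simp
      also have "\<dots> = exp (2 * (\<theta> - \<beta>)) * exp (- t\<^sup>2 / 8) * W"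
        unfolding exp_add by (simp add: W_def powr_def)
      finally have X: "exp (- t\<^sup>2 / 4 + \<delta>) * exp (\<tau> * \<delta>) \<le> exp (2 * (\<theta> - \<beta>)) * exp (- t\<^sup>2 / 8) * W" .
      have "norm (twist d f m) \<le> decayC \<beta> \<theta> D * ((real m + 1) powr (\<beta> - 1) * exp (\<Sum>j=1..m. (d j - \<beta>) / real j)) *
        (exp (- Df m0) + (real m0 / (real m + 1)) powr \<beta> * exp (\<tau> * Df m0)) * exp (\<tau> * (Df m - Df m0))"
        unfolding Df_def \<tau>_def by (rule split_decay_raw[OF params d f True])
      also have "\<dots> \<le> decayC \<beta> \<theta> D * (ecoef d m / (\<beta> * c0)) * (exp (- t\<^sup>2 / 4 + \<delta>) + exp (- t\<^sup>2 / 4 + \<delta>)) * exp (\<tau> * \<delta>)"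
        using P R E1 E2 E3 dC c0 params p
        by (intro mult_mono mult_left_mono add_mono) (auto simp: mult.commute intro: order_trans)
      also have "\<dots> = 2 * C' * ecoef d m * (exp (- t\<^sup>2 / 4 + \<delta>) * exp (\<tau> * \<delta>))"
        by (simp add: C'_def)
      also have "\<dots> \<le> 2 * C' * ecoef d m * (exp (2 * (\<theta> - \<beta>)) * exp (- t\<^sup>2 / 8) * W)"
        using X C' p by (intro mult_left_mono) auto
      also have "\<dots> = (2 * C' * exp (2 * (\<theta> - \<beta>))) * W * exp (- t\<^sup>2 / 8) * ecoef d m"
        by (simp only: mult_ac)
      also have "\<dots> \<le> C * W * exp (- t\<^sup>2 / 8) * ecoef d m"
        using C W p by (intro mult_right_mono) auto
      finally show ?thesis by (simp add: W_def f_def)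
    qed
  qed
qed

lemma ecoef_ratio_theta_le:
  assumes "\<And>j. \<theta> \<le> d j \<and> d j \<le> D" "m \<le> n"
  shows "ecoef d m \<le> (2 + 2 * D / \<theta>) / \<theta> * ((real n + 1) / (real m + 1)) powr (1 - \<theta>) * ecoef d n"
  using ecoef_ratio_le[of \<theta> d D m n] assms params by auto

text \<open>Geometric interpolation between the smoothness of \<open>twist_crude_smooth\<close>, which comes with a growing
exponential of \<open>t\<^sup>2\<close>, and the decay of \<open>twist_decay\<close>. A small share \<open>s\<close> of the former leaves a
positive order \<open>\<beta> * s\<close> of smoothness together with Gaussian decay.\<close>

lemma twist_smooth:
  assumes "0 < \<kappa>0"
  obtains C c \<kappa> where "0 < C" "0 < c" "0 < \<kappa>" "\<kappa> \<le> \<kappa>0"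
    "\<And>d h n t m i. admissible \<theta> D d h n \<Longrightarrow>
      \<bar>t\<bar> * third h n \<le> c \<Longrightarrow> 1 \<le> i \<Longrightarrow> i \<le> m \<Longrightarrow> m \<le> n \<Longrightarrow>
      norm (twist d (phase h t) m - twist d (phase h t) (m - i)) \<le>
        C * ((real i / (real m + 1)) powr \<kappa> * ((real n + 1) / (real (m - i) + 1)) powr (1 - \<beta>)) * exp (- t\<^sup>2 / 32) * ecoef d n"
    "\<And>d h n t m. admissible \<theta> D d h n \<Longrightarrow>
      \<bar>t\<bar> * third h n \<le> c \<Longrightarrow> m \<le> n \<Longrightarrow>
      norm (twist d (phase h t) m) \<le> C * ((real n + 1) / (real m + 1)) powr (1 - \<beta>) * exp (- t\<^sup>2 / 32) * ecoef d n"
proof -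
  define \<tau> where "\<tau> = tiltc \<beta> \<theta>"
  have tau: "0 < \<tau>" unfolding \<tau>_def using params by (intro tiltc_pos)
  obtain C2 c where C2: "0 < C2" "0 < c"
    "\<And>d h n t m. admissible \<theta> D d h n \<Longrightarrow>
      \<bar>t\<bar> * third h n \<le> c \<Longrightarrow> m \<le> n \<Longrightarrow>
      norm (twist d (phase h t) m) \<le> C2 * ((real n + 1) / (real m + 1)) powr (\<theta> - \<beta>) * exp (- t\<^sup>2 / 8) * ecoef d m"
    using twist_decay by blast
  define C1 where "C1 = (16 + 8 * tiltE \<beta> \<theta> D / \<beta>) / \<beta>"
  define C3 where "C3 = C2 * ((2 + 2 * D / \<theta>) / \<theta>)"
  define K where "K = C1 + 2 * C3"
  \<comment> \<open>\<open>1 / (16 * \<tau>)\<close> keeps the growth below \<open>exp (t\<^sup>2 / 32)\<close>, while a share of at least one half of the decay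
    contributes \<open>exp (- t\<^sup>2 / 16)\<close>\<close>
  define s where "s = min (1/2) (min (1 / (16 * \<tau>)) (\<kappa>0 / \<beta>))"
  have C1: "0 < C1" using tiltE_ge[OF params] params by (auto simp: C1_def intro!: divide_pos_pos add_pos_pos)
  have C3: "0 < C3" using C2 params by (auto simp: C3_def intro!: mult_pos_pos divide_pos_pos add_pos_nonneg)
  have K: "0 < K" "C1 \<le> K" "2 * C3 \<le> K" "C3 \<le> K" using C1 C3 by (auto simp: K_def)
  have s: "0 < s" "s \<le> 1 / 2" "s \<le> 1 / (16 * \<tau>)" "s \<le> \<kappa>0 / \<beta>"
    using tau assms params unfolding s_def by (simp, linarith, linarith, linarith)
  have sb: "\<beta> * s \<le> \<kappa>0" using s(4) params by (simp add: field_simps)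
  have dec: "norm (twist d (phase h t) m) \<le> C3 * ((real n + 1) / (real m + 1)) powr (1 - \<beta>) * exp (- t\<^sup>2 / 8) * ecoef d n"
    if ad: "admissible \<theta> D d h n"
      and t: "\<bar>t\<bar> * third h n \<le> c" and m: "m \<le> n" for d h n t m
  proof -
    note d = admissibleD(1)[OF ad] and u = admissibleD(2)[OF ad]
    define Q where "Q = (real n + 1) / (real m + 1)"
    have "norm (twist d (phase h t) m) \<le> C2 * Q powr (\<theta> - \<beta>) * exp (- t\<^sup>2 / 8) * ecoef d m"
      unfolding Q_def by (rule C2(3)[OF ad t m])
    also have "\<dots> \<le> C2 * Q powr (\<theta> - \<beta>) * exp (- t\<^sup>2 / 8) * ((2 + 2 * D / \<theta>) / \<theta> * Q powr (1 - \<theta>) * ecoef d n)"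
      unfolding Q_def using C2 by (intro mult_left_mono ecoef_ratio_theta_le[OF d m]) auto
    also have "\<dots> = C3 * (Q powr (\<theta> - \<beta>) * Q powr (1 - \<theta>)) * exp (- t\<^sup>2 / 8) * ecoef d n"
      by (simp add: C3_def)
    also have "Q powr (\<theta> - \<beta>) * Q powr (1 - \<theta>) = Q powr (1 - \<beta>)" by (simp add: powr_add[symmetric])
    finally show ?thesis unfolding Q_def .
  qed
  show thesis
  proof (rule that[OF K(1) C2(2) mult_pos_pos[OF params(1) s(1)] sb])
    fix d h :: "nat \<Rightarrow> real" and n m :: nat and t :: real
    assume ad: "admissible \<theta> D d h n"
      and t: "\<bar>t\<bar> * third h n \<le> c" and m: "m \<le> n"
    note d = admissibleD(1)[OF ad] and u = admissibleD(2)[OF ad]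
    have p: "0 < ecoef d n" by (rule ecoef_d_pos[OF params d, of "\<lambda>_. 0"]) auto
    have "norm (twist d (phase h t) m) \<le> C3 * ((real n + 1) / (real m + 1)) powr (1 - \<beta>) * exp (- t\<^sup>2 / 8) * ecoef d n"
      by (rule dec[OF ad t m])
    also have "\<dots> \<le> K * ((real n + 1) / (real m + 1)) powr (1 - \<beta>) * exp (- t\<^sup>2 / 32) * ecoef d n"
      using K p C3 by (intro mult_mono) auto
    finally show "norm (twist d (phase h t) m) \<le> \<dots>" .
  next
    fix d h :: "nat \<Rightarrow> real" and n m i :: nat and t :: real
    assume ad: "admissible \<theta> D d h n"
      and t: "\<bar>t\<bar> * third h n \<le> c" and i: "1 \<le> i" "i \<le> m" and m: "m \<le> n"
    note d = admissibleD(1)[OF ad] and u = admissibleD(2)[OF ad]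
    define f where "f = phase h t"
    have f: "norm (f j) \<le> 1" for j by (simp add: f_def)
    have d0: "0 \<le> d j \<and> d j \<le> D" for j using d[of j] params by auto
    define W where "W = ((real n + 1) / (real (m - i) + 1)) powr (1 - \<beta>)"
    define x where "x = real i / (real m + 1)"
    define Q where "Q = K * W * ecoef d n"
    define z where "z = norm (twist d f m - twist d f (m - i))"
    have p: "0 < ecoef d n" by (rule ecoef_d_pos[OF params d f])
    have Q: "0 \<le> Q" using K p by (simp add: Q_def W_def)
    have x: "0 < x" using i by (simp add: x_def)
    have z1: "z \<le> Q * (x powr \<beta> * exp (\<tau> * t\<^sup>2 / 2))"
    proof -
      have "z \<le> C1 * x powr \<beta> * W * ecoef d n * exp (\<tau> * defect d f n)"
        unfolding z_def C1_def x_def W_def \<tau>_def by (rule twist_crude_smooth[OF params d f i(2) m])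
      also have "\<dots> \<le> K * x powr \<beta> * W * ecoef d n * exp (\<tau> * (t\<^sup>2 / 2))"
        using defect_phase_le[OF d0 u, of t] tau K C1 p
        by (intro mult_mono) (auto simp: f_def W_def)
      finally show ?thesis by (simp add: Q_def mult_ac)
    qed
    have z2: "z \<le> Q * exp (- t\<^sup>2 / 8)"
    proof -
      have "z \<le> norm (twist d f m) + norm (twist d f (m - i))" unfolding z_def by (rule norm_triangle_ineq4)
      also have "\<dots> \<le> C3 * ((real n + 1) / (real m + 1)) powr (1 - \<beta>) * exp (- t\<^sup>2 / 8) * ecoef d n + C3 * W * exp (- t\<^sup>2 / 8) * ecoef d n"
        unfolding f_def W_def using m by (intro add_mono dec[OF ad t]) auto
      also have "\<dots> \<le> C3 * W * exp (- t\<^sup>2 / 8) * ecoef d n + C3 * W * exp (- t\<^sup>2 / 8) * ecoef d n"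
        unfolding W_def using C3 p params
        by (intro add_right_mono mult_right_mono mult_left_mono powr_mono2 divide_left_mono) auto
      also have "\<dots> = 2 * C3 * (W * exp (- t\<^sup>2 / 8) * ecoef d n)" by simp
      also have "\<dots> \<le> K * (W * exp (- t\<^sup>2 / 8) * ecoef d n)"
        using K p by (intro mult_right_mono) (auto simp: W_def)
      finally show ?thesis by (simp add: Q_def mult_ac)
    qed
    have "z \<le> Q * ((x powr \<beta> * exp (\<tau> * t\<^sup>2 / 2)) powr s * exp (- t\<^sup>2 / 8) powr (1 - s))"
      by (rule interpolate_le[OF z1 z2 Q]) (use x s in auto)
    also have "(x powr \<beta> * exp (\<tau> * t\<^sup>2 / 2)) powr s * exp (- t\<^sup>2 / 8) powr (1 - s) =
        x powr (\<beta> * s) * exp (s * \<tau> * t\<^sup>2 / 2 - (1 - s) * t\<^sup>2 / 8)"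
      using x by (simp add: powr_mult powr_powr exp_powr_real exp_add[symmetric] algebra_simps)
    also have "\<dots> \<le> x powr (\<beta> * s) * exp (- t\<^sup>2 / 32)"
    proof -
      have "s * \<tau> \<le> 1 / 16" using s(3) tau by (simp add: field_simps)
      then have "s * \<tau> * t\<^sup>2 \<le> 1 / 16 * t\<^sup>2" by (intro mult_right_mono) auto
      moreover have "1 / 2 * t\<^sup>2 \<le> (1 - s) * t\<^sup>2" using s by (intro mult_right_mono) auto
      ultimately show ?thesis by (intro mult_left_mono) auto
    qed
    finally have "z \<le> Q * (x powr (\<beta> * s) * exp (- t\<^sup>2 / 32))" using Q by (simp add: mult_left_mono)
    then show "norm (twist d (phase h t) m - twist d (phase h t) (m - i)) \<le>
        K * ((real i / (real m + 1)) powr (\<beta> * s) * ((real n + 1) / (real (m - i) + 1)) powr (1 - \<beta>)) * exp (- t\<^sup>2 / 32) * ecoef d n"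
      by (simp add: z_def Q_def x_def W_def f_def mult_ac)
  qed
qed

end

section \<open>Second-order expansion\<close>

text \<open>The gain \<open>(i / m) powr \<kappa>\<close> from smoothness against the singularity at \<open>i = m\<close>, where an index close to \<open>0\<close>
is compared with \<open>m\<close>. The shift by \<open>1\<close> keeps all quotients finite.\<close>

definition wfac :: "real \<Rightarrow> real \<Rightarrow> nat \<Rightarrow> nat \<Rightarrow> real" where
  "wfac \<kappa> a m i = (real i / (real m + 1)) powr \<kappa> * ((real m + 1) / (real (m - i) + 1)) powr a"

text \<open>The scales below \<open>n\<close> are included because a difference over \<open>i\<close> is also taken at the index \<open>n - j\<close>.\<close>

definition weighted_bound :: "real \<Rightarrow> real \<Rightarrow> nat \<Rightarrow> (nat \<Rightarrow> real) \<Rightarrow> real \<Rightarrow> bool" where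
  "weighted_bound \<kappa> a n h \<rho> \<longleftrightarrow>
    (\<forall>m. 1 \<le> m \<longrightarrow> m \<le> n \<longrightarrow> (\<Sum>i=1..m. \<bar>h i\<bar> / real i * wfac \<kappa> a m i) \<le> \<rho>)"

lemma wfac_nonneg: "0 \<le> wfac \<kappa> a m i"
  by (simp add: wfac_def)

text \<open>The bound for \<open>(M (n - j - i) - M (n - j)) - (M (n - i) - M n)\<close>, where \<open>M\<close> denotes the
twisted coefficients, with \<open>M\<close> equal to \<open>0\<close> at negative indices. Each bracket is estimated by smoothness
over \<open>i\<close>; for \<open>i + j > n\<close> the first one consists of the single term \<open>M (n - j)\<close>, and decay replaces
smoothness.\<close>

definition diffker :: "real \<Rightarrow> real \<Rightarrow> nat \<Rightarrow> nat \<Rightarrow> nat \<Rightarrow> real" where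
  "diffker \<kappa> a n i j =
    (if i + j \<le> n
     then (real i / (real (n - j) + 1)) powr \<kappa> * ((real n + 1) / (real (n - j - i) + 1)) powr a
     else ((real n + 1) / (real (n - j) + 1)) powr a)
    + (real i / (real n + 1)) powr \<kappa> * ((real n + 1) / (real (n - i) + 1)) powr a"

text \<open>The kernel is smooth only in \<open>i\<close>. Because \<open>i \<le> j\<close>, one half of the gain \<open>i powr (2 * k)\<close> may be given to
\<open>j\<close>, and the bound factors into a weight in \<open>j\<close> and a weight in \<open>i\<close>. For \<open>i + j > n\<close> no gain is
present, but then \<open>j\<close> is at least of the order of \<open>n\<close> and \<open>i\<close> exceeds \<open>n - j\<close>; the additional \<open>k\<close> in the exponent of the
singularity \<open>(n / (n - j)) powr (a + k)\<close> makes up for the factor \<open>(i / n) powr k\<close>.\<close>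

lemma diffker_le:
  assumes k: "0 < k" "k \<le> 1" and a: "0 \<le> a" and ij: "1 \<le> i" "i \<le> j" "j \<le> n"
  shows "diffker (2 * k) a n i j \<le> wfac k (a + k) n j *
    (3 * wfac k (a + k) n i + (if i \<le> n - j then wfac k (a + k) (n - j) i else 0))"
proof -
  define N where "N = real n + 1"
  define m where "m = n - j"
  define M where "M = real m + 1"
  define x where "x = real i"
  define y where "y = real j"
  define F where "F = wfac k (a + k) n j"
  define u where "u = wfac k (a + k) n i"
  have N: "N \<ge> 1" and M: "M \<ge> 1" "M \<le> N" "M + y = N" and x: "x \<ge> 1" "x \<le> y"
    using ij by (auto simp: N_def M_def x_def y_def m_def of_nat_diff)
  have F: "F = (y / N) powr k * (N / M) powr (a + k)" by (simp add: F_def wfac_def y_def N_def M_def m_def)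
  define L where "L = real (n - i) + 1"
  have L: "L \<ge> 1" "L \<le> N" by (auto simp: L_def N_def)
  have u: "u = (x / N) powr k * (N / L) powr (a + k)" by (simp add: u_def wfac_def x_def N_def L_def)
  have sq: "z powr (2 * k) = z powr k * z powr k" if "0 \<le> z" for z :: real
    by (simp add: powr_add[symmetric])
  have yN: "(y / N) powr k \<le> F"
    unfolding F using M a k by (auto intro!: mult_le_cancel_left1[THEN iffD2] ge_one_powr_ge_zero)
  have xN: "(x / N) powr k \<le> u"
    unfolding u using L a k by (auto intro!: mult_le_cancel_left1[THEN iffD2] ge_one_powr_ge_zero)
  have two: "(x / N) powr (2 * k) * (N / L) powr a \<le> F * u"
  proof -
    have "(x / N) powr (2 * k) * (N / L) powr a = (x / N) powr k * ((x / N) powr k * (N / L) powr a)"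
      using sq[of "x / N"] x N by simp
    also have "\<dots> \<le> (y / N) powr k * ((x / N) powr k * (N / L) powr (a + k))"
      using x N L a k by (intro mult_mono powr_mono2 powr_mono divide_right_mono) auto
    also have "\<dots> \<le> F * u" unfolding u using yN by (intro mult_right_mono) auto
    finally show ?thesis .
  qed
  show ?thesis
  proof (cases "i + j \<le> n")
    case True
    define l where "l = real (m - i) + 1"
    have l: "l \<ge> 1" "l \<le> M" by (auto simp: l_def M_def)
    define w where "w = wfac k (a + k) m i"
    have w: "w = (x / M) powr k * (M / l) powr (a + k)" by (simp add: w_def wfac_def x_def M_def l_def)
    have "(x / M) powr (2 * k) * (N / l) powr a = (x / M) powr k * (x / M) powr k * ((M / l) powr a * (N / M) powr a)"
      using sq[of "x / M"] x M l by (simp add: powr_mult[symmetric])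
    also have "\<dots> \<le> (y / M) powr k * (x / M) powr k * ((M / l) powr (a + k) * (N / M) powr a)"
      using x N M l a k by (intro mult_mono powr_mono2 powr_mono divide_right_mono) auto
    also have "(y / M) powr k = (y / N) powr k * (N / M) powr k"
      using x N M by (simp add: powr_mult[symmetric])
    also have "(y / N) powr k * (N / M) powr k * (x / M) powr k * ((M / l) powr (a + k) * (N / M) powr a) =
        F * w" unfolding F w by (simp add: powr_add)
    finally have "(x / M) powr (2 * k) * (N / l) powr a \<le> F * w" .
    then have "diffker (2 * k) a n i j \<le> F * w + F * u"
      using True two by (simp add: diffker_def x_def M_def l_def m_def N_def L_def)
    also have "F * w + F * u \<le> F * (3 * u + w)"
      using wfac_nonneg[of k "a + k" n j] wfac_nonneg[of k "a + k" n i] by (simp add: F_def u_def algebra_simps)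
    finally have "diffker (2 * k) a n i j \<le> F * (3 * u + w)" .
    moreover have "i \<le> n - j" using True by simp
    ultimately show ?thesis by (simp add: F_def u_def w_def m_def)
  next
    case False
    then have xM: "1 \<le> x / M" using ij M by (simp add: x_def M_def m_def)
    have y2: "1 / 2 \<le> y / N" using False ij N by (auto simp: y_def N_def field_simps)
    have "1 / 2 \<le> (1 / 2) powr k" using powr_mono'[of k 1 "1/2"] k by simp
    also have "\<dots> \<le> (y / N) powr k" using y2 k by (intro powr_mono2) auto
    finally have h: "1 \<le> 2 * (y / N) powr k" by simp
    have "1 \<le> (x / M) powr k" using xM k by (intro ge_one_powr_ge_zero) auto
    also have "\<dots> = (x / N) powr k * (N / M) powr k" using x N M by (simp add: powr_mult[symmetric])
    finally have h2: "1 \<le> (x / N) powr k * (N / M) powr k" .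
    have "(N / M) powr a * 1 * 1 \<le> (N / M) powr a * ((x / N) powr k * (N / M) powr k) * (2 * (y / N) powr k)"
      using h h2 by (intro mult_mono) auto
    also have "\<dots> = 2 * F * (x / N) powr k" by (simp add: F powr_add)
    also have "\<dots> \<le> 2 * F * u" using xN wfac_nonneg[of k "a + k" n j] by (intro mult_left_mono) (auto simp: F_def)
    finally have "(N / M) powr a \<le> 2 * F * u" by simp
    then have "diffker (2 * k) a n i j \<le> 2 * F * u + F * u"
      using False two by (simp add: diffker_def x_def M_def m_def N_def L_def)
    also have "2 * F * u + F * u = F * (3 * u)" by simp
    finally have "diffker (2 * k) a n i j \<le> F * (3 * u)" .
    moreover have "\<not> i \<le> n - j" using False ij by auto
    ultimately show ?thesis by (simp add: F_def u_def)
  qed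
qed

lemma diffker_sum_le:
  assumes k: "0 < k" "k \<le> 1" and a: "0 \<le> a" and w: "weighted_bound k (a + k) n h \<rho>" and n: "1 \<le> n"
  shows "(\<Sum>j=1..n. \<bar>h j\<bar> / real j * (\<Sum>i=1..j. \<bar>h i\<bar> / real i * diffker (2 * k) a n i j)) \<le> 4 * \<rho>\<^sup>2"
proof -
  let ?w = "wfac k (a + k)"
  let ?g = "\<lambda>i. \<bar>h i\<bar> / real i"
  have wn: "(\<Sum>i=1..n. ?g i * ?w n i) \<le> \<rho>" using w n unfolding weighted_bound_def by blast
  then have \<rho>: "0 \<le> \<rho>" by (rule order_trans[rotated]) (intro sum_nonneg, simp add: wfac_nonneg)
  have inner: "(\<Sum>i=1..j. ?g i * diffker (2 * k) a n i j) \<le> ?w n j * (4 * \<rho>)" if j: "j \<in> {1..n}" for j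
  proof -
    have "(\<Sum>i=1..j. ?g i * diffker (2 * k) a n i j) \<le>
        (\<Sum>i=1..j. ?w n j * (3 * (?g i * ?w n i) + (if i \<le> n - j then ?g i * ?w (n - j) i else 0)))"
    proof (rule sum_mono)
      fix i assume i: "i \<in> {1..j}"
      have "?g i * diffker (2 * k) a n i j \<le> ?g i * (?w n j * (3 * ?w n i + (if i \<le> n - j then ?w (n - j) i else 0)))"
        using i j by (intro mult_left_mono diffker_le k a) auto
      then show "?g i * diffker (2 * k) a n i j \<le>
          ?w n j * (3 * (?g i * ?w n i) + (if i \<le> n - j then ?g i * ?w (n - j) i else 0))"
        by (auto simp: algebra_simps)
    qed
    also have "\<dots> \<le> (\<Sum>i=1..n. ?w n j * (3 * (?g i * ?w n i) + (if i \<le> n - j then ?g i * ?w (n - j) i else 0)))"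
      using j by (intro sum_mono2) (auto intro!: mult_nonneg_nonneg add_nonneg_nonneg divide_nonneg_nonneg wfac_nonneg)
    also have "\<dots> = ?w n j * (3 * (\<Sum>i=1..n. ?g i * ?w n i) + (\<Sum>i=1..n. if i \<le> n - j then ?g i * ?w (n - j) i else 0))"
      unfolding sum_distrib_left[symmetric] sum.distrib ..
    also have "(\<Sum>i=1..n. if i \<le> n - j then ?g i * ?w (n - j) i else 0) = (\<Sum>i\<in>{1..n-j}. ?g i * ?w (n - j) i)"
      by (subst sum.If_cases) (auto intro!: sum.cong)
    also have "?w n j * (3 * (\<Sum>i=1..n. ?g i * ?w n i) + (\<Sum>i\<in>{1..n-j}. ?g i * ?w (n - j) i)) \<le> ?w n j * (3 * \<rho> + \<rho>)"
    proof (intro mult_left_mono add_mono wfac_nonneg)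
      show "(\<Sum>i\<in>{1..n-j}. ?g i * ?w (n - j) i) \<le> \<rho>"
      proof (cases "n - j = 0")
        case False
        then have "1 \<le> n - j" "n - j \<le> n" by auto
        then show ?thesis using w unfolding weighted_bound_def by blast
      qed (use \<rho> in simp)
    qed (use wn in auto)
    finally show ?thesis by simp
  qed
  have "(\<Sum>j=1..n. ?g j * (\<Sum>i=1..j. ?g i * diffker (2 * k) a n i j)) \<le> (\<Sum>j=1..n. ?g j * (?w n j * (4 * \<rho>)))"
    by (intro sum_mono mult_left_mono inner) auto
  also have "\<dots> = 4 * \<rho> * (\<Sum>j=1..n. ?g j * ?w n j)" by (simp add: sum_distrib_left mult_ac)
  also have "\<dots> \<le> 4 * \<rho> * \<rho>" using wn \<rho> by (intro mult_left_mono) auto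
  finally show ?thesis by (simp add: power2_eq_square)
qed

lemma symmetric_double_sum_le:
  fixes g :: "nat \<Rightarrow> real" and k :: "nat \<Rightarrow> nat \<Rightarrow> real"
  assumes g: "\<And>i. 0 \<le> g i" and k: "\<And>i j. 0 \<le> k i j"
  shows "(\<Sum>j=1..n. \<Sum>i=1..n. g i * g j * k (min i j) (max i j)) \<le>
    2 * (\<Sum>j=1..n. g j * (\<Sum>i=1..j. g i * k i j))"
proof -
  define T where "T i j = (if i \<le> j then g i * g j * k i j else 0)" for i j
  have T: "(\<Sum>j=1..n. \<Sum>i=1..n. T i j) = (\<Sum>j=1..n. g j * (\<Sum>i=1..j. g i * k i j))"
  proof (rule sum.cong)
    fix j assume j: "j \<in> {1..n}"
    have "(\<Sum>i=1..n. T i j) = (\<Sum>i\<in>{1..j}. T i j)"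
      by (rule sum.mono_neutral_right) (use j in \<open>auto simp: T_def\<close>)
    also have "\<dots> = g j * (\<Sum>i=1..j. g i * k i j)"
      by (simp add: T_def sum_distrib_left mult_ac)
    finally show "(\<Sum>i=1..n. T i j) = g j * (\<Sum>i=1..j. g i * k i j)" .
  qed simp
  have "(\<Sum>j=1..n. \<Sum>i=1..n. g i * g j * k (min i j) (max i j)) \<le> (\<Sum>j=1..n. \<Sum>i=1..n. T i j + T j i)"
    using g k by (intro sum_mono) (auto simp: T_def min_def max_def mult_ac)
  also have "\<dots> = (\<Sum>j=1..n. \<Sum>i=1..n. T i j) + (\<Sum>j=1..n. \<Sum>i=1..n. T j i)" by (simp add: sum.distrib)
  also have "(\<Sum>j=1..n. \<Sum>i=1..n. T j i) = (\<Sum>j=1..n. \<Sum>i=1..n. T i j)" by (rule sum.swap)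
  finally show ?thesis unfolding T by simp
qed

text \<open>The derivative of \<open>d j * phase h t j / j\<close> in \<open>t\<close>, that is, of one term of the exponent.\<close>

definition dphase :: "(nat \<Rightarrow> real) \<Rightarrow> (nat \<Rightarrow> real) \<Rightarrow> real \<Rightarrow> nat \<Rightarrow> complex" where
  "dphase d h t j = \<i> * of_real (d j * h j / real j) * phase h t j"

lemma phase_has_derivative:
  "((\<lambda>t. phase h t j) has_vector_derivative (\<i> * of_real (h j) * phase h t j)) (at t)"
proof -
  have "((\<lambda>z. exp (\<i> * (z * of_real (h j)))) has_field_derivative (\<i> * of_real (h j) * phase h t j)) (at (of_real t))"
    by (auto intro!: derivative_eq_intros)
  from has_vector_derivative_real_field[OF this] show ?thesis by simp
qed

text \<open>Coefficientwise form of \<open>(exp W)' = W' * exp W\<close>, by induction along the recursion.\<close>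

lemma twist_has_derivative:
  "((\<lambda>t. twist d (phase h t) m) has_vector_derivative
    (\<Sum>i=1..m. dphase d h t i * twist d (phase h t) (m - i))) (at t)"
proof (induction m rule: less_induct)
  case (less m)
  let ?T = "\<lambda>t m. twist d (phase h t) m"
  let ?V = "\<lambda>m. \<Sum>i=1..m. dphase d h t i * ?T t (m - i)"
  let ?w = "\<lambda>t j. of_real (d j) * phase h t j"
  show ?case
  proof (cases "m = 0")
    case True
    then show ?thesis by (simp add: twist_def)
  next
    case False
    have rec: "of_nat m * ?T t m = (\<Sum>j=1..m. ?w t j * ?T t (m - j))" for t m
      unfolding twist_def by (rule ecoef_rec)
    then have eq: "?T t m = (\<Sum>j=1..m. ?w t j * ?T t (m - j)) / of_nat m" for t
      using False by (metis nonzero_mult_div_cancel_left of_nat_0_eq_iff)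
    have dw: "((\<lambda>t. ?w t j) has_vector_derivative (of_nat j * dphase d h t j)) (at t)" if "j \<ge> 1" for j
      using has_vector_derivative_mult_right[OF phase_has_derivative[of h j t], of "of_real (d j)"] that
      by (simp add: dphase_def mult_ac)
    have "((\<lambda>t. \<Sum>j=1..m. ?w t j * ?T t (m - j)) has_vector_derivative
        (\<Sum>j=1..m. ?w t j * ?V (m - j) + of_nat j * dphase d h t j * ?T t (m - j))) (at t)"
      by (intro has_vector_derivative_sum has_vector_derivative_mult dw less) auto
    then have "((\<lambda>t. (\<Sum>j=1..m. ?w t j * ?T t (m - j)) / of_nat m) has_vector_derivative
        (\<Sum>j=1..m. ?w t j * ?V (m - j) + of_nat j * dphase d h t j * ?T t (m - j)) / of_nat m) (at t)"
      by (rule has_vector_derivative_divide)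
    moreover have "(\<Sum>j=1..m. ?w t j * ?V (m - j) + of_nat j * dphase d h t j * ?T t (m - j)) / of_nat m = ?V m"
    proof -
      have "(\<Sum>j=1..m. ?w t j * ?V (m - j)) =
          (\<Sum>j\<in>{1..m}. \<Sum>i\<in>{i. i \<in> {1..m} \<and> i + j \<le> m}. ?w t j * (dphase d h t i * ?T t (m - j - i)))"
        by (intro sum.cong refl, subst sum_distrib_left, intro sum.cong) auto
      also have "\<dots> = (\<Sum>i\<in>{1..m}. \<Sum>j\<in>{j. j \<in> {1..m} \<and> i + j \<le> m}. ?w t j * (dphase d h t i * ?T t (m - j - i)))"
        by (rule sum.swap_restrict) auto
      also have "\<dots> = (\<Sum>i\<in>{1..m}. dphase d h t i * (\<Sum>j=1..m-i. ?w t j * ?T t (m - i - j)))"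
        by (intro sum.cong refl, subst sum_distrib_left, intro sum.cong) (auto simp: mult_ac add.commute)
      also have "\<dots> = (\<Sum>i\<in>{1..m}. dphase d h t i * (of_nat (m - i) * ?T t (m - i)))"
        unfolding rec ..
      finally have "(\<Sum>j=1..m. ?w t j * ?V (m - j) + of_nat j * dphase d h t j * ?T t (m - j)) =
          (\<Sum>i\<in>{1..m}. dphase d h t i * (of_nat (m - i) * ?T t (m - i)) + of_nat i * dphase d h t i * ?T t (m - i))"
        by (simp only: sum.distrib)
      also have "\<dots> = (\<Sum>i\<in>{1..m}. of_nat m * (dphase d h t i * ?T t (m - i)))"
        by (intro sum.cong) (auto simp: of_nat_diff algebra_simps)
      also have "\<dots> = of_nat m * ?V m" by (simp only: sum_distrib_left)
      finally show ?thesis using False by simp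
    qed
    ultimately show ?thesis unfolding eq[abs_def] by simp
  qed
qed

lemma norm_diff_le_of_derivative_bound:
  fixes g :: "real \<Rightarrow> complex"
  assumes "0 \<le> t" "\<And>u. 0 \<le> u \<Longrightarrow> u \<le> t \<Longrightarrow> (g has_vector_derivative g' u) (at u)"
    "\<And>u. 0 \<le> u \<Longrightarrow> u \<le> t \<Longrightarrow> norm (g' u) \<le> B"
  shows "norm (g t - g 0) \<le> t * B"
proof (cases "t = 0")
  case False
  then have t: "0 < t" using assms by simp
  have "continuous_on {0..t} g"
    using has_vector_derivative_continuous[OF assms(2)]
    by (intro continuous_at_imp_continuous_on ballI) auto
  then obtain u where u: "u \<in> {0<..<t}" "norm (g t - g 0) \<le> norm ((t - 0) *\<^sub>R g' u)"
    using mvt_general[of 0 t g "\<lambda>u x. x *\<^sub>R g' u"] t assms(2)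
    unfolding has_vector_derivative_def by auto
  then have "norm (g t - g 0) \<le> t * norm (g' u)" using t by simp
  also have "\<dots> \<le> t * B" using u t assms(3) by (intro mult_left_mono) auto
  finally show ?thesis .
qed simp

text \<open>The cumulant function of \<open>\<Sum>j. h j * Z j\<close> for independent Poisson variables \<open>Z j\<close> of mean \<open>d j / j\<close>; to leading
order it is the logarithm of \<open>twist d (phase h t) n / ecoef d n\<close>.\<close>

definition log_ratio :: "(nat \<Rightarrow> real) \<Rightarrow> (nat \<Rightarrow> real) \<Rightarrow> nat \<Rightarrow> real \<Rightarrow> complex" where
  "log_ratio d h n t = (\<Sum>j=1..n. of_real (d j / real j) * (phase h t j - 1))"

lemma Re_log_ratio: "Re (log_ratio d h n t) = - defect d (phase h t) n"
  unfolding log_ratio_def defect_phase Re_sum sum_negf[symmetric]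
  by (intro sum.cong) (auto simp: Re_exp algebra_simps diff_divide_distrib)

lemma log_ratio_has_derivative:
  "((\<lambda>t. log_ratio d h n t) has_vector_derivative (\<Sum>j=1..n. dphase d h t j)) (at t)"
proof -
  have "((\<lambda>t. of_real (d j / real j) * (phase h t j - 1)) has_vector_derivative dphase d h t j) (at t)" for j
  proof -
    have "((\<lambda>t. phase h t j - 1) has_vector_derivative (\<i> * of_real (h j) * phase h t j - 0)) (at t)"
      by (intro has_vector_derivative_diff phase_has_derivative has_vector_derivative_const)
    from has_vector_derivative_mult_right[OF this, of "of_real (d j / real j)"]
    show ?thesis by (simp add: dphase_def mult_ac)
  qed
  then show ?thesis unfolding log_ratio_def by (intro has_vector_derivative_sum)
qed

text \<open>Dividing by the Poisson approximation turns the derivative of the coefficient into a combination of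
differences of coefficients, as \<open>gauged_has_derivative\<close> shows; these are small by smoothness.\<close>

definition gauged :: "(nat \<Rightarrow> real) \<Rightarrow> (nat \<Rightarrow> real) \<Rightarrow> nat \<Rightarrow> nat \<Rightarrow> real \<Rightarrow> complex" where
  "gauged d h n m t = exp (- log_ratio d h n t) * twist d (phase h t) m"

text \<open>The coefficient at the index \<open>m - i\<close>, with the convention \<open>0\<close> for negative indices, so that sums over
lengths need not depend on \<open>m\<close>.\<close>

definition twistz :: "(nat \<Rightarrow> real) \<Rightarrow> (nat \<Rightarrow> complex) \<Rightarrow> nat \<Rightarrow> nat \<Rightarrow> complex" where
  "twistz d f m i = (if i \<le> m then twist d f (m - i) else 0)"

lemma gauged_has_derivative:
  assumes "m \<le> n"
  shows "((\<lambda>t. gauged d h n m t) has_vector_derivative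
    exp (- log_ratio d h n t) * (\<Sum>i=1..n. dphase d h t i * (twistz d (phase h t) m i - twist d (phase h t) m))) (at t)"
proof -
  let ?S = "\<Sum>j=1..n. dphase d h t j"
  let ?V = "\<Sum>i=1..m. dphase d h t i * twist d (phase h t) (m - i)"
  have 1: "((exp \<circ> (\<lambda>t. - log_ratio d h n t)) has_vector_derivative (- ?S * exp (- log_ratio d h n t))) (at t)"
    by (rule field_vector_diff_chain_at[OF has_vector_derivative_minus[OF log_ratio_has_derivative] DERIV_exp])
  have 2: "((\<lambda>t. exp (- log_ratio d h n t) * twist d (phase h t) m) has_vector_derivative
      (exp (- log_ratio d h n t) * ?V + (- ?S * exp (- log_ratio d h n t)) * twist d (phase h t) m)) (at t)"
    using has_vector_derivative_mult[OF 1 twist_has_derivative[of d h m t]] by (simp add: o_def)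
  have V: "?V = (\<Sum>i=1..n. dphase d h t i * twistz d (phase h t) m i)"
    by (rule sum.mono_neutral_cong_left) (use assms in \<open>auto simp: twistz_def\<close>)
  have "exp (- log_ratio d h n t) * ?V + (- ?S * exp (- log_ratio d h n t)) * twist d (phase h t) m =
      exp (- log_ratio d h n t) * (\<Sum>i=1..n. dphase d h t i * (twistz d (phase h t) m i - twist d (phase h t) m))"
    unfolding V by (simp add: right_diff_distrib sum_subtractf sum_distrib_right sum_distrib_left mult_ac)
  then show ?thesis using 2 unfolding gauged_def by simp
qed

lemma norm_dphase: "0 \<le> d j \<Longrightarrow> d j \<le> D \<Longrightarrow> norm (dphase d h t j) \<le> D * (\<bar>h j\<bar> / real j)"
proof -
  assume d: "0 \<le> d j" "d j \<le> D"
  have "norm (dphase d h t j) = \<bar>d j * h j / real j\<bar>"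
    unfolding dphase_def norm_mult norm_of_real by simp
  also have "\<dots> = d j * (\<bar>h j\<bar> / real j)" using d by (simp add: abs_mult)
  also have "\<dots> \<le> D * (\<bar>h j\<bar> / real j)" using d by (intro mult_right_mono) auto
  finally show ?thesis .
qed

context
  fixes \<beta> \<theta> D :: real
  assumes params: "0 < \<beta>" "\<beta> < \<theta>" "\<theta> \<le> 1" "\<theta> \<le> D"
begin

text \<open>Write \<open>M\<close> for the twisted coefficients, \<open>U\<close> for \<open>log_ratio\<close>, and \<open>Y m = exp (- U) * M m\<close>. Then
\<open>(Y n)' = (\<Sum>j. U\<^sub>j' * (Y (n - j) - Y n))\<close>, where \<open>U\<^sub>j\<close> is the term of \<open>U\<close> for the length \<open>j\<close>. With the differences
taken at \<open>t = 0\<close> this integrates to the linear correction in the statement. The remainder contains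
\<open>Y (n - j) - Y n\<close> minus its value at \<open>t = 0\<close>, to which the same formula applies; the result is a double
sum over \<open>i\<close> and \<open>j\<close> of mixed second differences of \<open>M\<close>, which \<open>diffker_sum_le\<close> bounds by the square of
a single weighted sum. At \<open>t = 0\<close> the smoothness of \<open>M\<close> gives the last claim.\<close>

lemma twist_expansion:
  assumes k0: "0 < k0"
  obtains C c k where "0 < C" "0 < c" "0 < k" "k \<le> k0"
    "\<And>d h n t \<rho>. admissible \<theta> D d h n \<Longrightarrow>
      1 \<le> n \<Longrightarrow> weighted_bound k (1 - \<beta> + k) n h \<rho> \<Longrightarrow> 0 \<le> t \<Longrightarrow> t * third h n \<le> c \<Longrightarrow>
      norm (twist d (phase h t) n / of_real (ecoef d n) - exp (log_ratio d h n t) *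
        (1 + (\<Sum>j=1..n. of_real (d j / real j) * (phase h t j - 1) * of_real (ecoef d (n - j) / ecoef d n - 1))))
      \<le> C * (t\<^sup>2 * \<rho>\<^sup>2 * exp (- t\<^sup>2 / 64))"
    "\<And>d h n t. admissible \<theta> D d h n \<Longrightarrow>
      0 \<le> t \<Longrightarrow> t * third h n \<le> c \<Longrightarrow> 31 / 64 * t\<^sup>2 \<le> defect d (phase h t) n"
    "\<And>d h n \<rho>. admissible \<theta> D d h n \<Longrightarrow>
      1 \<le> n \<Longrightarrow> weighted_bound k (1 - \<beta> + k) n h \<rho> \<Longrightarrow>
      (\<Sum>j=1..n. \<bar>h j\<bar> / real j * \<bar>ecoef d (n - j) / ecoef d n - 1\<bar>) \<le> C * \<rho>"
proof -
  have D: "0 < D" using params by linarith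
  define a where "a = 1 - \<beta>"
  have a: "0 \<le> a" using params by (simp add: a_def)
  have k0': "0 < min 2 (2 * k0)" using k0 by simp
  obtain C c1 \<kappa> where C: "0 < C" "0 < c1" "0 < \<kappa>" "\<kappa> \<le> min 2 (2 * k0)"
    and smooth: "\<And>d h n t m i. admissible \<theta> D d h n \<Longrightarrow>
      \<bar>t\<bar> * third h n \<le> c1 \<Longrightarrow> 1 \<le> i \<Longrightarrow> i \<le> m \<Longrightarrow> m \<le> n \<Longrightarrow>
      norm (twist d (phase h t) m - twist d (phase h t) (m - i)) \<le>
        C * ((real i / (real m + 1)) powr \<kappa> * ((real n + 1) / (real (m - i) + 1)) powr a) * exp (- t\<^sup>2 / 32) * ecoef d n"
    and decay: "\<And>d h n t m. admissible \<theta> D d h n \<Longrightarrow>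
      \<bar>t\<bar> * third h n \<le> c1 \<Longrightarrow> m \<le> n \<Longrightarrow>
      norm (twist d (phase h t) m) \<le> C * ((real n + 1) / (real m + 1)) powr a * exp (- t\<^sup>2 / 32) * ecoef d n"
    using twist_smooth[OF params k0'] unfolding a_def by blast
  define k where "k = \<kappa> / 2"
  have k: "0 < k" "k \<le> 1" "k \<le> k0" "\<kappa> = 2 * k" using C by (auto simp: k_def)
  define c where "c = min c1 (3 / (32 * D))"
  have c: "0 < c" "c \<le> c1" "c \<le> 3 / (32 * D)" using C D by (auto simp: c_def)
  define K where "K = C + 8 * D\<^sup>2 * C"
  have K: "0 < K" "C \<le> K" "8 * D\<^sup>2 * C \<le> K" using C by (auto simp: K_def add_pos_nonneg)
  have dlow: "31 / 64 * t\<^sup>2 \<le> defect d (phase h t) n"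
    if ad: "admissible \<theta> D d h n"
      and t: "0 \<le> t" "t * third h n \<le> c" for d h n t
  proof -
    note d = admissibleD(1)[OF ad] and u = admissibleD(2)[OF ad]
    have d0: "0 \<le> d j \<and> d j \<le> D" for j using d[of j] params by auto
    have "D * \<bar>t\<bar> ^ 3 * third h n / 6 = D * t\<^sup>2 / 6 * (t * third h n)"
      using t by (simp add: power3_eq_cube power2_eq_square)
    also have "\<dots> \<le> D * t\<^sup>2 / 6 * (3 / (32 * D))" using t c D by (intro mult_left_mono) auto
    also have "\<dots> = t\<^sup>2 / 64" using D by simp
    finally show ?thesis using defect_phase_ge[OF d0 u, of t] by linarith
  qed
  show thesis
  proof (rule that[OF K(1) c(1) k(1) k(3)])
    fix d h :: "nat \<Rightarrow> real" and n :: nat and t :: real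
    assume "admissible \<theta> D d h n" "0 \<le> t" "t * third h n \<le> c"
    then show "31 / 64 * t\<^sup>2 \<le> defect d (phase h t) n" by (rule dlow)
  next
    fix d h :: "nat \<Rightarrow> real" and n :: nat and \<rho> :: real
    assume ad: "admissible \<theta> D d h n"
      and n: "1 \<le> n" and w: "weighted_bound k (1 - \<beta> + k) n h \<rho>"
    note d = admissibleD(1)[OF ad] and u = admissibleD(2)[OF ad]
    have p: "0 < ecoef d n" by (rule ecoef_d_pos[OF params d, of "\<lambda>_. 0"]) auto
    have tw0: "twist d (phase h 0) m = of_real (ecoef d m)" for m by (simp add: twist_def ecoef_of_real)
    have "(\<Sum>j=1..n. \<bar>h j\<bar> / real j * \<bar>ecoef d (n - j) / ecoef d n - 1\<bar>) \<le>
        (\<Sum>j=1..n. \<bar>h j\<bar> / real j * (C * wfac k (a + k) n j))"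
    proof (intro sum_mono mult_left_mono)
      fix j assume j: "j \<in> {1..n}"
      have "\<bar>ecoef d n - ecoef d (n - j)\<bar> = norm (twist d (phase h 0) n - twist d (phase h 0) (n - j))"
        unfolding tw0 of_real_diff[symmetric] norm_of_real ..
      also have "\<dots> \<le> C * ((real j / (real n + 1)) powr \<kappa> * ((real n + 1) / (real (n - j) + 1)) powr a) * exp (- 0\<^sup>2 / 32) * ecoef d n"
        by (rule smooth[OF ad]) (use j C in auto)
      also have "\<dots> \<le> C * wfac k (a + k) n j * ecoef d n"
      proof -
        have "(real j / (real n + 1)) powr \<kappa> \<le> (real j / (real n + 1)) powr k"
          using k j by (intro powr_mono') auto
        moreover have "((real n + 1) / (real (n - j) + 1)) powr a \<le> ((real n + 1) / (real (n - j) + 1)) powr (a + k)"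
          using k by (intro powr_mono) auto
        ultimately show ?thesis using C p by (auto simp: wfac_def intro!: mult_mono)
      qed
      finally have "\<bar>ecoef d n - ecoef d (n - j)\<bar> \<le> C * wfac k (a + k) n j * ecoef d n" .
      moreover have "\<bar>ecoef d (n - j) / ecoef d n - 1\<bar> = \<bar>ecoef d n - ecoef d (n - j)\<bar> / ecoef d n"
      proof -
        have "ecoef d (n - j) / ecoef d n - 1 = (ecoef d (n - j) - ecoef d n) / ecoef d n"
          using p by (simp add: diff_divide_distrib)
        then show ?thesis using p abs_minus_commute[of "ecoef d n" "ecoef d (n - j)"] by simp
      qed
      ultimately show "\<bar>ecoef d (n - j) / ecoef d n - 1\<bar> \<le> C * wfac k (a + k) n j"
        using p by (simp add: divide_le_eq)
    qed auto
    also have "\<dots> = C * (\<Sum>j=1..n. \<bar>h j\<bar> / real j * wfac k (a + k) n j)" by (simp add: sum_distrib_left mult_ac)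
    also have wn: "(\<Sum>j=1..n. \<bar>h j\<bar> / real j * wfac k (a + k) n j) \<le> \<rho>"
      using w n unfolding weighted_bound_def a_def by blast
    then have "C * (\<Sum>j=1..n. \<bar>h j\<bar> / real j * wfac k (a + k) n j) \<le> C * \<rho>" using C by simp
    also have "0 \<le> \<rho>" using wn by (rule order_trans[rotated]) (intro sum_nonneg, simp add: wfac_nonneg)
    then have "C * \<rho> \<le> K * \<rho>" using K by (intro mult_right_mono)
    finally show "(\<Sum>j=1..n. \<bar>h j\<bar> / real j * \<bar>ecoef d (n - j) / ecoef d n - 1\<bar>) \<le> K * \<rho>" .
  next
    fix d h :: "nat \<Rightarrow> real" and n :: nat and t \<rho> :: real
    assume ad: "admissible \<theta> D d h n"
      and n: "1 \<le> n" and w: "weighted_bound k (1 - \<beta> + k) n h \<rho>"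
      and t: "0 \<le> t" "t * third h n \<le> c"
    note d = admissibleD(1)[OF ad] and unit = admissibleD(2)[OF ad]
    have d0: "0 \<le> d j \<and> d j \<le> D" for j using d[of j] params by auto
    define p where "p = ecoef d n"
    have p: "0 < p" unfolding p_def by (rule ecoef_d_pos[OF params d, of "\<lambda>_. 0"]) auto
    define T where "T u m = twist d (phase h u) m" for u m
    define Y where "Y m u = gauged d h n m u" for m u
    define g where "g i = \<bar>h i\<bar> / real i" for i
    define q where "q i j = diffker \<kappa> a n (min i j) (max i j)" for i j
    \<comment> \<open>\<open>1 / norm (exp (log_ratio d h n u))\<close> is at most \<open>exp (u\<^sup>2 / 2)\<close>, and the mixed differences decay
      like \<open>exp (- u\<^sup>2 / 32)\<close>; \<open>X\<close> bounds the product. The factor \<open>exp (log_ratio d h n t)\<close>, at most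
      \<open>exp (- 31 * t\<^sup>2 / 64)\<close>, restores the decay at the end\<close>
    define X where "X = exp (15 / 32 * t\<^sup>2)"
    have tw0: "T 0 m = of_real (ecoef d m)" for m by (simp add: T_def twist_def ecoef_of_real)
    have Y0: "Y m 0 = of_real (ecoef d m)" for m
      using tw0[of m] by (simp add: Y_def gauged_def T_def log_ratio_def)
    have tu: "\<bar>u\<bar> * third h n \<le> c1" if "0 \<le> u" "u \<le> t" for u
      using that t c mult_right_mono[of u t "third h n"] third_nonneg[of h n] by auto
    have om: "norm (dphase d h u i) \<le> D * g i" for u i
      unfolding g_def using d0[of i] by (intro norm_dphase) auto
    have om': "norm (dphase d h u i * z) \<le> D * g i * b" if "norm z \<le> b" for u i b and z :: complex
      unfolding norm_mult using om that D by (intro mult_mono) (auto simp: g_def)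
    have diff_nonneg: "0 \<le> diffker \<kappa> a n i j" for i j by (simp add: diffker_def)
    have q0: "0 \<le> q i j" for i j by (simp add: q_def diff_nonneg)
    \<comment> \<open>the mixed second difference is symmetric, so it may be estimated by smoothness over the smaller of
      \<open>i\<close> and \<open>j\<close>\<close>
    define Bk where "Bk u i j = (twistz d (phase h u) (n - j) i - T u (n - j)) - (twistz d (phase h u) n i - T u n)" for u i j
    have Bk_sym: "Bk u i j = Bk u j i" if "i \<le> n" "j \<le> n" for u i j
    proof -
      have "(i \<le> n - j) = (j \<le> n - i)" using that by auto
      then show ?thesis using that by (simp add: Bk_def twistz_def T_def add.commute)
    qed
    have Bk1: "norm (Bk u i j) \<le> C * p * exp (- u\<^sup>2 / 32) * diffker \<kappa> a n i j"
      if u: "0 \<le> u" "u \<le> t" and ij: "1 \<le> i" "i \<le> j" "j \<le> n" for u i j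
    proof -
      note sm = smooth[OF ad tu[OF u]] and dc = decay[OF ad tu[OF u]]
      have e2: "norm (twistz d (phase h u) n i - T u n) \<le>
          C * p * exp (- u\<^sup>2 / 32) * ((real i / (real n + 1)) powr \<kappa> * ((real n + 1) / (real (n - i) + 1)) powr a)"
        using sm[of i n] ij by (simp add: twistz_def T_def p_def norm_minus_commute mult_ac)
      have e1: "norm (twistz d (phase h u) (n - j) i - T u (n - j)) \<le>
          C * p * exp (- u\<^sup>2 / 32) * (if i + j \<le> n
     then (real i / (real (n - j) + 1)) powr \<kappa> * ((real n + 1) / (real (n - j - i) + 1)) powr a
     else ((real n + 1) / (real (n - j) + 1)) powr a)"
      proof (cases "i + j \<le> n")
        case True
        then show ?thesis
          using sm[of i "n - j"] ij by (auto simp: twistz_def T_def p_def norm_minus_commute mult_ac)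
      next
        case False
        then show ?thesis
          using dc[of "n - j"] ij by (auto simp: twistz_def T_def p_def mult_ac)
      qed
      have "norm (Bk u i j) \<le> norm (twistz d (phase h u) (n - j) i - T u (n - j)) + norm (twistz d (phase h u) n i - T u n)"
        unfolding Bk_def by (rule norm_triangle_ineq4)
      then show ?thesis using e1 e2 unfolding diffker_def distrib_left by linarith
    qed
    have Bk2: "norm (Bk u i j) \<le> C * p * exp (- u\<^sup>2 / 32) * q i j"
      if u: "0 \<le> u" "u \<le> t" and ij: "i \<in> {1..n}" "j \<in> {1..n}" for u i j
    proof (cases "i \<le> j")
      case True
      then show ?thesis using Bk1[OF u, of i j] ij by (simp add: q_def)
    next
      case False
      then show ?thesis using Bk1[OF u, of j i] Bk_sym[of i j u] ij by (simp add: q_def)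
    qed
    have EB: "norm (exp (- log_ratio d h n u)) * (C * p * exp (- u\<^sup>2 / 32)) \<le> C * p * X"
      if u: "0 \<le> u" "u \<le> t" for u
    proof -
      have "norm (exp (- log_ratio d h n u)) = exp (defect d (phase h u) n)"
        by (simp add: norm_exp_eq_Re Re_log_ratio)
      also have "\<dots> \<le> exp (u\<^sup>2 / 2)" using defect_phase_le[OF d0 unit, of u] by simp
      finally have "norm (exp (- log_ratio d h n u)) * (C * p * exp (- u\<^sup>2 / 32)) \<le> exp (u\<^sup>2 / 2) * (C * p * exp (- u\<^sup>2 / 32))"
        using C p by (intro mult_right_mono) auto
      also have "\<dots> = C * p * exp (15 / 32 * u\<^sup>2)" by (simp add: exp_add[symmetric])
      also have "\<dots> \<le> C * p * X" unfolding X_def using C p u by (intro mult_left_mono) (auto intro: power_mono)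
      finally show ?thesis .
    qed
    define Z where "Z j = (\<Sum>i=1..n. D * g i * (C * p * X * q i j))" for j
    have zeta: "norm ((Y (n - j) u - Y n u) - (Y (n - j) 0 - Y n 0)) \<le> t * Z j"
      if u: "0 \<le> u" "u \<le> t" and j: "j \<in> {1..n}" for u j
    proof -
      have Z0: "0 \<le> Z j" unfolding Z_def using D C p q0
        by (intro sum_nonneg mult_nonneg_nonneg) (auto simp: g_def X_def)
      have "norm ((Y (n - j) u - Y n u) - (Y (n - j) 0 - Y n 0)) \<le> u * Z j"
      proof (rule norm_diff_le_of_derivative_bound[OF u(1)])
        fix s assume s: "0 \<le> s" "s \<le> u"
        let ?d' = "exp (- log_ratio d h n s) * (\<Sum>i=1..n. dphase d h s i * Bk s i j)"
        show "((\<lambda>u. Y (n - j) u - Y n u) has_vector_derivative ?d') (at s)"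
        proof -
          have "((\<lambda>u. Y (n - j) u - Y n u) has_vector_derivative
            (exp (- log_ratio d h n s) * (\<Sum>i=1..n. dphase d h s i * (twistz d (phase h s) (n - j) i - T s (n - j)))
             - exp (- log_ratio d h n s) * (\<Sum>i=1..n. dphase d h s i * (twistz d (phase h s) n i - T s n)))) (at s)"
            unfolding Y_def T_def by (intro has_vector_derivative_diff gauged_has_derivative) auto
          also have "(exp (- log_ratio d h n s) * (\<Sum>i=1..n. dphase d h s i * (twistz d (phase h s) (n - j) i - T s (n - j)))
             - exp (- log_ratio d h n s) * (\<Sum>i=1..n. dphase d h s i * (twistz d (phase h s) n i - T s n))) = ?d'"
            unfolding Bk_def right_diff_distrib[of "dphase d h s _" "_ - _" "_ - _"] sum_subtractf right_diff_distrib[of "exp _"] ..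
          finally show ?thesis .
        qed
        have st: "s \<le> t" using s u by simp
        have "norm ?d' = norm (exp (- log_ratio d h n s)) * norm (\<Sum>i=1..n. dphase d h s i * Bk s i j)"
          by (rule norm_mult)
        also have "\<dots> \<le> norm (exp (- log_ratio d h n s)) * (\<Sum>i=1..n. D * g i * (C * p * exp (- s\<^sup>2 / 32) * q i j))"
          by (intro mult_left_mono sum_norm_le om' Bk2 s(1) st j norm_ge_zero)
        also have "\<dots> = (\<Sum>i=1..n. D * g i * (norm (exp (- log_ratio d h n s)) * (C * p * exp (- s\<^sup>2 / 32)) * q i j))"
          by (simp add: sum_distrib_left mult_ac)
        also have "\<dots> \<le> Z j" unfolding Z_def using D q0
          by (intro sum_mono mult_left_mono mult_right_mono EB s st mult_nonneg_nonneg) (auto simp: g_def)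
        finally show "norm ?d' \<le> Z j" .
      qed
      also have "\<dots> \<le> t * Z j" using u Z0 by (intro mult_right_mono)
      finally show ?thesis .
    qed
    define R where "R u = (\<Sum>j=1..n. of_real (d j / real j) * (phase h u j - 1) * (Y (n - j) 0 - Y n 0))" for u
    \<comment> \<open>\<open>R\<close> is the linear correction; its derivative removes from \<open>(Y n)'\<close> the differences at \<open>t = 0\<close>\<close>
    define \<psi> where "\<psi> u = Y n u - R u" for u
    have psi: "norm (\<psi> t - \<psi> 0) \<le> t * (\<Sum>j=1..n. D * g j * (t * Z j))"
    proof (rule norm_diff_le_of_derivative_bound[OF t(1)])
      fix s assume s: "0 \<le> s" "s \<le> t"
      let ?d' = "\<Sum>j=1..n. dphase d h s j * ((Y (n - j) s - Y n s) - (Y (n - j) 0 - Y n 0))"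
      have Rd: "(R has_vector_derivative (\<Sum>j=1..n. dphase d h s j * (Y (n - j) 0 - Y n 0))) (at s)"
        unfolding R_def
      proof (intro has_vector_derivative_sum)
        fix j
        have "((\<lambda>t. phase h t j - 1) has_vector_derivative (\<i> * of_real (h j) * phase h s j - 0)) (at s)"
          by (intro has_vector_derivative_diff phase_has_derivative has_vector_derivative_const)
        from has_vector_derivative_mult_right[OF this, of "of_real (d j / real j) * (Y (n - j) 0 - Y n 0)"]
        show "((\<lambda>u. of_real (d j / real j) * (phase h u j - 1) * (Y (n - j) 0 - Y n 0)) has_vector_derivative
            dphase d h s j * (Y (n - j) 0 - Y n 0)) (at s)" by (simp add: dphase_def mult_ac)
      qed
      have Yd: "(Y n has_vector_derivative (\<Sum>j=1..n. dphase d h s j * (Y (n - j) s - Y n s))) (at s)"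
      proof -
        have "(Y n has_vector_derivative exp (- log_ratio d h n s) * (\<Sum>i=1..n. dphase d h s i * (twistz d (phase h s) n i - T s n))) (at s)"
          unfolding Y_def T_def by (rule gauged_has_derivative) simp
        also have "exp (- log_ratio d h n s) * (\<Sum>i=1..n. dphase d h s i * (twistz d (phase h s) n i - T s n)) =
            (\<Sum>j=1..n. dphase d h s j * (Y (n - j) s - Y n s))"
          unfolding sum_distrib_left by (intro sum.cong) (auto simp: Y_def T_def gauged_def twistz_def algebra_simps)
        finally show ?thesis .
      qed
      show "(\<psi> has_vector_derivative ?d') (at s)"
        unfolding \<psi>_def using has_vector_derivative_diff[OF Yd Rd]
        by (simp only: right_diff_distrib[of "dphase d h s _" "_ - _" "_ - _"] sum_subtractf)
      show "norm ?d' \<le> (\<Sum>j=1..n. D * g j * (t * Z j))"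
        by (intro sum_norm_le om' zeta s)
    qed
    have "(\<Sum>j=1..n. D * g j * (t * Z j)) = t * (D\<^sup>2 * C * p * X) * (\<Sum>j=1..n. \<Sum>i=1..n. g i * g j * q i j)"
      unfolding Z_def sum_distrib_left by (intro sum.cong) (auto simp: power2_eq_square)
    also have "\<dots> \<le> t * (D\<^sup>2 * C * p * X) * (2 * (4 * \<rho>\<^sup>2))"
    proof (rule mult_left_mono)
      have "(\<Sum>j=1..n. \<Sum>i=1..n. g i * g j * q i j) \<le> 2 * (\<Sum>j=1..n. g j * (\<Sum>i=1..j. g i * diffker \<kappa> a n i j))"
        unfolding q_def by (rule symmetric_double_sum_le) (auto simp: g_def diff_nonneg)
      also have "\<dots> \<le> 2 * (4 * \<rho>\<^sup>2)"
        unfolding g_def k(4) using diffker_sum_le[OF k(1,2) a _ n, of h \<rho>] w by (simp add: a_def)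
      finally show "(\<Sum>j=1..n. \<Sum>i=1..n. g i * g j * q i j) \<le> 2 * (4 * \<rho>\<^sup>2)" .
    qed (use t C p in \<open>auto simp: X_def\<close>)
    finally have "norm (\<psi> t - \<psi> 0) \<le> t * (t * (D\<^sup>2 * C * p * X) * (2 * (4 * \<rho>\<^sup>2)))"
      using psi t by (meson mult_left_mono order_trans)
    then have psi2: "norm (\<psi> t - \<psi> 0) \<le> 8 * D\<^sup>2 * C * (t\<^sup>2 * \<rho>\<^sup>2) * X * p"
      by (simp add: power2_eq_square mult_ac)
    have psi0: "\<psi> 0 = of_real p" by (simp add: \<psi>_def R_def Y0 p_def)
    have eq: "twist d (phase h t) n / of_real (ecoef d n) - exp (log_ratio d h n t) *
        (1 + (\<Sum>j=1..n. of_real (d j / real j) * (phase h t j - 1) * of_real (ecoef d (n - j) / ecoef d n - 1))) =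
        exp (log_ratio d h n t) * (\<psi> t - \<psi> 0) / of_real p"
    proof -
      have R: "R t = of_real p * (\<Sum>j=1..n. of_real (d j / real j) * (phase h t j - 1) * of_real (ecoef d (n - j) / ecoef d n - 1))"
        unfolding R_def sum_distrib_left using p
        by (intro sum.cong) (auto simp: Y0 p_def[symmetric] field_simps)
      have "twist d (phase h t) n = exp (log_ratio d h n t) * Y n t"
        by (simp add: Y_def gauged_def exp_minus)
      then show ?thesis using p unfolding psi0 unfolding \<psi>_def R p_def[symmetric]
        by (simp add: field_simps)
    qed
    have "norm (exp (log_ratio d h n t) * (\<psi> t - \<psi> 0) / of_real p) = exp (- defect d (phase h t) n) * norm (\<psi> t - \<psi> 0) / p"
      using p by (simp add: norm_mult norm_divide norm_exp_eq_Re Re_log_ratio)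
    also have "\<dots> \<le> exp (- (31 / 64 * t\<^sup>2)) * (8 * D\<^sup>2 * C * (t\<^sup>2 * \<rho>\<^sup>2) * X * p) / p"
      using psi2 dlow[OF ad t] p by (intro divide_right_mono mult_mono) auto
    also have "\<dots> = 8 * D\<^sup>2 * C * (t\<^sup>2 * \<rho>\<^sup>2) * (exp (- (31 / 64 * t\<^sup>2)) * X)" using p by simp
    also have "exp (- (31 / 64 * t\<^sup>2)) * X = exp (- t\<^sup>2 / 64)"
      unfolding X_def exp_add[symmetric] by simp
    also have "8 * D\<^sup>2 * C * (t\<^sup>2 * \<rho>\<^sup>2) * exp (- t\<^sup>2 / 64) \<le> K * (t\<^sup>2 * \<rho>\<^sup>2 * exp (- t\<^sup>2 / 64))"
      using mult_right_mono[OF K(3), of "t\<^sup>2 * \<rho>\<^sup>2 * exp (- t\<^sup>2 / 64)"] by (simp add: mult_ac)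
    finally show "norm (twist d (phase h t) n / of_real (ecoef d n) - exp (log_ratio d h n t) *
        (1 + (\<Sum>j=1..n. of_real (d j / real j) * (phase h t j - 1) * of_real (ecoef d (n - j) / ecoef d n - 1))))
      \<le> K * (t\<^sup>2 * \<rho>\<^sup>2 * exp (- t\<^sup>2 / 64))" unfolding eq .
  qed
qed

end

section \<open>Smoothing inequality\<close>

text \<open>The distribution function of the density \<open>(1 - cos y) / (pi * y\<^sup>2)\<close>. Its characteristic function is
\<open>max 0 (1 - \<bar>t\<bar>)\<close>, so smoothing with it involves only the frequencies in a bounded interval.\<close>

definition fejer_cdf :: "real \<Rightarrow> real" where
  "fejer_cdf y = 1 / 2 + (Si y - (1 - cos y) / y) / pi"

lemma one_minus_cos_div_tendsto_0: "((\<lambda>y::real. (1 - cos y) / y) \<longlongrightarrow> 0) (at 0)"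
proof -
  have "((\<lambda>y::real. 1 - cos y) has_real_derivative 0) (at 0)"
    by (auto intro!: derivative_eq_intros)
  then show ?thesis by (simp add: has_field_derivative_iff)
qed

lemma isCont_fejer_cdf: "isCont fejer_cdf y"
proof -
  have "isCont (\<lambda>y::real. (1 - cos y) / y) y"
  proof (cases "y = 0")
    case True
    have "((\<lambda>y::real. (1 - cos y) / y) \<longlongrightarrow> (1 - cos 0) / 0) (at 0)"
      using one_minus_cos_div_tendsto_0 by simp
    then show ?thesis unfolding True isCont_def .
  qed (auto intro!: continuous_intros)
  moreover define g where "g y = (1 - cos y) / y" for y :: real
  ultimately have "isCont g y" by (simp add: g_def[abs_def])
  then have "isCont (\<lambda>y. 1 / 2 + (Si y - g y) / pi) y" by (intro continuous_intros isCont_Si) auto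
  then show ?thesis unfolding fejer_cdf_def[abs_def] g_def .
qed

lemma fejer_cdf_minus: "fejer_cdf (- y) = 1 - fejer_cdf y"
proof -
  have "Si (- y) = - Si y" using Si_neg[of y] Si_neg[of "- y"] by (cases "0 \<le> y") auto
  then show ?thesis by (simp add: fejer_cdf_def diff_divide_distrib add_divide_distrib)
qed

lemma fejer_cdf_has_derivative:
  assumes "y \<noteq> 0"
  shows "(fejer_cdf has_real_derivative (1 - cos y) / (pi * y\<^sup>2)) (at y)"
proof -
  have "(fejer_cdf has_real_derivative (sinc y - (sin y * y - (1 - cos y)) / (y * y)) / pi) (at y)"
    unfolding fejer_cdf_def[abs_def] using assms
    by (auto intro!: derivative_eq_intros DERIV_Si[THEN DERIV_cong])
  moreover have "(sinc y - (sin y * y - (1 - cos y)) / (y * y)) / pi = (1 - cos y) / (pi * y\<^sup>2)"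
    using assms by (simp add: field_simps power2_eq_square)
  ultimately show ?thesis by simp
qed

lemma fejer_cdf_mono:
  assumes "x \<le> y"
  shows "fejer_cdf x \<le> fejer_cdf y"
proof -
  have pos: "fejer_cdf x \<le> fejer_cdf y" if "0 \<le> x" "x \<le> y" for x y
    using that(2)
  proof (rule DERIV_nonneg_imp_increasing_open)
    fix z assume "x < z" "z < y"
    then show "\<exists>D. (fejer_cdf has_real_derivative D) (at z) \<and> 0 \<le> D"
      using that fejer_cdf_has_derivative[of z] by (intro exI[of _ "(1 - cos z) / (pi * z\<^sup>2)"]) auto
  qed (intro continuous_at_imp_continuous_on ballI isCont_fejer_cdf)
  consider "0 \<le> x" | "y \<le> 0" | "x \<le> 0" "0 \<le> y" by linarith
  then show ?thesis
  proof cases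
    case 1 then show ?thesis using pos assms by blast
  next
    case 2 then show ?thesis using pos[of "- y" "- x"] assms by (simp add: fejer_cdf_minus)
  next
    case 3
    have "fejer_cdf 0 = 1 / 2" using fejer_cdf_minus[of 0] by simp
    then show ?thesis using 3 pos[of 0 y] pos[of 0 "- x"] fejer_cdf_minus[of x] by linarith
  qed
qed

lemma fejer_cdf_at_top: "(fejer_cdf \<longlongrightarrow> 1) at_top"
proof -
  have "((\<lambda>y::real. (1 - cos y) / y) \<longlongrightarrow> 0) at_top"
  proof (rule Lim_null_comparison)
    show "\<forall>\<^sub>F y in at_top. norm ((1 - cos y) / y) \<le> 2 / y"
      using eventually_gt_at_top[of "0::real"]
    proof eventually_elim
      case (elim y)
      have "\<bar>1 - cos y\<bar> \<le> 2" using cos_ge_minus_one[of y] cos_le_one[of y] by linarith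
      then show ?case using elim by (simp add: divide_right_mono)
    qed
    show "((\<lambda>y::real. 2 / y) \<longlongrightarrow> 0) at_top"
      by (intro tendsto_divide_0[OF tendsto_const] filterlim_at_top_imp_at_infinity filterlim_ident)
  qed
  then have "((\<lambda>y. 1 / 2 + (Si y - (1 - cos y) / y) / pi) \<longlongrightarrow> 1 / 2 + (pi / 2 - 0) / pi) at_top"
    by (intro tendsto_intros Si_at_top) auto
  then show ?thesis by (simp add: fejer_cdf_def[abs_def])
qed

lemma fejer_cdf_at_bot: "(fejer_cdf \<longlongrightarrow> 0) at_bot"
proof -
  have "((\<lambda>y. fejer_cdf (- y)) \<longlongrightarrow> 1 - 1) at_top"
    unfolding fejer_cdf_minus by (intro tendsto_intros fejer_cdf_at_top)
  then show ?thesis by (simp add: filterlim_at_bot_mirror)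
qed

text \<open>The derivative of \<open>fejer_cdf y + 2 / (pi * y)\<close> is nonpositive, and its limit is \<open>1\<close>.\<close>

lemma fejer_cdf_tail:
  assumes "0 < y"
  shows "1 - fejer_cdf y \<le> 2 / (pi * y)"
proof -
  define G where "G z = fejer_cdf z + 2 / (pi * z)" for z
  have le: "G z \<le> G y" if "y \<le> z" for z
    using that
  proof (rule DERIV_nonpos_imp_nonincreasing)
    fix x assume x: "y \<le> x" "x \<le> z"
    have "(G has_real_derivative (1 - cos x) / (pi * x\<^sup>2) - 2 / (pi * x\<^sup>2)) (at x)"
      unfolding G_def using x assms
      by (auto intro!: derivative_eq_intros fejer_cdf_has_derivative[THEN DERIV_cong] simp: power2_eq_square field_simps)
    moreover have "(1 - cos x) / (pi * x\<^sup>2) - 2 / (pi * x\<^sup>2) \<le> 0"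
      using cos_ge_minus_one[of x] x assms by (simp add: diff_divide_distrib[symmetric] divide_nonpos_nonneg)
    ultimately show "\<exists>D. (G has_real_derivative D) (at x) \<and> D \<le> 0" by blast
  qed
  have "\<forall>\<^sub>F z in at_top. G z \<le> G y" using eventually_ge_at_top[of y] by (rule eventually_mono) (rule le)
  moreover have "((\<lambda>z::real. 2 / (pi * z)) \<longlongrightarrow> 0) at_top"
    by (intro tendsto_divide_0[OF tendsto_const] filterlim_at_top_imp_at_infinity
        filterlim_tendsto_pos_mult_at_top[OF tendsto_const] filterlim_ident) simp
  then have "(G \<longlongrightarrow> 1 + 0) at_top" unfolding G_def by (intro tendsto_intros fejer_cdf_at_top)
  ultimately have "1 \<le> G y" by (intro tendsto_upperbound[of G 1 at_top]) auto
  then show ?thesis by (simp add: G_def)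
qed

definition fejer :: "real measure" where "fejer = interval_measure fejer_cdf"

lemma fejer_right_cont: "continuous (at_right a) fejer_cdf"
  using isCont_fejer_cdf[of a] by (simp add: continuous_at_imp_continuous_within)

interpretation fejer: real_distribution fejer
  unfolding fejer_def
  by (intro real_distribution_interval_measure fejer_cdf_mono fejer_right_cont fejer_cdf_at_bot fejer_cdf_at_top)

lemma cdf_fejer: "cdf fejer y = fejer_cdf y"
  unfolding cdf_def fejer_def
  by (intro measure_interval_measure_Iic fejer_cdf_mono fejer_right_cont fejer_cdf_at_bot fejer_cdf_at_top)

lemma fejer_two_sided_tail:
  assumes "0 < y"
  shows "measure fejer {w. y \<le> \<bar>w\<bar>} \<le> 4 / (pi * y)"
proof -
  have lt: "measure fejer {..<y} = fejer_cdf y"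
  proof -
    have "measure fejer {y} = 0" using isCont_fejer_cdf[of y] fejer.isCont_cdf[of y] by (simp add: cdf_fejer[abs_def])
    moreover have "measure fejer {..y} = measure fejer ({..<y} \<union> {y})" by (rule arg_cong[where f="measure fejer"]) auto
    moreover have "\<dots> = measure fejer {..<y} + measure fejer {y}" by (rule fejer.finite_measure_Union) auto
    ultimately show ?thesis using cdf_fejer[of y] by (simp add: cdf_def)
  qed
  have "{w. y \<le> \<bar>w\<bar>} = {..- y} \<union> {y..}" by auto
  then have "measure fejer {w. y \<le> \<bar>w\<bar>} \<le> measure fejer {..- y} + measure fejer {y..}"
    using measure_Un_le[of "{..- y}" fejer "{y..}"] by simp
  also have "measure fejer {y..} = 1 - measure fejer {..<y}"
  proof -
    have "{y..} = space fejer - {..<y}" by auto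
    then show ?thesis using fejer.prob_compl[of "{..<y}"] by simp
  qed
  also have "measure fejer {..- y} = fejer_cdf (- y)" using cdf_fejer[of "- y"] by (simp add: cdf_def)
  finally have "measure fejer {w. y \<le> \<bar>w\<bar>} \<le> 2 * (1 - fejer_cdf y)" by (simp add: lt fejer_cdf_minus)
  also have "\<dots> \<le> 2 * (2 / (pi * y))" using fejer_cdf_tail[OF assms] by simp
  finally show ?thesis by simp
qed

text \<open>Fourier inversion for this particular function, obtained from the sine integral. The formula uses
frequencies in \<open>(0, 1)\<close> only.\<close>

lemma fejer_cdf_integral:
  "fejer_cdf y = 1 / 2 + (LBINT u. indicator {0<..<1} u * ((1 - u) / u * sin (u * y))) / pi"
  and fejer_integrable: "integrable lborel (\<lambda>u. indicator {0<..<1} u * ((1 - u) / u * sin (u * y)))"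
proof -
  have i1: "integrable lborel (\<lambda>u. indicator {0<..<1} u * (sin (u * y) / u))"
    using integrable_sinc'[of 1 y]
    by (simp add: interval_lebesgue_integrable_def set_integrable_def zero_ereal_def one_ereal_def)
  have "set_integrable lborel {0<..<1} (\<lambda>u. sin (u * y))"
    by (rule set_integrable_subset[of lborel "{0..1}"], rule borel_integrable_atLeastAtMost') (auto intro!: continuous_intros)
  then have i2: "integrable lborel (\<lambda>u. indicator {0<..<1} u * sin (u * y))"
    by (simp add: set_integrable_def)
  have e: "indicator {0<..<1} u * ((1 - u) / u * sin (u * y)) =
      indicator {0<..<1} u * (sin (u * y) / u) - indicator {0<..<1} u * sin (u * y)" for u :: real
    by (auto simp: indicator_def field_simps)
  show "integrable lborel (\<lambda>u. indicator {0<..<1} u * ((1 - u) / u * sin (u * y)))"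
    unfolding e by (intro Bochner_Integration.integrable_diff i1 i2)
  have "(LBINT u. indicator {0<..<1} u * (sin (u * y) / u)) = (LBINT u=0..1. sin (u * y) / u)"
    unfolding interval_lebesgue_integral_def set_lebesgue_integral_def einterval_eq zero_ereal_def one_ereal_def by simp
  also have "\<dots> = sgn y * Si \<bar>y\<bar>" using LBINT_I0c_sin_scale_divide[of 1 y] by (simp add: one_ereal_def)
  also have "\<dots> = Si y" using Si_neg[of "- y"] by (cases "y = 0") (auto simp: sgn_real_def Si_def zero_ereal_def)
  finally have 1: "(LBINT u. indicator {0<..<1} u * (sin (u * y) / u)) = Si y" .
  have 2: "(LBINT u. indicator {0<..<1} u * sin (u * y)) = (1 - cos y) / y"
  proof (cases "y = 0")
    case False
    have "(LBINT u. indicator {0<..<1} u * sin (u * y)) = (LBINT u=0..1. sin (u * y))"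
      unfolding interval_lebesgue_integral_def set_lebesgue_integral_def einterval_eq zero_ereal_def one_ereal_def by simp
    also have "\<dots> = - cos (1 * y) / y - (- cos (0 * y) / y)"
      unfolding zero_ereal_def one_ereal_def
      by (rule interval_integral_FTC_finite)
         (use False in \<open>auto intro!: continuous_intros derivative_eq_intros simp: has_real_derivative_iff_has_vector_derivative[symmetric]\<close>)
    finally show ?thesis by (simp add: diff_divide_distrib)
  qed simp
  have "(LBINT u. indicator {0<..<1} u * ((1 - u) / u * sin (u * y))) = Si y - (1 - cos y) / y"
    unfolding e by (subst Bochner_Integration.integral_diff[OF i1 i2]) (simp only: 1 2)
  then show "fejer_cdf y = 1 / 2 + (LBINT u. indicator {0<..<1} u * ((1 - u) / u * sin (u * y))) / pi"
    by (simp add: fejer_cdf_def)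
qed

text \<open>The first moment makes the integrand integrable near \<open>u = 0\<close>: \<open>\<bar>sin (u * z) / u\<bar> \<le> \<bar>z\<bar>\<close>. Fubini's theorem then
exchanges the two integrals.\<close>

lemma (in real_distribution) fejer_smoothing_sin:
  assumes m1: "integrable M (\<lambda>y. y)" and T: "0 < T"
  shows "(\<integral>y. fejer_cdf (T * (x - y)) \<partial>M) =
      1 / 2 + (LBINT u. indicator {0<..<1} u * ((1 - u) / u * (\<integral>y. sin (u * (T * (x - y))) \<partial>M))) / pi"
    and "integrable lborel (\<lambda>u. indicator {0<..<1} u * ((1 - u) / u * (\<integral>y. sin (u * (T * (x - y))) \<partial>M)))"
proof -
  define f where "f y u = indicator {0<..<1} u * ((1 - u) / u * sin (u * (T * (x - y))))" for y u :: real
  interpret P: pair_sigma_finite M lborel ..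
  have f_le: "norm (f y u) \<le> indicator {0<..<1} u * (T * (\<bar>x\<bar> + \<bar>y\<bar>))" for y u
  proof (cases "u \<in> {0<..<1}")
    case True
    have "\<bar>(1 - u) / u * sin (u * (T * (x - y)))\<bar> \<le> 1 / u * (u * (T * \<bar>x - y\<bar>))"
      unfolding abs_mult using True abs_sin_x_le_abs_x[of "u * (T * (x - y))"] T
      by (intro mult_mono) (auto simp: abs_mult divide_right_mono)
    also have "\<dots> = T * \<bar>x - y\<bar>" using True by simp
    also have "\<dots> \<le> T * (\<bar>x\<bar> + \<bar>y\<bar>)" using T by (intro mult_left_mono abs_triangle_ineq4) auto
    finally show ?thesis using True by (simp add: f_def)
  qed (simp add: f_def)
  define g where "g p = indicator {0<..<1} (snd p) * (T * (\<bar>x\<bar> + \<bar>fst p\<bar>))" for p :: "real \<times> real"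
  have g: "integrable (M \<Otimes>\<^sub>M lborel) g"
  proof (rule P.Fubini_integrable)
    have 1: "(LBINT u. norm (g (y, u))) = T * (\<bar>x\<bar> + \<bar>y\<bar>)" for y
      using T by (simp add: abs_mult g_def)
    show "integrable M (\<lambda>y. LBINT u. norm (g (y, u)))"
      unfolding 1 using m1 by auto
    show "g \<in> borel_measurable (M \<Otimes>\<^sub>M lborel)" unfolding g_def[abs_def] by measurable
  qed (auto simp: g_def)
  have fi: "integrable (M \<Otimes>\<^sub>M lborel) (case_prod f)"
  proof (rule Bochner_Integration.integrable_bound[OF g])
    show "case_prod f \<in> borel_measurable (M \<Otimes>\<^sub>M lborel)" unfolding f_def by measurable
    show "AE p in M \<Otimes>\<^sub>M lborel. norm (case_prod f p) \<le> norm (g p)"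
      using f_le T by (intro AE_I2) (auto simp: abs_mult g_def split: prod.splits)
  qed
  have fu: "(\<integral>y. f y u \<partial>M) = indicator {0<..<1} u * ((1 - u) / u * (\<integral>y. sin (u * (T * (x - y))) \<partial>M))" for u
    unfolding f_def by simp
  have fy: "(LBINT u. f y u) = pi * (fejer_cdf (T * (x - y)) - 1 / 2)" for y
    unfolding f_def fejer_cdf_integral[of "T * (x - y)"] by simp
  have inty: "integrable M (\<lambda>y. LBINT u. f y u)" using P.integrable_fst'[OF fi] by simp
  show "integrable lborel (\<lambda>u. indicator {0<..<1} u * ((1 - u) / u * (\<integral>y. sin (u * (T * (x - y))) \<partial>M)))"
    using P.integrable_snd[OF fi] unfolding fu .
  have "(LBINT u. (\<integral>y. f y u \<partial>M)) = (\<integral>y. (LBINT u. f y u) \<partial>M)"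
    by (rule P.Fubini_integral[OF fi])
  moreover have "(\<integral>y. fejer_cdf (T * (x - y)) \<partial>M) = (\<integral>y. 1 / 2 + (LBINT u. f y u) / pi \<partial>M)"
    unfolding fy by simp
  moreover have "\<dots> = 1 / 2 + (\<integral>y. (LBINT u. f y u) \<partial>M) / pi"
    using inty prob_space by (subst Bochner_Integration.integral_add) auto
  ultimately show "(\<integral>y. fejer_cdf (T * (x - y)) \<partial>M) =
      1 / 2 + (LBINT u. indicator {0<..<1} u * ((1 - u) / u * (\<integral>y. sin (u * (T * (x - y))) \<partial>M))) / pi"
    unfolding fu by simp
qed

lemma (in real_distribution) sin_integral_char:
  "(\<integral>y. sin (s * (x - y)) \<partial>M) = - Im (iexp (- (s * x)) * char M s)"
proof -
  have i: "integrable M (\<lambda>y. iexp (- (s * x)) * iexp (s * y))"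
    by (intro integrable_mult_right) (auto intro!: integrable_const_bound[where B=1])
  have "iexp (- (s * x)) * char M s = (CLINT y|M. iexp (- (s * x)) * iexp (s * y))"
    unfolding char_def by simp
  then have "Im (iexp (- (s * x)) * char M s) = (\<integral>y. Im (iexp (- (s * x)) * iexp (s * y)) \<partial>M)"
    using integral_Im[OF i] by simp
  also have "\<dots> = (\<integral>y. - sin (s * (x - y)) \<partial>M)"
  proof (rule Bochner_Integration.integral_cong)
    fix y
    have "iexp (- (s * x)) * iexp (s * y) = iexp (- (s * (x - y)))"
      by (simp add: exp_add[symmetric] algebra_simps)
    then show "Im (iexp (- (s * x)) * iexp (s * y)) = - sin (s * (x - y))" by (simp add: Im_exp)
  qed simp
  finally show ?thesis by simp
qed

lemma cdf_integrable_fejer: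
  assumes "real_distribution M"
  shows "integrable fejer (\<lambda>w. cdf M (x - w / T))"
proof -
  interpret M: real_distribution M by fact
  have [measurable]: "cdf M \<in> borel_measurable borel"
    by (intro borel_measurable_mono monoI M.cdf_nondecreasing)
  have "(\<lambda>w. cdf M (x - w / T)) \<in> borel_measurable fejer"
    by (simp add: measurable_cong_sets[OF fejer.events_eq_borel refl])
  then show ?thesis
    using M.cdf_nonneg M.cdf_bounded_prob by (intro fejer.integrable_const_bound[where B=1] AE_I2) auto
qed

lemma bounded_cdf_difference_integrable:
  assumes "real_distribution M" "real_distribution N"
  shows "integrable fejer (\<lambda>w. cdf M (x - w / T) - cdf N (x - w / T))"
  by (intro Bochner_Integration.integrable_diff cdf_integrable_fejer assms)

text \<open>Both sides are the probability that a variable of law \<open>M\<close> plus an independent Fejer variable divided by \<open>T\<close>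
is at most \<open>x\<close>, conditioned on the one or on the other.\<close>

lemma cdf_smoothing_eq:
  assumes "real_distribution M" and T: "0 < T"
  shows "(\<integral>w. cdf M (x - w / T) \<partial>fejer) = (\<integral>y. fejer_cdf (T * (x - y)) \<partial>M)"
proof -
  interpret M: real_distribution M by fact
  interpret P: pair_prob_space fejer M ..
  define f where "f w y = (indicator {p. fst p \<le> T * (x - snd p)} (w, y) :: real)" for w y
  have fm: "case_prod f \<in> borel_measurable (fejer \<Otimes>\<^sub>M M)"
  proof -
    have "{p \<in> space (fejer \<Otimes>\<^sub>M M). fst p \<le> T * (x - snd p)} \<in> sets (fejer \<Otimes>\<^sub>M M)" by measurable
    then have "{p. fst p \<le> T * (x - snd p)} \<in> sets (fejer \<Otimes>\<^sub>M M)" by (simp add: space_pair_measure)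
    then show ?thesis unfolding f_def by simp
  qed
  have fi: "integrable (fejer \<Otimes>\<^sub>M M) (case_prod f)"
    using fm by (intro P.integrable_const_bound[where B=1]) (auto simp: f_def indicator_def)
  have a: "(\<integral>y. f w y \<partial>M) = cdf M (x - w / T)" for w
  proof -
    have "f w y = indicator {..x - w / T} y" for y
      using T by (auto simp: f_def indicator_def field_simps)
    then show ?thesis by (simp add: cdf_def)
  qed
  have b: "(\<integral>w. f w y \<partial>fejer) = fejer_cdf (T * (x - y))" for y
  proof -
    have "f w y = indicator {..T * (x - y)} w" for w by (auto simp: f_def indicator_def)
    then show ?thesis using cdf_fejer[of "T * (x - y)"] by (simp add: cdf_def)
  qed
  show ?thesis using P.Fubini_integral[OF fi] unfolding a b by simp
qed

text \<open>A function that is large on a whole neighbourhood of \<open>x\<close> and nowhere very negative has a large average.\<close>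

lemma fejer_average_lower_bound:
  fixes \<Delta> :: "real \<Rightarrow> real"
  assumes int: "integrable fejer (\<lambda>w. \<Delta> (x - w / T))" and T: "0 < T" and r: "0 < r" and \<eta>: "0 \<le> \<eta>" "0 \<le> e"
    and bd: "\<And>y. - \<eta> \<le> \<Delta> y" and near: "\<And>y. \<bar>y - x\<bar> < r \<Longrightarrow> \<eta> / 2 - e \<le> \<Delta> y"
  shows "\<eta> / 2 - e - 3 / 2 * \<eta> * (4 / (pi * (T * r))) \<le> (\<integral>w. \<Delta> (x - w / T) \<partial>fejer)"
proof -
  let ?A = "{w. T * r \<le> \<bar>w\<bar>}"
  have A: "?A \<in> sets fejer" by simp
  have "\<eta> / 2 - e - 3 / 2 * \<eta> * (4 / (pi * (T * r))) \<le> \<eta> / 2 - e - 3 / 2 * \<eta> * measure fejer ?A"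
    using fejer_two_sided_tail[of "T * r"] T r \<eta> by (intro diff_left_mono mult_left_mono) auto
  also have "\<dots> = (\<integral>w. (\<eta> / 2 - e) - 3 / 2 * \<eta> * indicator ?A w \<partial>fejer)"
  proof -
    have "measure fejer UNIV = 1" using fejer.prob_space by simp
    moreover have "integrable fejer (\<lambda>w. 3 / 2 * \<eta> * indicator ?A w)"
      by (intro integrable_mult_right integrable_real_indicator) (auto simp: less_top[symmetric])
    ultimately show ?thesis by (subst Bochner_Integration.integral_diff) auto
  qed
  also have "\<dots> \<le> (\<integral>w. \<Delta> (x - w / T) \<partial>fejer)"
  proof (rule integral_mono[OF _ int])
    show "integrable fejer (\<lambda>w. (\<eta> / 2 - e) - 3 / 2 * \<eta> * indicator ?A w)"
      by (intro Bochner_Integration.integrable_diff integrable_mult_right integrable_real_indicator)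
         (auto simp: less_top[symmetric])
    fix w
    show "(\<eta> / 2 - e) - 3 / 2 * \<eta> * indicator ?A w \<le> \<Delta> (x - w / T)"
    proof (cases "w \<in> ?A")
      case True
      then show ?thesis using bd[of "x - w / T"] \<eta> by simp
    next
      case False
      then have "\<bar>(x - w / T) - x\<bar> < r" using T by (simp add: abs_divide field_simps)
      then show ?thesis using near[of "x - w / T"] False by simp
    qed
  qed
  finally show ?thesis .
qed

text \<open>A difference of distribution functions that comes close to its supremum \<open>\<eta>\<close> at one point stays above
\<open>\<eta> / 2\<close>, up to the precision, on an interval of length \<open>\<eta> / 2\<close> on one side of it: \<open>cdf M\<close> is monotone and
\<open>cdf N\<close> is Lipschitz. Averaging with the Fejer law at scale \<open>1 / T\<close> recovers this up to a multiple of \<open>1 / T\<close>,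
and the average is an integral of the characteristic functions over \<open>(0, T)\<close>. The hypothesis is in the
form \<open>B * t / (1 + t\<^sup>2)\<close> because this integral is then an arctangent.\<close>

theorem esseen_smoothing:
  assumes M: "real_distribution M" and N: "real_distribution N"
    and m1: "integrable M (\<lambda>y. y)" "integrable N (\<lambda>y. y)"
    and lip: "\<And>x y. x \<le> y \<Longrightarrow> cdf N y - cdf N x \<le> y - x"
    and T: "0 < T"
    and ch: "\<And>t. 0 < t \<Longrightarrow> t < T \<Longrightarrow> norm (char M t - char N t) \<le> B * t / (1 + t\<^sup>2)"
  shows "\<bar>cdf M x - cdf N x\<bar> \<le> B + 16 / T"
proof -
  interpret M: real_distribution M by fact
  interpret N: real_distribution N by fact
  define \<Delta> where "\<Delta> y = cdf M y - cdf N y" for y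
  have B: "0 \<le> B"
  proof -
    define t where "t = T / 2"
    have t: "0 < t" "t < T" using T by (auto simp: t_def)
    have t2: "0 < 1 + t\<^sup>2" by (simp add: add_pos_nonneg)
    have "0 \<le> B * t / (1 + t\<^sup>2)" by (rule order_trans[OF norm_ge_zero ch[OF t]])
    then have "0 \<le> B * t / (1 + t\<^sup>2) * (1 + t\<^sup>2)" using t2 by (intro mult_nonneg_nonneg) auto
    then have "0 \<le> B * t" using t2 by simp
    then show ?thesis using t by (simp add: zero_le_mult_iff)
  qed
  have \<Delta>1: "\<bar>\<Delta> y\<bar> \<le> 1" for y
    using M.cdf_nonneg[of y] N.cdf_nonneg[of y] M.cdf_bounded_prob[of y] N.cdf_bounded_prob[of y]
    by (auto simp: \<Delta>_def abs_le_iff)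
  have smooth: "\<bar>\<integral>w. \<Delta> (z - w / T) \<partial>fejer\<bar> \<le> B / 2" for z
  proof -
    note Mi = cdf_integrable_fejer[OF M, of z T] and Ni = cdf_integrable_fejer[OF N, of z T]
    let ?s = "\<lambda>P u. indicator {0<..<1} u * ((1 - u) / u * (\<integral>y. sin (u * (T * (z - y))) \<partial>P)) :: real"
    have sM: "integrable lborel (?s M)" and sN: "integrable lborel (?s N)"
      using M.fejer_smoothing_sin(2)[OF m1(1) T] N.fejer_smoothing_sin(2)[OF m1(2) T] by auto
    have "(\<integral>w. \<Delta> (z - w / T) \<partial>fejer) = (\<integral>y. fejer_cdf (T * (z - y)) \<partial>M) - (\<integral>y. fejer_cdf (T * (z - y)) \<partial>N)"
      unfolding \<Delta>_def by (subst Bochner_Integration.integral_diff[OF Mi Ni]) (simp add: cdf_smoothing_eq M N T)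
    also have "\<dots> = (LBINT u. ?s M u - ?s N u) / pi"
      unfolding M.fejer_smoothing_sin(1)[OF m1(1) T] N.fejer_smoothing_sin(1)[OF m1(2) T]
      by (subst Bochner_Integration.integral_diff[OF sM sN]) (simp add: diff_divide_distrib)
    finally have eq: "(\<integral>w. \<Delta> (z - w / T) \<partial>fejer) = (LBINT u. ?s M u - ?s N u) / pi" .
    let ?b = "\<lambda>u. indicator {0..1} u * (B * (T / (1 + (T * u)\<^sup>2))) :: real"
    have at: "((\<lambda>u. B * arctan (T * u)) has_real_derivative B * (T / (1 + (T * u)\<^sup>2))) (at u)" for u
      by (auto intro!: derivative_eq_intros simp: divide_inverse)
    have bi: "has_bochner_integral lborel (\<lambda>u. (B * (T / (1 + (T * u)\<^sup>2))) * indicator {0..1} u) (B * arctan (T * 1) - B * arctan (T * 0))"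
      by (rule has_bochner_integral_FTC_Icc_nonneg[where F="\<lambda>u. B * arctan (T * u)"])
         (use at B T in \<open>auto intro!: continuous_intros mult_nonneg_nonneg divide_nonneg_nonneg simp: add_nonneg_eq_0_iff add_pos_nonneg\<close>)
    have bnd: "norm (?s M u - ?s N u) \<le> ?b u" for u
    proof (cases "u \<in> {0<..<1}")
      case True
      let ?c = "\<lambda>P. - Im (iexp (- ((u * T) * z)) * char P (u * T))"
      have s: "(\<integral>y. sin (u * (T * (z - y))) \<partial>M) = ?c M" "(\<integral>y. sin (u * (T * (z - y))) \<partial>N) = ?c N"
        using M.sin_integral_char[of "u * T" z] N.sin_integral_char[of "u * T" z] by (simp_all only: mult.assoc)
      have "?c M - ?c N = - Im (iexp (- ((u * T) * z)) * (char M (u * T) - char N (u * T)))"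
        by (simp add: right_diff_distrib)
      then have "\<bar>?c M - ?c N\<bar> \<le> norm (iexp (- ((u * T) * z)) * (char M (u * T) - char N (u * T)))"
        using abs_Im_le_cmod by (metis abs_minus_cancel)
      also have "\<dots> = norm (char M (u * T) - char N (u * T))" unfolding norm_mult by simp
      also have "\<dots> \<le> B * (u * T) / (1 + (u * T)\<^sup>2)" using ch[of "u * T"] True T by simp
      finally have "(1 - u) / u * \<bar>?c M - ?c N\<bar> \<le> 1 / u * (B * (u * T) / (1 + (u * T)\<^sup>2))"
        using True by (intro mult_mono divide_right_mono) auto
      also have "\<dots> = ?b u" using True by (simp add: mult.commute)
      finally have f: "(1 - u) / u * \<bar>?c M - ?c N\<bar> \<le> ?b u" .
      have abs_w: "\<bar>(1 - u) / u * a - (1 - u) / u * b\<bar> = (1 - u) / u * \<bar>a - b\<bar>" for a b :: real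
        unfolding right_diff_distrib[symmetric] abs_mult using True by simp
      have i1: "indicator {0<..<1} u = (1::real)" using True by simp
      show ?thesis unfolding s i1 mult_1_left real_norm_def abs_w by (rule f)
    qed (use B T in \<open>auto simp: indicator_def intro!: mult_nonneg_nonneg divide_nonneg_nonneg add_nonneg_nonneg\<close>)
    have "integrable lborel ?b" using bi by (simp add: has_bochner_integral_iff mult.commute)
    then have "norm (LBINT u. ?s M u - ?s N u) \<le> (LBINT u. ?b u)"
      using Bochner_Integration.integrable_diff[OF sM sN] bnd
      by (intro Bochner_Integration.integral_norm_bound_integral) auto
    then have "\<bar>LBINT u. ?s M u - ?s N u\<bar> \<le> (LBINT u. ?b u)" by simp
    also have "\<dots> = B * arctan T" using bi by (simp add: has_bochner_integral_iff mult.commute)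
    also have "\<dots> \<le> B * (pi / 2)" using arctan_ubound[of T] B by (intro mult_left_mono) auto
    finally have "\<bar>LBINT u. ?s M u - ?s N u\<bar> / pi \<le> B * (pi / 2) / pi" by (intro divide_right_mono) auto
    then show ?thesis unfolding eq by simp
  qed
  define \<eta> where "\<eta> = (SUP y. \<bar>\<Delta> y\<bar>)"
  have bdd: "bdd_above (range (\<lambda>y. \<bar>\<Delta> y\<bar>))" using \<Delta>1 by (auto intro!: bdd_aboveI)
  have le\<eta>: "\<bar>\<Delta> y\<bar> \<le> \<eta>" for y unfolding \<eta>_def by (rule cSUP_upper[OF _ bdd]) simp
  have \<eta>0: "0 \<le> \<eta>" using le\<eta>[of 0] by linarith
  have int: "integrable fejer (\<lambda>w. \<Delta> (z - w / T))" for z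
    unfolding \<Delta>_def by (rule bounded_cdf_difference_integrable[OF M N])
  have "\<eta> \<le> B + 48 / (pi * T)"
  proof (cases "\<eta> = 0")
    case True
    then show ?thesis using B T by simp
  next
    case False
    then have \<eta>: "0 < \<eta>" using \<eta>0 by simp
    \<comment> \<open>the interval has radius \<open>\<eta> / 4\<close>; its dependence on \<open>\<eta>\<close> cancels in the tail term\<close>
    define r where "r = \<eta> / 4"
    have r: "0 < r" using \<eta> by (simp add: r_def)
    have tail: "3 / 2 * \<eta> * (4 / (pi * (T * r))) = 24 / (pi * T)"
      using \<eta> T by (simp add: r_def field_simps)
    show ?thesis
    proof (rule field_le_epsilon)
      fix e :: real assume e: "0 < e"
      have "\<eta> - e / 2 < (SUP y. \<bar>\<Delta> y\<bar>)" using e by (simp add: \<eta>_def)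
      then obtain x0 where x0: "\<eta> - e / 2 < \<bar>\<Delta> x0\<bar>"
        by (subst (asm) less_cSUP_iff[OF _ bdd]) auto
      have "\<eta> / 2 - e / 2 - 24 / (pi * T) \<le> B / 2"
      proof (cases "0 \<le> \<Delta> x0")
        case True
        have "\<eta> / 2 - e / 2 \<le> \<Delta> y" if "\<bar>y - (x0 + r)\<bar> < r" for y
        proof -
          have y: "x0 \<le> y" "y - x0 \<le> \<eta> / 2" using that unfolding r_def abs_less_iff by linarith+
          have "cdf M x0 \<le> cdf M y" using y by (intro M.cdf_nondecreasing)
          then show ?thesis using lip[OF y(1)] x0 True y by (simp add: \<Delta>_def)
        qed
        moreover have "- \<eta> \<le> \<Delta> y" for y using le\<eta>[of y] by (simp add: abs_le_iff)
        ultimately have "\<eta> / 2 - e / 2 - 3 / 2 * \<eta> * (4 / (pi * (T * r))) \<le> (\<integral>w. \<Delta> ((x0 + r) - w / T) \<partial>fejer)"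
          using e by (intro fejer_average_lower_bound[OF int T r \<eta>0]) auto
        then show ?thesis using smooth[of "x0 + r"] unfolding tail by (simp add: abs_le_iff)
      next
        case False
        have "\<eta> / 2 - e / 2 \<le> - \<Delta> y" if "\<bar>y - (x0 - r)\<bar> < r" for y
        proof -
          have y: "y \<le> x0" "x0 - y \<le> \<eta> / 2" using that unfolding r_def abs_less_iff by linarith+
          have "cdf M y \<le> cdf M x0" using y by (intro M.cdf_nondecreasing)
          then show ?thesis using lip[OF y(1)] x0 False y by (simp add: \<Delta>_def)
        qed
        moreover have "- \<eta> \<le> - \<Delta> y" for y using le\<eta>[of y] by (simp add: abs_le_iff)
        ultimately have "\<eta> / 2 - e / 2 - 3 / 2 * \<eta> * (4 / (pi * (T * r))) \<le> (\<integral>w. - \<Delta> ((x0 - r) - w / T) \<partial>fejer)"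
          using e by (intro fejer_average_lower_bound[OF Bochner_Integration.integrable_minus[OF int] T r \<eta>0]) auto
        then show ?thesis using smooth[of "x0 - r"] unfolding tail by (simp add: abs_le_iff)
      qed
      then show "\<eta> \<le> B + 48 / (pi * T) + e" by (simp add: field_simps)
    qed
  qed
  also have "48 / (pi * T) \<le> 16 / T" using pi_gt3 T by (simp add: field_simps)
  finally show ?thesis using le\<eta>[of x] by (simp add: \<Delta>_def)
qed

section \<open>The cycle index of the symmetric group\<close>

lemma orbit_subset_closed:
  assumes "x \<in> A" "\<And>z. z \<in> A \<Longrightarrow> f z \<in> A"
  shows "orbit f x \<subseteq> A"
proof
  fix y assume "y \<in> orbit f x"
  then show "y \<in> A" by induction (use assms in auto)
qed

lemma orbit_fixed_singleton: "f x = x \<Longrightarrow> orbit f x = {x}"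
  using orbit_eq_singleton_iff[of f x] by simp

lemma orbit_eq_of_mem:
  assumes "x \<in> orbit f x" "y \<in> orbit f x"
  shows "orbit f y = orbit f x"
proof -
  have "x \<in> orbit f y" using assms by (rule orbit_swap)
  then show ?thesis using assms(2) by (auto intro: orbit_trans)
qed

text \<open>For \<open>b\<close> in the set that \<open>q\<close> permutes, the new point \<open>a\<close> enters the cycle of \<open>b\<close> just before \<open>b\<close>; for \<open>b = a\<close> it becomes
a fixed point. Every permutation of the enlarged set arises in exactly one of these ways.\<close>

abbreviation insert_before :: "'a \<Rightarrow> 'a \<Rightarrow> ('a \<Rightarrow> 'a) \<Rightarrow> 'a \<Rightarrow> 'a" where
  "insert_before a b q \<equiv> Transposition.transpose a b \<circ> q"

context
  fixes S :: "'a set" and a b :: 'a and q :: "'a \<Rightarrow> 'a"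
  assumes fin: "finite S" and a: "a \<notin> S" and b: "b \<in> S" and q: "q permutes S"
begin

lemma ins_eval: "(insert_before a b q) a = b" "q x = b \<Longrightarrow> (insert_before a b q) x = a" "x \<noteq> a \<Longrightarrow> q x \<noteq> b \<Longrightarrow> (insert_before a b q) x = q x"
proof -
  have qa: "q a = a" using q a by (simp add: permutes_def)
  then show "(insert_before a b q) a = b" by simp
  show "q x = b \<Longrightarrow> (insert_before a b q) x = a" by simp
  assume x: "x \<noteq> a" "q x \<noteq> b"
  have "q x \<noteq> a" using x qa permutes_inj[OF q] by (metis injD)
  then show "(insert_before a b q) x = q x" using x by (simp add: Transposition.transpose_def)
qed

lemma ins_permutes: "(insert_before a b q) permutes insert a S"
  using permutes_insert[of a S] b q by auto

lemma self_in_orbit_q: "x \<in> orbit q x"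
  by (rule permutation_self_in_orbit) (use q fin permutation_permutes in blast)

lemma self_in_orbit_ins: "x \<in> orbit (insert_before a b q) x"
  by (rule permutation_self_in_orbit) (use ins_permutes fin permutation_permutes in blast)

lemma orbit_ins_subset: "x \<in> S \<Longrightarrow> orbit (insert_before a b q) x \<subseteq> orbit q x \<union> (if b \<in> orbit q x then {a} else {})"
proof (rule orbit_subset_closed)
  assume x: "x \<in> S"
  show "x \<in> orbit q x \<union> (if b \<in> orbit q x then {a} else {})" using self_in_orbit_q by auto
  fix z assume z: "z \<in> orbit q x \<union> (if b \<in> orbit q x then {a} else {})"
  show "(insert_before a b q) z \<in> orbit q x \<union> (if b \<in> orbit q x then {a} else {})"
  proof (cases "z = a")
    case True
    have "a \<notin> orbit q x" using permutes_orbit_subset[OF q x] a by auto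
    then have "b \<in> orbit q x" using z True by (auto split: if_splits)
    then show ?thesis using True ins_eval(1) by auto
  next
    case False
    then have zq: "z \<in> orbit q x" using z by (auto split: if_splits)
    then have "q z \<in> orbit q x" by (rule orbit.step)
    then show ?thesis using False ins_eval(2,3)[of z] by (cases "q z = b") auto
  qed
qed

lemma orbit_q_subset: "x \<in> S \<Longrightarrow> orbit q x \<subseteq> orbit (insert_before a b q) x"
proof (rule orbit_subset_closed)
  show "x \<in> orbit (insert_before a b q) x" by (rule self_in_orbit_ins)
next
  assume x: "x \<in> S"
  fix z assume z: "z \<in> orbit (insert_before a b q) x"
  show "q z \<in> orbit (insert_before a b q) x"
  proof (cases "z = a")
    case True
    then show ?thesis using z q a by (simp add: permutes_def)
  next
    case False
    have st: "(insert_before a b q) z \<in> orbit (insert_before a b q) x" using z by (rule orbit.step)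
    show ?thesis
    proof (cases "q z = b")
      case True
      then have "(insert_before a b q) z = a" by (rule ins_eval(2))
      then have "(insert_before a b q) a \<in> orbit (insert_before a b q) x" using orbit.step[OF st] by simp
      then show ?thesis using ins_eval(1) True by simp
    next
      case False
      then show ?thesis using st ins_eval(3)[OF \<open>z \<noteq> a\<close>] by simp
    qed
  qed
qed

lemma orbit_ins: "x \<in> S \<Longrightarrow> orbit (insert_before a b q) x = (if b \<in> orbit q x then insert a (orbit q x) else orbit q x)"
proof -
  assume x: "x \<in> S"
  have "a \<in> orbit (insert_before a b q) x" if "b \<in> orbit q x"
  proof -
    have "b \<in> orbit (insert_before a b q) x" using orbit_q_subset[OF x] that by auto
    then have "x \<in> orbit (insert_before a b q) b" using orbit_swap[OF self_in_orbit_ins] by blast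
    have "b \<in> orbit (insert_before a b q) a" using orbit.base[of "insert_before a b q" a] ins_eval(1) by simp
    then have "a \<in> orbit (insert_before a b q) b" using orbit_swap[OF self_in_orbit_ins] by blast
    then show ?thesis using \<open>b \<in> orbit (insert_before a b q) x\<close> by (rule orbit_trans)
  qed
  then show ?thesis using orbit_ins_subset[OF x] orbit_q_subset[OF x] by (auto split: if_splits)
qed

lemma orbit_ins_a: "orbit (insert_before a b q) a = insert a (orbit q b)"
proof -
  have "b \<in> orbit (insert_before a b q) a" using orbit.base[of "insert_before a b q" a] ins_eval(1) by simp
  then have "orbit (insert_before a b q) a = orbit (insert_before a b q) b"
    using orbit_eq_of_mem[OF self_in_orbit_ins, of b a] by simp
  then show ?thesis using orbit_ins[OF b] self_in_orbit_q by simp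
qed

lemma orbits_ins: "orbit (insert_before a b q) ` insert a S - {orbit (insert_before a b q) a} = orbit q ` S - {orbit q b}"
proof -
  have eq_b: "orbit q x = orbit q b \<longleftrightarrow> b \<in> orbit q x" for x
    using orbit_eq_of_mem[OF self_in_orbit_q, of b x] self_in_orbit_q[of b] by auto
  have aq: "a \<notin> orbit q x" if "x \<in> S" for x using permutes_orbit_subset[OF q that] a by auto
  have 1: "orbit (insert_before a b q) x = orbit (insert_before a b q) a" if "x \<in> S" "b \<in> orbit q x" for x
    using orbit_ins[OF that(1)] that eq_b[of x] orbit_ins_a by simp
  have 2: "orbit (insert_before a b q) x = orbit q x" "orbit (insert_before a b q) x \<noteq> orbit (insert_before a b q) a" if "x \<in> S" "b \<notin> orbit q x" for x
    using orbit_ins[OF that(1)] that aq[of x] orbit_ins_a by auto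
  have "orbit (insert_before a b q) ` insert a S - {orbit (insert_before a b q) a} =
      orbit (insert_before a b q) ` {x \<in> S. b \<notin> orbit q x}"
  proof -
    have "orbit (insert_before a b q) x \<noteq> orbit (insert_before a b q) a \<longleftrightarrow> b \<notin> orbit q x" if "x \<in> S" for x
      using 1[OF that] 2(2)[OF that] by blast
    then show ?thesis by auto
  qed
  also have "\<dots> = orbit q ` {x \<in> S. b \<notin> orbit q x}" by (rule image_cong) (use 2(1) in auto)
  also have "\<dots> = orbit q ` S - {orbit q b}" using eq_b by auto
  finally show ?thesis .
qed

lemma card_orbit_ins_a: "card (orbit (insert_before a b q) a) = Suc (card (orbit q b))"
proof -
  have "orbit q b \<subseteq> S" by (rule permutes_orbit_subset[OF q b])
  then have "finite (orbit q b)" "a \<notin> orbit q b" using fin a finite_subset by auto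
  then show ?thesis unfolding orbit_ins_a by simp
qed

end

text \<open>The cycle through \<open>b\<close> has a weight \<open>w\<close> of its own. Removing a point from that cycle shifts \<open>w\<close> by one,
so an induction over points has to carry an arbitrary \<open>w\<close>.\<close>

definition marked_weight :: "(nat \<Rightarrow> complex) \<Rightarrow> (nat \<Rightarrow> complex) \<Rightarrow> 'a set \<Rightarrow> 'a \<Rightarrow> ('a \<Rightarrow> 'a) \<Rightarrow> complex" where
  "marked_weight c w S b q = w (card (orbit q b)) * (\<Prod>C\<in>orbit q ` S - {orbit q b}. c (card C))"

definition marked_sum where
  "marked_sum c w S b = (\<Sum>q | q permutes S. marked_weight c w S b q)"

definition cycle_sum :: "(nat \<Rightarrow> complex) \<Rightarrow> 'a set \<Rightarrow> complex" where
  "cycle_sum c S = (\<Sum>q | q permutes S. \<Prod>C\<in>orbit q ` S. c (card C))"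

lemma cycle_sum_eq_marked_sum:
  assumes "finite S" "b \<in> S"
  shows "cycle_sum c S = marked_sum c c S b"
  unfolding cycle_sum_def marked_sum_def marked_weight_def
proof (intro sum.cong refl)
  fix q
  show "(\<Prod>C\<in>orbit q ` S. c (card C)) = c (card (orbit q b)) * (\<Prod>C\<in>orbit q ` S - {orbit q b}. c (card C))"
    using assms by (intro prod.remove) auto
qed

text \<open>The marked point \<open>a\<close> is either a fixed point or precedes some \<open>b\<close>. In the second case its removal leaves a
permutation with marked point \<open>b\<close> whose marked cycle is shorter by one.\<close>

lemma marked_sum_insert:
  assumes fin: "finite S" and a: "a \<notin> S"
  shows "marked_sum c w (insert a S) a = w 1 * cycle_sum c S + (\<Sum>b\<in>S. marked_sum c (\<lambda>j. w (Suc j)) S b)"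
proof -
  let ?f = "\<lambda>(b, q). insert_before a b q"
  have inj: "inj_on ?f (insert a S \<times> {q. q permutes S})"
  proof (rule inj_onI, clarify)
    fix b q b' q' assume *: "q permutes S" "q' permutes S" "insert_before a b q = insert_before a b' q'"
    have "q a = a" "q' a = a" using * a by (auto simp: permutes_def)
    then have bb: "b = b'" using fun_cong[OF *(3), of a] by simp
    have "Transposition.transpose a b \<circ> (insert_before a b q) = Transposition.transpose a b \<circ> (insert_before a b q')" using *(3) bb by simp
    then show "b = b' \<and> q = q'" using bb by (simp add: comp_assoc[symmetric])
  qed
  have "marked_sum c w (insert a S) a = (\<Sum>(b, q)\<in>insert a S \<times> {q. q permutes S}. marked_weight c w (insert a S) a (insert_before a b q))"
    unfolding marked_sum_def permutes_insert
  proof (subst sum.reindex)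
    show "inj_on ?f {(b, p). b \<in> insert a S \<and> p \<in> {p. p permutes S}}"
      by (rule inj_on_subset[OF inj]) auto
  qed (auto intro!: sum.cong)
  also have "\<dots> = (\<Sum>b\<in>insert a S. \<Sum>q | q permutes S. marked_weight c w (insert a S) a (insert_before a b q))"
    by (simp add: sum.cartesian_product)
  also have "\<dots> = (\<Sum>q | q permutes S. marked_weight c w (insert a S) a (insert_before a a q)) +
      (\<Sum>b\<in>S. \<Sum>q | q permutes S. marked_weight c w (insert a S) a (insert_before a b q))"
    using fin a by simp
  also have "(\<Sum>q | q permutes S. marked_weight c w (insert a S) a (insert_before a a q)) = w 1 * cycle_sum c S"
    unfolding cycle_sum_def sum_distrib_left
  proof (rule sum.cong)
    fix q assume "q \<in> {q. q permutes S}"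
    then have q: "q permutes S" by simp
    have o1: "orbit q a = {a}" using q a by (intro orbit_fixed_singleton) (simp add: permutes_def)
    have "a \<notin> orbit q x" if "x \<in> S" for x using permutes_orbit_subset[OF q that] a by auto
    then have "orbit q ` insert a S - {orbit q a} = orbit q ` S" using o1 by auto
    then show "marked_weight c w (insert a S) a (insert_before a a q) = w 1 * (\<Prod>C\<in>orbit q ` S. c (card C))"
      by (simp add: marked_weight_def o1)
  qed simp
  also have "(\<Sum>b\<in>S. \<Sum>q | q permutes S. marked_weight c w (insert a S) a (insert_before a b q)) =
      (\<Sum>b\<in>S. marked_sum c (\<lambda>j. w (Suc j)) S b)"
    unfolding marked_sum_def
  proof (intro sum.cong refl)
    fix b q assume b: "b \<in> S" and "q \<in> {q. q permutes S}"
    then have q: "q permutes S" by simp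
    show "marked_weight c w (insert a S) a (insert_before a b q) = marked_weight c (\<lambda>j. w (Suc j)) S b q"
      unfolding marked_weight_def card_orbit_ins_a[OF fin a b q] orbits_ins[OF fin a b q] ..
  qed
  finally show ?thesis .
qed

text \<open>Iterating \<open>marked_sum_insert\<close> unwinds the marked cycle: after \<open>j\<close> steps it has been removed
entirely, and the other cycles permute the remaining points. The induction hypothesis on unmarked sums is
passed as an assumption because the final theorem is proved by induction on the same cardinality.\<close>

lemma marked_sum_eq:
  fixes S :: "'a set"
  assumes "finite S" "b \<in> S"
    and IH: "\<And>R::'a set. finite R \<Longrightarrow> card R < card S \<Longrightarrow> cycle_sum c R = fact (card R) * ecoef c (card R)"
  shows "marked_sum c w S b = fact (card S - 1) * (\<Sum>j=1..card S. w j * ecoef c (card S - j))"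
  using assms
proof (induction "card S" arbitrary: S b w)
  case 0
  then show ?case by auto
next
  case (Suc n S b w)
  define R where "R = S - {b}"
  have R: "finite R" "b \<notin> R" "S = insert b R" "card R = n" using Suc.prems Suc.hyps(2) by (auto simp: R_def)
  have m: "marked_sum c (\<lambda>j. w (Suc j)) R x = fact (n - 1) * (\<Sum>j=1..n. w (Suc j) * ecoef c (n - j))" if "x \<in> R" for x
  proof -
    have "marked_sum c (\<lambda>j. w (Suc j)) R x = fact (card R - 1) * (\<Sum>j=1..card R. w (Suc j) * ecoef c (card R - j))"
    proof (rule Suc.hyps(1)[OF R(4)[symmetric] R(1) that])
      fix Q :: "'a set" assume "finite Q" "card Q < card R"
      then show "cycle_sum c Q = fact (card Q) * ecoef c (card Q)"
        using Suc.prems(3)[of Q] R(4) Suc.hyps(2) by linarith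
    qed
    then show ?thesis unfolding R(4) .
  qed
  have "card R < card S" using R(4) Suc.hyps(2) by simp
  then have c: "cycle_sum c R = fact n * ecoef c n" using Suc.prems(3)[OF R(1)] unfolding R(4) by blast
  have "marked_sum c w S b = w 1 * (fact n * ecoef c n) + of_nat n * (fact (n - 1) * (\<Sum>j=1..n. w (Suc j) * ecoef c (n - j)))"
    unfolding R(3) marked_sum_insert[OF R(1,2)] c using m by (simp add: R(4))
  also have "of_nat n * (fact (n - 1) * (\<Sum>j=1..n. w (Suc j) * ecoef c (n - j))) =
      fact n * (\<Sum>j=1..n. w (Suc j) * ecoef c (n - j))"
    by (cases n) (auto simp: algebra_simps)
  also have "w 1 * (fact n * ecoef c n) + fact n * (\<Sum>j=1..n. w (Suc j) * ecoef c (n - j)) =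
      fact n * (w 1 * ecoef c n + (\<Sum>j=1..n. w (Suc j) * ecoef c (n - j)))"
    by (simp add: algebra_simps)
  also have "w 1 * ecoef c n + (\<Sum>j=1..n. w (Suc j) * ecoef c (n - j)) = (\<Sum>j=1..Suc n. w j * ecoef c (Suc n - j))"
  proof -
    have "(\<Sum>j=1..Suc n. w j * ecoef c (Suc n - j)) = w 1 * ecoef c n + (\<Sum>j=2..Suc n. w j * ecoef c (Suc n - j))"
      using sum.atLeast_Suc_atMost[of 1 "Suc n" "\<lambda>j. w j * ecoef c (Suc n - j)"] by (simp add: numeral_2_eq_2)
    also have "(\<Sum>j=2..Suc n. w j * ecoef c (Suc n - j)) = (\<Sum>j=1..n. w (Suc j) * ecoef c (n - j))"
      by (rule sum.reindex_bij_witness[of _ Suc "\<lambda>j. j - 1"]) auto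
    finally show ?thesis by simp
  qed
  finally show ?case using Suc.hyps(2) by (metis diff_Suc_1)
qed

text \<open>Sorting permutations by the length \<open>j\<close> of the cycle of one chosen point gives the recursion that defines
\<open>ecoef\<close>.\<close>

theorem cycle_sum_eq_ecoef:
  assumes "finite S"
  shows "cycle_sum c S = fact (card S) * ecoef c (card S)"
  using assms
proof (induction "card S" arbitrary: S rule: less_induct)
  case less
  show ?case
  proof (cases "S = {}")
    case True
    then show ?thesis by (simp add: cycle_sum_def)
  next
    case False
    then obtain b where b: "b \<in> S" by auto
    have pos: "card S \<noteq> 0" using less.prems False by simp
    have "cycle_sum c S = fact (card S - 1) * (\<Sum>j=1..card S. c j * ecoef c (card S - j))"
      unfolding cycle_sum_eq_marked_sum[OF less.prems b]
      by (rule marked_sum_eq[OF less.prems b]) (use less.hyps in auto)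
    also have "\<dots> = fact (card S - 1) * (of_nat (card S) * ecoef c (card S))" by (simp only: ecoef_rec)
    also have "\<dots> = fact (card S) * ecoef c (card S)" using pos by (subst (2) fact_num_eq_if) auto
    finally show ?thesis .
  qed
qed

lemma cycle_sum_eq_prod_power:
  "(\<Sum>\<sigma>\<in>sym_group n. \<Prod>j=1..n. c j ^ cycle_count n j \<sigma>) = cycle_sum c {1..n}"
  unfolding cycle_sum_def sym_group_def
proof (intro sum.cong refl)
  fix \<sigma> assume "\<sigma> \<in> {\<sigma>. \<sigma> permutes {1..n}}"
  then have p: "\<sigma> permutes {1..n}" by simp
  have "card C \<in> {1..n}" if C: "C \<in> orbit \<sigma> ` {1..n}" for C
  proof -
    obtain x where x: "x \<in> {1..n}" "C = orbit \<sigma> x" using C by auto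
    have "C \<subseteq> {1..n}" using permutes_orbit_subset[OF p x(1)] x by simp
    moreover have "\<sigma> x \<in> C" using x orbit.base by simp
    moreover have "finite C" using \<open>C \<subseteq> {1..n}\<close> by (rule finite_subset) simp
    ultimately have "card C \<le> card {1..n}" "card C \<noteq> 0"
      using card_mono[of "{1..n}" C] by auto
    then show ?thesis by simp
  qed
  then have "(\<Prod>C\<in>orbit \<sigma> ` {1..n}. c (card C)) =
      (\<Prod>j\<in>{1..n}. \<Prod>C\<in>{C \<in> orbit \<sigma> ` {1..n}. card C = j}. c (card C))"
    by (intro prod.group[symmetric]) auto
  also have "\<dots> = (\<Prod>j=1..n. c j ^ cycle_count n j \<sigma>)"
    by (intro prod.cong refl) (simp add: cycle_count_def)
  finally show "(\<Prod>j=1..n. c j ^ cycle_count n j \<sigma>) = (\<Prod>C\<in>orbit \<sigma> ` {1..n}. c (card C))" by simp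
qed

section \<open>Hoelder weights and the normal distribution function\<close>

text \<open>The bound is uniform in \<open>m\<close>: near \<open>0\<close> the weight \<open>i powr (\<kappa> - 1)\<close> is summable to the order \<open>m powr \<kappa>\<close>, and near
\<open>m\<close> the singularity \<open>(m - i) powr (- a)\<close> is summable because \<open>a < 1\<close>.\<close>

lemma wfac_sum_le:
  assumes k: "0 < \<kappa>" "\<kappa> \<le> 1" and a: "0 \<le> a" "a < 1"
  shows "(\<Sum>i=1..m. wfac \<kappa> a m i / real i) \<le> 2 / \<kappa>\<^sup>2 + 2 / (1 - a)\<^sup>2"
proof -
  define M where "M = real m + 1"
  have M: "M \<ge> 1" by (simp add: M_def)
  have t: "wfac \<kappa> a m i / real i \<le> 2 * M powr - \<kappa> * real i powr (\<kappa> - 1) + 2 * M powr (a - 1) * (real (m - i) + 1) powr (- a)"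
    if i: "i \<in> {1..m}" for i
  proof -
    define L where "L = real (m - i) + 1"
    have L: "1 \<le> L" "L \<le> M" by (auto simp: L_def M_def)
    have i0: "0 < real i" using i by simp
    have w: "wfac \<kappa> a m i / real i = (real i / M) powr \<kappa> * (M / L) powr a / real i"
      by (simp add: wfac_def M_def L_def)
    show ?thesis
    proof (cases "2 * i \<le> m")
      case True
      have "M / L \<le> 2" using True L i by (simp add: M_def L_def of_nat_diff field_simps)
      then have "(M / L) powr a \<le> 2 powr a" using L M a by (intro powr_mono2) auto
      also have "\<dots> \<le> 2 powr 1" using a by (intro powr_mono) auto
      finally have "(real i / M) powr \<kappa> * (M / L) powr a / real i \<le> (real i / M) powr \<kappa> * 2 / real i"
        using i0 by (intro divide_right_mono mult_left_mono) auto
      also have "\<dots> = 2 * M powr - \<kappa> * real i powr (\<kappa> - 1)"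
        using i0 M by (simp add: powr_divide powr_minus_divide powr_diff)
      finally show ?thesis unfolding w using M by (simp add: add_increasing2)
    next
      case False
      then have iM: "M / 2 \<le> real i" "real i \<le> M" using i by (auto simp: M_def)
      have "(real i / M) powr \<kappa> \<le> 1 powr \<kappa>" using iM M i0 k by (intro powr_mono2) auto
      then have "(real i / M) powr \<kappa> * (M / L) powr a / real i \<le> 1 * (M / L) powr a / (M / 2)"
        using iM M i0 by (intro frac_le mult_right_mono) auto
      also have "\<dots> = 2 * M powr (a - 1) * L powr (- a)"
        using M L by (simp add: powr_divide powr_minus_divide powr_diff mult_ac)
      finally show ?thesis unfolding w L_def using M by (simp add: add_increasing)
    qed
  qed
  have s1: "(\<Sum>i=1..m. real i powr (\<kappa> - 1)) \<le> M powr \<kappa> / \<kappa>\<^sup>2"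
  proof -
    have "(\<Sum>i=1..m. real i powr (\<kappa> - 1)) = (\<Sum>k<m. (real k + 1) powr (\<kappa> - 1))"
      by (rule sum.reindex_bij_witness[of _ Suc "\<lambda>i. i - 1"]) (auto simp: add.commute)
    also have "\<dots> \<le> (\<Sum>k<Suc m. (real k + 1) powr (\<kappa> - 1))" by simp
    also have "\<dots> = (\<Sum>k\<le>m. (real (m - k) + 1) powr (\<kappa> - 1))"
      by (rule sum.reindex_bij_witness[of _ "\<lambda>i. m - i" "\<lambda>j. m - j"]) auto
    also have "\<dots> \<le> M powr \<kappa> / \<kappa>\<^sup>2" unfolding M_def by (rule sum_powr_le[OF k])
    finally show ?thesis .
  qed
  have s2: "(\<Sum>i=1..m. (real (m - i) + 1) powr (- a)) \<le> M powr (1 - a) / (1 - a)\<^sup>2"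
  proof -
    have "(\<Sum>i=1..m. (real (m - i) + 1) powr (- a)) \<le> (\<Sum>i\<le>m. (real (m - i) + 1) powr ((1 - a) - 1))"
      by (simp, rule sum_mono2) auto
    also have "\<dots> \<le> M powr (1 - a) / (1 - a)\<^sup>2" unfolding M_def by (rule sum_powr_le) (use a in auto)
    finally show ?thesis .
  qed
  have "(\<Sum>i=1..m. wfac \<kappa> a m i / real i) \<le>
      (\<Sum>i=1..m. 2 * M powr - \<kappa> * real i powr (\<kappa> - 1) + 2 * M powr (a - 1) * (real (m - i) + 1) powr (- a))"
    by (intro sum_mono t)
  also have "\<dots> = 2 * M powr - \<kappa> * (\<Sum>i=1..m. real i powr (\<kappa> - 1)) + 2 * M powr (a - 1) * (\<Sum>i=1..m. (real (m - i) + 1) powr (- a))"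
    by (simp only: sum.distrib sum_distrib_left)
  also have "\<dots> \<le> 2 * M powr - \<kappa> * (M powr \<kappa> / \<kappa>\<^sup>2) + 2 * M powr (a - 1) * (M powr (1 - a) / (1 - a)\<^sup>2)"
    using s1 s2 by (intro add_mono mult_left_mono) auto
  also have "\<dots> = 2 * (M powr - \<kappa> * M powr \<kappa>) / \<kappa>\<^sup>2 + 2 * (M powr (a - 1) * M powr (1 - a)) / (1 - a)\<^sup>2" by simp
  also have "\<dots> = 2 / \<kappa>\<^sup>2 + 2 / (1 - a)\<^sup>2" using M unfolding powr_add[symmetric] by simp
  finally show ?thesis .
qed

lemma holder_sum_le:
  fixes w x y :: "'i \<Rightarrow> real" and p q :: real
  assumes pq: "1 < p" "1 < q" "1 / p + 1 / q = 1"
    and nn: "\<And>i. i \<in> I \<Longrightarrow> 0 \<le> w i \<and> 0 \<le> x i \<and> 0 \<le> y i"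
    and AB: "0 < A" "0 < B" "(\<Sum>i\<in>I. w i * x i powr p) \<le> A" "(\<Sum>i\<in>I. w i * y i powr q) \<le> B"
  shows "(\<Sum>i\<in>I. w i * (x i * y i)) \<le> A powr (1 / p) * B powr (1 / q)"
proof -
  define a where "a = A powr (1 / p)"
  define b where "b = B powr (1 / q)"
  have ab: "0 < a" "0 < b" "a powr p = A" "b powr q = B"
    using AB pq by (auto simp: a_def b_def powr_powr)
  have "(\<Sum>i\<in>I. w i * (x i * y i)) \<le> (\<Sum>i\<in>I. a * b * (w i * x i powr p / (A * p) + w i * y i powr q / (B * q)))"
  proof (rule sum_mono)
    fix i assume i: "i \<in> I"
    have "x i / a * (y i / b) \<le> (x i / a) powr p / p + (y i / b) powr q / q"
      using nn[OF i] ab pq by (intro Youngs_inequality) auto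
    also have "\<dots> = x i powr p / (A * p) + y i powr q / (B * q)"
      using nn[OF i] ab by (simp add: powr_divide)
    finally have "a * b * w i * (x i / a * (y i / b)) \<le> a * b * w i * (x i powr p / (A * p) + y i powr q / (B * q))"
      using nn[OF i] ab by (intro mult_left_mono) auto
    then show "w i * (x i * y i) \<le> a * b * (w i * x i powr p / (A * p) + w i * y i powr q / (B * q))"
      using ab by (simp add: algebra_simps)
  qed
  also have "\<dots> = a * b * ((\<Sum>i\<in>I. w i * x i powr p) / (A * p) + (\<Sum>i\<in>I. w i * y i powr q) / (B * q))"
    by (simp only: sum_distrib_left[symmetric] sum.distrib sum_divide_distrib[symmetric])
  also have "\<dots> \<le> a * b * (A / (A * p) + B / (B * q))"
    using AB ab pq by (intro mult_left_mono add_mono divide_right_mono) auto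
  also have "\<dots> = a * b" using AB pq by simp
  finally show ?thesis by (simp add: a_def b_def)
qed

text \<open>Hoelder's inequality with the conjugate exponent \<open>q\<close> of \<open>p\<close>. The weights blow up like
\<open>(1 - j / n) powr (\<beta> - 1 - k)\<close>, and the \<open>q\<close>-th power of this is summable if \<open>\<beta> - k > 1 / p\<close>. Since also
\<open>\<beta> < \<theta>\<close>, a suitable \<open>\<beta>\<close> exists precisely when \<open>p > 1 / \<theta>\<close>: this is where that condition
enters.\<close>

lemma weighted_bound_L_norm:
  assumes p: "ereal (max 2 (1 / \<theta>)) < p" and \<theta>: "0 < \<theta>"
  obtains \<beta> k0 where "0 < \<beta>" "\<beta> < \<theta>" "0 < k0"
    "\<And>k. 0 < k \<Longrightarrow> k \<le> k0 \<Longrightarrow> \<beta> \<le> 1 \<Longrightarrow> \<exists>R>0. \<forall>n h. 1 \<le> n \<longrightarrow> (\<exists>j\<in>{1..n}. h j \<noteq> 0) \<longrightarrow>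
      weighted_bound k (1 - \<beta> + k) n h (R * sqrt (L_norm_sq n h p))"
proof (cases "p = \<infinity>")
  case True
  show thesis
  proof (rule that[of "\<theta> / 2" "min 1 (\<theta> / 4)"])
    fix k assume k: "0 < k" "k \<le> min 1 (\<theta> / 4)" "\<theta> / 2 \<le> 1"
    define a where "a = 1 - \<theta> / 2 + k"
    have a: "0 \<le> a" "a < 1" using k \<theta> by (auto simp: a_def)
    define R where "R = 2 / k\<^sup>2 + 2 / (1 - a)\<^sup>2"
    have R: "0 < R" using k by (auto simp: R_def intro!: add_pos_nonneg)
    have "weighted_bound k a n h (R * sqrt (L_norm_sq n h p))" if n: "1 \<le> n" for n h
      unfolding weighted_bound_def
    proof (intro allI impI)
      fix m :: nat assume m: "1 \<le> m" "m \<le> n"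
      define \<rho> where "\<rho> = Max ((\<lambda>j. \<bar>h j\<bar>) ` {1..n})"
      have le: "\<bar>h j\<bar> \<le> \<rho>" if "j \<in> {1..n}" for j unfolding \<rho>_def using that by (intro Max_ge) auto
      have \<rho>: "0 \<le> \<rho>" using le[of 1] n by auto
      have "(\<Sum>i=1..m. \<bar>h i\<bar> / real i * wfac k a m i) \<le> (\<Sum>i=1..m. \<rho> * (wfac k a m i / real i))"
      proof (rule sum_mono)
        fix i assume "i \<in> {1..m}"
        then show "\<bar>h i\<bar> / real i * wfac k a m i \<le> \<rho> * (wfac k a m i / real i)"
          using le[of i] m wfac_nonneg[of k a m i] by (simp add: mult_right_mono divide_right_mono)
      qed
      also have "\<dots> = \<rho> * (\<Sum>i=1..m. wfac k a m i / real i)" by (simp add: sum_distrib_left)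
      also have "\<dots> \<le> \<rho> * R" unfolding R_def using k a \<rho> by (intro mult_left_mono wfac_sum_le) auto
      also have "\<rho> * R = R * sqrt (L_norm_sq n h p)" using True \<rho> by (simp add: L_norm_sq_def \<rho>_def)
      finally show "(\<Sum>i=1..m. \<bar>h i\<bar> / real i * wfac k a m i) \<le> R * sqrt (L_norm_sq n h p)" .
    qed
    then show "\<exists>R>0. \<forall>n h. 1 \<le> n \<longrightarrow> (\<exists>j\<in>{1..n}. h j \<noteq> 0) \<longrightarrow>
      weighted_bound k (1 - \<theta> / 2 + k) n h (R * sqrt (L_norm_sq n h p))"
      using R unfolding a_def by blast
  qed (use \<theta> in auto)
next
  case False
  obtain r where r: "p = ereal r" using p False by (cases p) auto
  have r2: "2 < r" "1 / \<theta> < r" using p r by auto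
  have rt: "1 / r < \<theta>" using r2 \<theta> by (simp add: field_simps)
  define q where "q = r / (r - 1)"
  have q: "1 < q" "1 / r + 1 / q = 1" using r2 by (auto simp: q_def field_simps)
  define \<beta> where "\<beta> = (1 / r + \<theta>) / 2"
  define k0 where "k0 = min 1 ((\<beta> - 1 / r) / 2)"
  have b: "0 < \<beta>" "\<beta> < \<theta>" "1 / r < \<beta>" using rt r2 \<theta> by (auto simp: \<beta>_def intro!: add_pos_pos)
  show thesis
  proof (rule that[of \<beta> k0])
    fix k assume k: "0 < k" "k \<le> k0" "\<beta> \<le> 1"
    define a where "a = 1 - \<beta> + k"
    have k': "k \<le> 1" "k \<le> (\<beta> - 1 / r) / 2" using k by (auto simp: k0_def)
    have a: "0 \<le> a" "a < 1 - 1 / r" using k k' b by (auto simp: a_def)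
    have aq: "0 \<le> a * q" "a * q < 1"
    proof -
      have "a < 1 / q" using a q by linarith
      then show "a * q < 1" using q by (simp add: field_simps)
    qed (use a q in auto)
    define B where "B = 2 / k\<^sup>2 + 2 / (1 - a * q)\<^sup>2"
    have B: "0 < B" using k by (auto simp: B_def intro!: add_pos_nonneg)
    define R where "R = B powr (1 / q)"
    have R: "0 < R" using B by (simp add: R_def)
    have "weighted_bound k a n h (R * sqrt (L_norm_sq n h p))" if n: "1 \<le> n" and h: "\<exists>j\<in>{1..n}. h j \<noteq> 0" for n h
      unfolding weighted_bound_def
    proof (intro allI impI)
      fix m :: nat assume m: "1 \<le> m" "m \<le> n"
      define A where "A = L_sum n h r"
      have A: "0 < A"
      proof -
        obtain j where j: "j \<in> {1..n}" "h j \<noteq> 0" using h by auto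
        have "0 < \<bar>h j\<bar> powr r / real j" using j by simp
        also have "\<dots> \<le> A" unfolding A_def L_sum_def by (rule member_le_sum) (use j in auto)
        finally show ?thesis .
      qed
      have "(\<Sum>i=1..m. 1 / real i * (\<bar>h i\<bar> * wfac k a m i)) \<le> A powr (1 / r) * B powr (1 / q)"
      proof (rule holder_sum_le)
        show "(\<Sum>i=1..m. 1 / real i * \<bar>h i\<bar> powr r) \<le> A"
          unfolding A_def L_sum_def using m by (simp, intro sum_mono2) auto
        have "(\<Sum>i=1..m. 1 / real i * wfac k a m i powr q) \<le> (\<Sum>i=1..m. wfac k (a * q) m i / real i)"
        proof (rule sum_mono)
          fix i assume i: "i \<in> {1..m}"
          have "wfac k a m i powr q = (real i / (real m + 1)) powr (k * q) * ((real m + 1) / (real (m - i) + 1)) powr (a * q)"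
            by (simp add: wfac_def powr_mult powr_powr)
          also have "\<dots> \<le> (real i / (real m + 1)) powr k * ((real m + 1) / (real (m - i) + 1)) powr (a * q)"
            using i k q by (intro mult_right_mono powr_mono') auto
          finally show "1 / real i * wfac k a m i powr q \<le> wfac k (a * q) m i / real i"
            by (simp add: wfac_def divide_right_mono)
        qed
        also have "\<dots> \<le> B" unfolding B_def using k k' aq by (intro wfac_sum_le) auto
        finally show "(\<Sum>i=1..m. 1 / real i * wfac k a m i powr q) \<le> B" .
      qed (use r2 q A B in \<open>auto simp: wfac_nonneg\<close>)
      also have "A powr (1 / r) = sqrt (A powr (2 / r))"
        using A by (simp add: powr_half_sqrt[symmetric] powr_powr)
      also have "A powr (2 / r) = L_norm_sq n h p" by (simp add: L_norm_sq_def r A_def)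
      finally show "(\<Sum>i=1..m. \<bar>h i\<bar> / real i * wfac k a m i) \<le> R * sqrt (L_norm_sq n h p)"
        by (simp add: R_def mult.commute)
    qed
    then show "\<exists>R>0. \<forall>n h. 1 \<le> n \<longrightarrow> (\<exists>j\<in>{1..n}. h j \<noteq> 0) \<longrightarrow>
      weighted_bound k (1 - \<beta> + k) n h (R * sqrt (L_norm_sq n h p))"
      using R unfolding a_def by blast
  qed (use b in \<open>auto simp: k0_def\<close>)
qed

lemma norm_exp_diff_le:
  fixes z w :: complex
  assumes "Re z \<le> r" "Re w \<le> r"
  shows "norm (exp z - exp w) \<le> norm (z - w) * exp r"
proof -
  let ?g = "\<lambda>u::real. exp (w + of_real u * (z - w))"
  have "norm (?g 1 - ?g 0) \<le> 1 * (norm (z - w) * exp r)"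
  proof (rule norm_diff_le_of_derivative_bound)
    fix u :: real assume u: "0 \<le> u" "u \<le> 1"
    show "(?g has_vector_derivative (z - w) * ?g u) (at u)"
    proof -
      have "((\<lambda>v. exp (w + v * (z - w))) has_field_derivative (z - w) * ?g u) (at (of_real u))"
        by (auto intro!: derivative_eq_intros)
      from has_vector_derivative_real_field[OF this] show ?thesis .
    qed
    have "Re (w + of_real u * (z - w)) = (1 - u) * Re w + u * Re z" by (simp add: algebra_simps)
    also have "\<dots> \<le> (1 - u) * r + u * r" using assms u by (intro add_mono mult_left_mono) auto
    finally have "Re (w + of_real u * (z - w)) \<le> r" by (simp add: algebra_simps)
    then show "norm ((z - w) * ?g u) \<le> norm (z - w) * exp r"
      unfolding norm_mult norm_exp_eq_Re by (intro mult_left_mono) auto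
  qed simp
  then show ?thesis by simp
qed

text \<open>The target \<open>t / (1 + t\<^sup>2)\<close> is the shape that \<open>esseen_smoothing\<close> integrates.\<close>

lemma polynomial_gauss_le:
  fixes t :: real
  assumes "0 \<le> t"
  shows "(t\<^sup>2 + t ^ 3 + t ^ 4) * exp (- t\<^sup>2 / 64) \<le> (3 * 64 ^ 3 * 27) * (t / (1 + t\<^sup>2))"
proof -
  define y where "y = t\<^sup>2 / 64"
  have y: "0 \<le> y" "t\<^sup>2 = 64 * y" by (auto simp: y_def)
  have Y: "1 \<le> 1 + t\<^sup>2" by simp
  have "2 * t \<le> 1 + t\<^sup>2" using sum_squares_ge_zero[of "t - 1" 0] by (simp add: power2_eq_square algebra_simps)
  then have t1: "t \<le> (1 + t\<^sup>2) ^ 2"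
    using self_le_power[OF Y, of 2] assms by linarith
  have t2: "t\<^sup>2 \<le> (1 + t\<^sup>2) ^ 2" using self_le_power[OF Y, of 2] by linarith
  have t3: "t ^ 3 \<le> (1 + t\<^sup>2) ^ 2"
  proof -
    have "t ^ 3 = t * t\<^sup>2" by (simp add: power3_eq_cube power2_eq_square)
    also have "\<dots> \<le> (1 + t\<^sup>2) * (1 + t\<^sup>2)" using \<open>2 * t \<le> 1 + t\<^sup>2\<close> assms by (intro mult_mono) auto
    finally show ?thesis by (simp add: power2_eq_square)
  qed
  have "(t + t\<^sup>2 + t ^ 3) * (1 + t\<^sup>2) \<le> (3 * (1 + t\<^sup>2) ^ 2) * (1 + t\<^sup>2)"
    using t1 t2 t3 by (intro mult_right_mono) auto
  also have "\<dots> = 3 * (1 + t\<^sup>2) ^ 3" by (simp add: power3_eq_cube power2_eq_square)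
  also have "\<dots> \<le> 3 * (64 * (1 + y)) ^ 3" using y by (intro mult_left_mono power_mono) auto
  also have "\<dots> \<le> 3 * (64 * (3 * exp (y / 3))) ^ 3"
  proof (intro mult_left_mono power_mono)
    have "1 + y / 3 \<le> exp (y / 3)" by (rule exp_ge_add_one_self)
    then show "1 + y \<le> 3 * exp (y / 3)" using y by linarith
  qed (use y in auto)
  also have "\<dots> = 3 * 64 ^ 3 * 27 * exp y"
    by (simp add: power_mult_distrib exp_of_nat_mult[symmetric])
  finally have "(t + t\<^sup>2 + t ^ 3) * (1 + t\<^sup>2) * exp (- y) \<le> 3 * 64 ^ 3 * 27 * exp y * exp (- y)"
    by (intro mult_right_mono) auto
  moreover have "c * exp y * exp (- y) = c" for c :: real by (simp add: exp_minus)
  ultimately have "(t + t\<^sup>2 + t ^ 3) * (1 + t\<^sup>2) * exp (- y) \<le> 3 * 64 ^ 3 * 27"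
    by (simp only:)
  then have "t / (1 + t\<^sup>2) * ((t + t\<^sup>2 + t ^ 3) * (1 + t\<^sup>2) * exp (- y)) \<le> t / (1 + t\<^sup>2) * (3 * 64 ^ 3 * 27)"
    using assms by (intro mult_left_mono) auto
  moreover have "t / (1 + t\<^sup>2) * ((t + t\<^sup>2 + t ^ 3) * (1 + t\<^sup>2) * exp (- y)) = (t\<^sup>2 + t ^ 3 + t ^ 4) * exp (- t\<^sup>2 / 64)"
  proof -
    have "1 + t\<^sup>2 \<noteq> 0" using Y by linarith
    then have "t / (1 + t\<^sup>2) * ((t + t\<^sup>2 + t ^ 3) * (1 + t\<^sup>2) * exp (- y)) = t * (t + t\<^sup>2 + t ^ 3) * exp (- y)" by simp
    also have "t * (t + t\<^sup>2 + t ^ 3) = t\<^sup>2 + t ^ 3 + t ^ 4" by (simp add: power2_eq_square power3_eq_cube power4_eq_xxxx algebra_simps)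
    finally show ?thesis by (simp add: y_def)
  qed
  ultimately show ?thesis by (simp add: mult.commute)
qed

lemma std_normal_density_lipschitz: "\<bar>std_normal_density x - std_normal_density y\<bar> \<le> \<bar>x - y\<bar>"
proof -
  have "norm (std_normal_density x - std_normal_density y) \<le> 1 * norm (x - y)"
  proof (rule field_differentiable_bound[of UNIV])
    fix u :: real
    show "(std_normal_density has_field_derivative (- u) * std_normal_density u) (at u within UNIV)"
    proof -
      have "((\<lambda>u. c * exp (- u\<^sup>2 / 2)) has_field_derivative (- u) * (c * exp (- u\<^sup>2 / 2))) (at u)" for c :: real
        by (auto intro!: derivative_eq_intros)
      from this[of "1 / sqrt (2 * pi)"] show ?thesis by (simp add: std_normal_density_def[abs_def])
    qed
    have "\<bar>u\<bar> \<le> 1 + u\<^sup>2 / 2"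
      using zero_le_power2[of "\<bar>u\<bar> - 1"] by (simp add: power2_eq_square algebra_simps)
    also have "\<dots> \<le> exp (u\<^sup>2 / 2)" by (rule exp_ge_add_one_self)
    finally have "\<bar>u\<bar> * exp (- u\<^sup>2 / 2) \<le> exp (u\<^sup>2 / 2) * exp (- u\<^sup>2 / 2)" by (intro mult_right_mono) auto
    then have 1: "\<bar>u\<bar> * exp (- u\<^sup>2 / 2) \<le> 1" by (simp add: exp_add[symmetric])
    have "1 \<le> sqrt (2 * pi)" using pi_gt3 by simp
    then have "1 / sqrt (2 * pi) \<le> 1" by simp
    then have "1 / sqrt (2 * pi) * (\<bar>u\<bar> * exp (- u\<^sup>2 / 2)) \<le> 1 * 1" using 1 by (intro mult_mono) auto
    then show "norm ((- u) * std_normal_density u) \<le> 1"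
      by (simp add: std_normal_density_def abs_mult mult_ac)
  qed auto
  then show ?thesis by simp
qed

lemma std_normal_density_le_1: "std_normal_density x \<le> 1"
proof -
  have "1 \<le> sqrt (2 * pi)" using pi_gt3 by simp
  then have "1 / sqrt (2 * pi) * exp (- x\<^sup>2 / 2) \<le> 1 * 1" by (intro mult_mono) auto
  then show ?thesis by (simp add: std_normal_density_def)
qed

lemma Phi_increment:
  assumes "x \<le> y" "\<And>u. x < u \<Longrightarrow> u \<le> y \<Longrightarrow> a \<le> std_normal_density u \<and> std_normal_density u \<le> b"
  shows "a * (y - x) \<le> Phi y - Phi x" "Phi y - Phi x \<le> b * (y - x)"
proof -
  interpret N: real_distribution std_normal_distribution by (rule real_dist_normal_dist)
  have "Phi y - Phi x = (LBINT u. std_normal_density u * indicator {x<..y} u)"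
  proof (cases "x = y")
    case False
    then have "Phi y - Phi x = measure std_normal_distribution {x<..y}"
      unfolding Phi_eq_cdf using assms(1) by (intro N.cdf_diff_eq) auto
    also have "\<dots> = (\<integral>u. indicator {x<..y} u \<partial>std_normal_distribution)" by simp
    also have "\<dots> = (LBINT u. std_normal_density u *\<^sub>R indicator {x<..y} u)"
      by (rule integral_density) auto
    finally show ?thesis by simp
  qed simp
  moreover have i: "integrable lborel (\<lambda>u. std_normal_density u * indicator {x<..y} u)"
    by (intro integrable_real_mult_indicator integrable_normal_density) auto
  have c: "integrable lborel (\<lambda>u. c * indicator {x<..y} u)" "(LBINT u. c * indicator {x<..y} u) = c * (y - x)" for c :: real
    using assms(1) by (auto intro!: integrable_mult_right integrable_real_indicator simp: less_top[symmetric])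
  have "(LBINT u. a * indicator {x<..y} u) \<le> (LBINT u. std_normal_density u * indicator {x<..y} u)"
    using assms(2) by (intro integral_mono c i) (auto split: split_indicator)
  moreover have "(LBINT u. std_normal_density u * indicator {x<..y} u) \<le> (LBINT u. b * indicator {x<..y} u)"
    using assms(2) by (intro integral_mono c i) (auto split: split_indicator)
  ultimately show "a * (y - x) \<le> Phi y - Phi x" "Phi y - Phi x \<le> b * (y - x)"
    unfolding c(2) by auto
qed

lemma Phi_lipschitz: "x \<le> y \<Longrightarrow> Phi y - Phi x \<le> y - x"
  using Phi_increment(2)[of x y 0 1] std_normal_density_le_1 by simp

text \<open>The density is Lipschitz with constant \<open>1\<close>, so over an interval of length \<open>\<bar>c\<bar>\<close> it stays within \<open>\<bar>c\<bar>\<close> of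
its value at \<open>x\<close>.\<close>

lemma Phi_taylor: "\<bar>Phi (x - c) - Phi x + c * std_normal_density x\<bar> \<le> c\<^sup>2"
proof (cases "0 \<le> c")
  case True
  have b: "std_normal_density x - c \<le> std_normal_density u \<and> std_normal_density u \<le> std_normal_density x + c"
    if "x - c < u" "u \<le> x" for u
    using std_normal_density_lipschitz[of u x] that by (auto simp: abs_le_iff)
  have "(std_normal_density x - c) * (x - (x - c)) \<le> Phi x - Phi (x - c)"
    "Phi x - Phi (x - c) \<le> (std_normal_density x + c) * (x - (x - c))"
    using Phi_increment[of "x - c" x, OF _ b] True by auto
  then show ?thesis by (auto simp: abs_le_iff power2_eq_square algebra_simps)
next
  case False
  have b: "std_normal_density x + c \<le> std_normal_density u \<and> std_normal_density u \<le> std_normal_density x - c"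
    if "x < u" "u \<le> x - c" for u
    using std_normal_density_lipschitz[of u x] that by (auto simp: abs_le_iff)
  have "(std_normal_density x + c) * ((x - c) - x) \<le> Phi (x - c) - Phi x"
    "Phi (x - c) - Phi x \<le> (std_normal_density x - c) * ((x - c) - x)"
    using Phi_increment[of x "x - c", OF _ b] False by auto
  then show ?thesis by (auto simp: abs_le_iff power2_eq_square algebra_simps)
qed

section \<open>Comparison with the Gaussian characteristic function\<close>

context
  fixes \<beta> \<theta> D :: real
  assumes params: "0 < \<beta>" "\<beta> < \<theta>" "\<theta> \<le> 1" "\<theta> \<le> D"
begin

text \<open>After centring at the mean plus the correction \<open>C\<close>, four errors remain: the remainder of
\<open>twist_expansion\<close>; the linear term \<open>S\<close>, which equals \<open>\<i> * t * C\<close> up to the second-order sum \<open>L2'\<close>; the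
Poisson approximation, which is Gaussian up to the third absolute moment; and
\<open>1 + \<i> * t * C\<close> against \<open>exp (\<i> * t * C)\<close>, which costs \<open>t\<^sup>2 * C\<^sup>2\<close>, where \<open>C\<^sup>2\<close> is of the order \<open>\<rho>\<^sup>2\<close> by the
last claim of \<open>twist_expansion\<close>.\<close>

lemma twist_gauss_approx:
  assumes k0: "0 < k0"
  obtains B c k where "0 < B" "0 < c" "0 < k" "k \<le> k0"
    "\<And>d h n t \<rho>. admissible \<theta> D d h n \<Longrightarrow>
      1 \<le> n \<Longrightarrow> weighted_bound k (1 - \<beta> + k) n h \<rho> \<Longrightarrow> 0 < t \<Longrightarrow> t * third h n \<le> c \<Longrightarrow>
      norm (iexp (- (t * (A_mean n d h + C_corr n d h))) * (twist d (phase h t) n / of_real (ecoef d n))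
        - of_real (exp (- t\<^sup>2 / 2))) \<le> B * (third h n + \<rho>\<^sup>2 + L2' n d h) * (t / (1 + t\<^sup>2))"
    "\<And>d h n \<rho>. admissible \<theta> D d h n \<Longrightarrow>
      1 \<le> n \<Longrightarrow> weighted_bound k (1 - \<beta> + k) n h \<rho> \<Longrightarrow> (C_corr n d h)\<^sup>2 \<le> B * \<rho>\<^sup>2"
proof -
  have D: "0 < D" using params by linarith
  obtain K c k where K: "0 < K" "0 < c" "0 < k" "k \<le> k0"
    and expn: "\<And>d h n t \<rho>. admissible \<theta> D d h n \<Longrightarrow>
      1 \<le> n \<Longrightarrow> weighted_bound k (1 - \<beta> + k) n h \<rho> \<Longrightarrow> 0 \<le> t \<Longrightarrow> t * third h n \<le> c \<Longrightarrow>
      norm (twist d (phase h t) n / of_real (ecoef d n) - exp (log_ratio d h n t) *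
        (1 + (\<Sum>j=1..n. of_real (d j / real j) * (phase h t j - 1) * of_real (ecoef d (n - j) / ecoef d n - 1))))
      \<le> K * (t\<^sup>2 * \<rho>\<^sup>2 * exp (- t\<^sup>2 / 64))"
    and dlow: "\<And>d h n t. admissible \<theta> D d h n \<Longrightarrow>
      0 \<le> t \<Longrightarrow> t * third h n \<le> c \<Longrightarrow> 31 / 64 * t\<^sup>2 \<le> defect d (phase h t) n"
    and corr: "\<And>d h n \<rho>. admissible \<theta> D d h n \<Longrightarrow>
      1 \<le> n \<Longrightarrow> weighted_bound k (1 - \<beta> + k) n h \<rho> \<Longrightarrow>
      (\<Sum>j=1..n. \<bar>h j\<bar> / real j * \<bar>ecoef d (n - j) / ecoef d n - 1\<bar>) \<le> K * \<rho>"
    using twist_expansion[OF params k0] by blast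
  have Cb: "(C_corr n d h)\<^sup>2 \<le> (D * K)\<^sup>2 * \<rho>\<^sup>2"
    if ad: "admissible \<theta> D d h n"
      and n: "1 \<le> n" and w: "weighted_bound k (1 - \<beta> + k) n h \<rho>" for d h n \<rho>
  proof -
    note d = admissibleD(1)[OF ad] and u = admissibleD(2)[OF ad]
    have "\<bar>C_corr n d h\<bar> \<le> (\<Sum>j=1..n. D * (\<bar>h j\<bar> / real j * \<bar>ecoef d (n - j) / ecoef d n - 1\<bar>))"
      unfolding C_corr_def p_coeff_eq_ecoef
    proof (rule order_trans[OF sum_abs sum_mono])
      fix j
      have "d j * (\<bar>h j\<bar> / real j * \<bar>ecoef d (n - j) / ecoef d n - 1\<bar>) \<le>
          D * (\<bar>h j\<bar> / real j * \<bar>ecoef d (n - j) / ecoef d n - 1\<bar>)"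
        using d[of j] by (intro mult_right_mono) auto
      then show "\<bar>d j * (h j / real j) * (ecoef d (n - j) / ecoef d n - 1)\<bar> \<le>
          D * (\<bar>h j\<bar> / real j * \<bar>ecoef d (n - j) / ecoef d n - 1\<bar>)"
        using d[of j] params by (simp only: abs_mult abs_divide abs_of_nat mult.assoc) simp
    qed
    also have "\<dots> = D * (\<Sum>j=1..n. \<bar>h j\<bar> / real j * \<bar>ecoef d (n - j) / ecoef d n - 1\<bar>)"
      by (simp only: sum_distrib_left)
    also have "\<dots> \<le> D * (K * \<rho>)" using corr[OF ad n w] D by (intro mult_left_mono) auto
    finally have "\<bar>C_corr n d h\<bar> \<le> D * K * \<rho>" by simp
    then have "\<bar>C_corr n d h\<bar>\<^sup>2 \<le> (D * K * \<rho>)\<^sup>2" by (intro power_mono) auto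
    then show ?thesis by (simp add: power_mult_distrib)
  qed
  define G where "G = (3 * 64 ^ 3 * 27 :: real)"
  define E where "E = D * (1 + c) + (D + 1) * (D * K)\<^sup>2 + K"
  define B where "B = (D * K)\<^sup>2 + E * G"
  have E: "0 < E" using D K by (simp add: E_def add_pos_pos add_nonneg_pos)
  have G: "0 < G" by (simp add: G_def)
  have B: "0 < B" "(D * K)\<^sup>2 \<le> B" "E * G \<le> B" using E G by (auto simp: B_def add_nonneg_pos)
  show thesis
  proof (rule that[OF B(1) K(2,3,4)])
    fix d h :: "nat \<Rightarrow> real" and n :: nat and \<rho> :: real
    assume ad: "admissible \<theta> D d h n"
      and n: "1 \<le> n" and w: "weighted_bound k (1 - \<beta> + k) n h \<rho>"
    have "(D * K)\<^sup>2 * \<rho>\<^sup>2 \<le> B * \<rho>\<^sup>2" using B by (intro mult_right_mono) auto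
    then show "(C_corr n d h)\<^sup>2 \<le> B * \<rho>\<^sup>2" using Cb[OF ad n w] by linarith
  next
    fix d h :: "nat \<Rightarrow> real" and n :: nat and t \<rho> :: real
    assume ad: "admissible \<theta> D d h n"
      and n: "1 \<le> n" and w: "weighted_bound k (1 - \<beta> + k) n h \<rho>"
      and t: "0 < t" "t * third h n \<le> c"
    note d = admissibleD(1)[OF ad] and u = admissibleD(2)[OF ad]
    define C where "C = C_corr n d h"
    define A where "A = A_mean n d h"
    define L3 where "L3 = third h n"
    define L2 where "L2 = L2' n d h"
    define r where "r j = ecoef d (n - j) / ecoef d n - 1" for j
    define S where "S = (\<Sum>j=1..n. of_real (d j / real j) * (phase h t j - 1) * of_real (r j))"
    define U where "U = log_ratio d h n t"
    define V where "V = U - \<i> * of_real (t * A)"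
    define x where "x = twist d (phase h t) n / of_real (ecoef d n)"
    define g where "g = exp (- (31 / 64 * t\<^sup>2))"
    have d0: "0 \<le> d j" "d j \<le> D" for j using d[of j] params by auto
    have dj: "\<bar>d j\<bar> / \<bar>real j\<bar> \<le> D / real j" for j using d0[of j] by (simp add: divide_right_mono)
    have L3: "0 \<le> L3" "t * L3 \<le> c" using t third_nonneg by (auto simp: L3_def)
    have L2: "0 \<le> L2" unfolding L2_def L2'_def by (intro sum_nonneg) auto
    have C2: "C\<^sup>2 \<le> (D * K)\<^sup>2 * \<rho>\<^sup>2" unfolding C_def by (rule Cb[OF ad n w])
    have x1: "norm (x - exp U * (1 + S)) \<le> K * (t\<^sup>2 * \<rho>\<^sup>2 * exp (- t\<^sup>2 / 64))"
      unfolding x_def U_def S_def r_def using expn[OF ad n w] t by simp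
    have ReV: "Re V \<le> - (31 / 64 * t\<^sup>2)"
      using dlow[OF ad, of t] t by (simp add: V_def U_def Re_log_ratio)
    have eV: "norm (exp V) \<le> g" unfolding norm_exp_eq_Re g_def using ReV by simp
    have S1: "norm (S - \<i> * of_real (t * C)) \<le> D * t\<^sup>2 * L2 / 2"
    proof -
      have "S - \<i> * of_real (t * C) = (\<Sum>j=1..n. of_real (d j / real j * r j) * (phase h t j - (\<Sum>k\<le>1. (\<i> * of_real (t * h j)) ^ k / fact k)))"
        unfolding S_def C_def C_corr_def p_coeff_eq_ecoef r_def[symmetric] of_real_mult[of t] of_real_sum sum_distrib_left sum_subtractf[symmetric]
        by (intro sum.cong) (auto simp: algebra_simps add_divide_distrib)
      also have "norm \<dots> \<le> (\<Sum>j=1..n. D * t\<^sup>2 / 2 * ((h j)\<^sup>2 / real j * \<bar>r j\<bar>))"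
      proof (rule sum_norm_le)
        fix j
        have "norm (phase h t j - (\<Sum>k\<le>1. (\<i> * of_real (t * h j)) ^ k / fact k)) \<le> \<bar>t * h j\<bar> ^ 2 / 2"
          using iexp_approx1[of "t * h j" 1] by (simp add: numeral_2_eq_2)
        then have "norm (of_real (d j / real j * r j) * (phase h t j - (\<Sum>k\<le>1. (\<i> * of_real (t * h j)) ^ k / fact k)))
            \<le> (D / real j * \<bar>r j\<bar>) * (\<bar>t * h j\<bar> ^ 2 / 2)"
          unfolding norm_mult norm_of_real abs_mult abs_divide using D by (intro mult_mono dj) auto
        also have "\<dots> = D * t\<^sup>2 / 2 * ((h j)\<^sup>2 / real j * \<bar>r j\<bar>)" by (simp add: power_mult_distrib mult_ac)
        finally show "norm (of_real (d j / real j * r j) * (phase h t j - (\<Sum>k\<le>1. (\<i> * of_real (t * h j)) ^ k / fact k))) \<le> \<dots>" .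
      qed
      also have "\<dots> = D * t\<^sup>2 * L2 / 2"
        unfolding L2_def L2'_def p_coeff_eq_ecoef r_def sum_distrib_left[symmetric] by simp
      finally show ?thesis .
    qed
    have V1: "norm (exp V - exp (of_real (- t\<^sup>2 / 2))) \<le> D * t ^ 3 * L3 / 6 * g"
    proof -
      have one: "of_real (- t\<^sup>2 / 2) = - (\<Sum>j=1..n. complex_of_real (t\<^sup>2 / 2 * (d j * ((h j)\<^sup>2 / real j))))"
        unfolding of_real_sum[symmetric] sum_distrib_left[symmetric] u by simp
      have "V - of_real (- t\<^sup>2 / 2) = (\<Sum>j=1..n. of_real (d j / real j) * (phase h t j - (\<Sum>k\<le>2. (\<i> * of_real (t * h j)) ^ k / fact k)))"
        unfolding V_def U_def log_ratio_def A_def A_mean_def one of_real_mult[of t] of_real_sum sum_distrib_left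
          diff_minus_eq_add sum_subtractf[symmetric] sum.distrib[symmetric]
        by (intro sum.cong) (auto simp: numeral_2_eq_2 power2_eq_square field_simps)
      also have "norm \<dots> \<le> (\<Sum>j=1..n. D * t ^ 3 / 6 * (\<bar>h j\<bar> ^ 3 / real j))"
      proof (rule sum_norm_le)
        fix j
        have "norm (phase h t j - (\<Sum>k\<le>2. (\<i> * of_real (t * h j)) ^ k / fact k)) \<le> \<bar>t * h j\<bar> ^ 3 / 6"
          using iexp_approx1[of "t * h j" 2] by (simp add: numeral_2_eq_2 numeral_3_eq_3)
        then have "norm (of_real (d j / real j) * (phase h t j - (\<Sum>k\<le>2. (\<i> * of_real (t * h j)) ^ k / fact k)))
            \<le> (D / real j) * (\<bar>t * h j\<bar> ^ 3 / 6)"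
          unfolding norm_mult norm_of_real abs_divide using D by (intro mult_mono dj) auto
        also have "\<dots> = D * t ^ 3 / 6 * (\<bar>h j\<bar> ^ 3 / real j)" using t by (simp add: power_mult_distrib abs_mult mult_ac)
        finally show "norm (of_real (d j / real j) * (phase h t j - (\<Sum>k\<le>2. (\<i> * of_real (t * h j)) ^ k / fact k))) \<le> \<dots>" .
      qed
      also have "\<dots> = D * t ^ 3 * L3 / 6" unfolding L3_def third_def sum_distrib_left[symmetric] by simp
      finally have v: "norm (V - of_real (- t\<^sup>2 / 2)) \<le> D * t ^ 3 * L3 / 6" .
      have "norm (exp V - exp (of_real (- t\<^sup>2 / 2))) \<le> norm (V - of_real (- t\<^sup>2 / 2)) * g"
        unfolding g_def by (rule norm_exp_diff_le[OF ReV]) simp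
      also have "\<dots> \<le> D * t ^ 3 * L3 / 6 * g" using v by (rule mult_right_mono) (simp add: g_def)
      finally show ?thesis .
    qed
    have ex: "norm (1 + \<i> * of_real (t * C) - iexp (t * C)) \<le> t\<^sup>2 * C\<^sup>2 / 2"
    proof -
      have "norm (iexp (t * C) - (\<Sum>k\<le>1. (\<i> * of_real (t * C)) ^ k / fact k)) \<le> \<bar>t * C\<bar> ^ 2 / 2"
        using iexp_approx1[of "t * C" 1] by (simp add: numeral_2_eq_2)
      then show ?thesis by (simp add: norm_minus_commute power_mult_distrib)
    qed
    have gexp: "norm (exp (complex_of_real (- t\<^sup>2 / 2))) \<le> g"
      unfolding norm_exp_eq_Re g_def by simp
    let ?F = "iexp (- (t * A))" and ?H = "iexp (- (t * C))"
    have FU: "?F * exp U = exp V" by (simp add: V_def exp_diff exp_minus field_simps)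
    have HC: "?H * iexp (t * C) = 1" by (simp add: exp_add[symmetric])
    have "iexp (- (t * (A + C))) = ?F * ?H" by (simp add: exp_add[symmetric] algebra_simps)
    then have main: "iexp (- (t * (A + C))) * x - exp (complex_of_real (- t\<^sup>2 / 2)) =
        ?H * (?F * (x - exp U * (1 + S)) + (exp V * (S - \<i> * of_real (t * C)) +
          ((exp V - exp (of_real (- t\<^sup>2 / 2))) * (1 + \<i> * of_real (t * C)) +
            exp (of_real (- t\<^sup>2 / 2)) * (1 + \<i> * of_real (t * C) - iexp (t * C)))))"
      unfolding FU[symmetric] using HC by (simp add: algebra_simps)
    have nH: "norm ?H = 1" "norm ?F = 1" by simp_all
    have n1: "norm (1 + \<i> * of_real (t * C)) \<le> 1 + t * \<bar>C\<bar>"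
      using norm_triangle_ineq[of 1 "\<i> * complex_of_real (t * C)"] t by (simp add: norm_mult abs_mult)
    have tri: "norm (w * (a + (b + (c + e)))) \<le> A1 + (A2 + (A3 + A4))"
      if "norm w = 1" "norm a \<le> A1" "norm b \<le> A2" "norm c \<le> A3" "norm e \<le> A4" for w a b c e :: complex and A1 A2 A3 A4
      unfolding norm_mult that(1) mult_1_left
      by (intro order_trans[OF norm_triangle_ineq] add_mono that)
    have "norm (iexp (- (t * (A + C))) * x - exp (complex_of_real (- t\<^sup>2 / 2))) \<le>
        K * (t\<^sup>2 * \<rho>\<^sup>2 * exp (- t\<^sup>2 / 64)) + (g * (D * t\<^sup>2 * L2 / 2) + (D * t ^ 3 * L3 / 6 * g * (1 + t * \<bar>C\<bar>) + g * (t\<^sup>2 * C\<^sup>2 / 2)))"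
      unfolding main
    proof (rule tri[OF nH(1)])
      show "norm (?F * (x - exp U * (1 + S))) \<le> K * (t\<^sup>2 * \<rho>\<^sup>2 * exp (- t\<^sup>2 / 64))"
        unfolding norm_mult nH using x1 by simp
      show "norm (exp V * (S - \<i> * of_real (t * C))) \<le> g * (D * t\<^sup>2 * L2 / 2)"
        unfolding norm_mult using eV S1 by (intro mult_mono) (auto simp: g_def)
      show "norm ((exp V - exp (of_real (- t\<^sup>2 / 2))) * (1 + \<i> * of_real (t * C))) \<le> D * t ^ 3 * L3 / 6 * g * (1 + t * \<bar>C\<bar>)"
        unfolding norm_mult using V1 n1 D t L3 by (intro mult_mono) (auto simp: g_def)
      show "norm (exp (of_real (- t\<^sup>2 / 2)) * (1 + \<i> * of_real (t * C) - iexp (t * C))) \<le> g * (t\<^sup>2 * C\<^sup>2 / 2)"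
        unfolding norm_mult using gexp ex by (intro mult_mono) (auto simp: g_def)
    qed
    also have "\<dots> = K * (t\<^sup>2 * \<rho>\<^sup>2) * exp (- t\<^sup>2 / 64) + g * (D * t\<^sup>2 * L2 / 2 + D * t ^ 3 * L3 / 6 + D / 6 * (t ^ 4 * (L3 * \<bar>C\<bar>)) + t\<^sup>2 * C\<^sup>2 / 2)"
      by (simp add: algebra_simps power4_eq_xxxx power3_eq_cube power2_eq_square)
    also have "\<dots> \<le> K * (t\<^sup>2 * \<rho>\<^sup>2) * exp (- t\<^sup>2 / 64) + exp (- t\<^sup>2 / 64) *
        (D * t\<^sup>2 * L2 / 2 + D * t ^ 3 * L3 / 6 + D / 6 * ((c * (t ^ 3 * L3) + t ^ 4 * C\<^sup>2) / 2) + t\<^sup>2 * C\<^sup>2 / 2)"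
    proof -
      \<comment> \<open>the cross term: one factor \<open>t * L3\<close> is bounded by \<open>c\<close>\<close>
      have "t ^ 4 * (L3 * \<bar>C\<bar>) \<le> t ^ 4 * ((L3\<^sup>2 + C\<^sup>2) / 2)"
        using sum_squares_bound[of L3 "\<bar>C\<bar>"] t by (intro mult_left_mono) auto
      also have "\<dots> = (t ^ 3 * L3 * (t * L3) + t ^ 4 * C\<^sup>2) / 2"
        by (simp add: algebra_simps power4_eq_xxxx power3_eq_cube power2_eq_square)
      also have "\<dots> \<le> (t ^ 3 * L3 * c + t ^ 4 * C\<^sup>2) / 2"
        using L3 t by (intro divide_right_mono add_right_mono mult_left_mono) auto
      finally have "t ^ 4 * (L3 * \<bar>C\<bar>) \<le> (c * (t ^ 3 * L3) + t ^ 4 * C\<^sup>2) / 2" by (simp add: mult_ac)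
      moreover have "g \<le> exp (- t\<^sup>2 / 64)" by (simp add: g_def)
      ultimately show ?thesis using D L2 L3 t K
        by (intro add_left_mono mult_mono add_mono mult_left_mono) auto
    qed
    also have "\<dots> \<le> E * (L3 + \<rho>\<^sup>2 + L2) * ((t\<^sup>2 + t ^ 3 + t ^ 4) * exp (- t\<^sup>2 / 64))"
    proof -
      define X where "X = (D * K)\<^sup>2"
      define T where "T = t\<^sup>2 + t ^ 3 + t ^ 4"
      have T: "t\<^sup>2 \<le> T" "t ^ 3 \<le> T" "t ^ 4 \<le> T" "0 \<le> T" using t by (auto simp: T_def)
      have C2': "C\<^sup>2 \<le> X * \<rho>\<^sup>2" using C2 by (simp add: X_def)
      have X: "0 \<le> X" by (simp add: X_def)
      have a1: "K * (t\<^sup>2 * \<rho>\<^sup>2) \<le> K * (T * \<rho>\<^sup>2)" using T K by (intro mult_left_mono mult_right_mono) auto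
      have a2: "D * t\<^sup>2 * L2 / 2 \<le> D * (T * L2)" 
      proof -
        have "t\<^sup>2 * L2 \<le> T * L2" using T L2 by (intro mult_right_mono)
        then have "D * (t\<^sup>2 * L2) \<le> D * (T * L2)" using D by (intro mult_left_mono) auto
        moreover have "0 \<le> D * (t\<^sup>2 * L2)" using D L2 by simp
        ultimately have "D * (t\<^sup>2 * L2) / 2 \<le> D * (T * L2)" by linarith
        then show ?thesis by (simp only: mult.assoc)
      qed
      have t3: "t ^ 3 * L3 \<le> T * L3" "0 \<le> t ^ 3 * L3" using T L3 t by (auto intro!: mult_right_mono)
      have a3: "D * t ^ 3 * L3 / 6 \<le> D * (T * L3)"
      proof -
        have "D * (t ^ 3 * L3) \<le> D * (T * L3)" "0 \<le> D * (t ^ 3 * L3)" using D t3 by (auto intro: mult_left_mono)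
        then have "D * (t ^ 3 * L3) / 6 \<le> D * (T * L3)" by linarith
        then show ?thesis by (simp only: mult.assoc)
      qed
      have tc: "t ^ 4 * C\<^sup>2 \<le> T * (X * \<rho>\<^sup>2)" "t\<^sup>2 * C\<^sup>2 \<le> T * (X * \<rho>\<^sup>2)" "0 \<le> t ^ 4 * C\<^sup>2" "0 \<le> t\<^sup>2 * C\<^sup>2"
        using T C2' t by (auto intro!: mult_mono)
      have a4: "D / 6 * ((c * (t ^ 3 * L3) + t ^ 4 * C\<^sup>2) / 2) \<le> D * (c * (T * L3) + T * (X * \<rho>\<^sup>2))"
      proof -
        have "c * (t ^ 3 * L3) + t ^ 4 * C\<^sup>2 \<le> c * (T * L3) + T * (X * \<rho>\<^sup>2)"
          using t3 tc K by (intro add_mono mult_left_mono) auto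
        then have "D * (c * (t ^ 3 * L3) + t ^ 4 * C\<^sup>2) \<le> D * (c * (T * L3) + T * (X * \<rho>\<^sup>2))"
          using D by (intro mult_left_mono) auto
        moreover have "0 \<le> D * (c * (t ^ 3 * L3) + t ^ 4 * C\<^sup>2)" using D K t3 tc by simp
        moreover have "D / 6 * ((c * (t ^ 3 * L3) + t ^ 4 * C\<^sup>2) / 2) = D * (c * (t ^ 3 * L3) + t ^ 4 * C\<^sup>2) / 12" by simp
        ultimately show ?thesis by linarith
      qed
      have a5: "t\<^sup>2 * C\<^sup>2 / 2 \<le> T * (X * \<rho>\<^sup>2)" using tc(2,4) by linarith
      have "K * (t\<^sup>2 * \<rho>\<^sup>2) + (D * t\<^sup>2 * L2 / 2 + D * t ^ 3 * L3 / 6 + D / 6 * ((c * (t ^ 3 * L3) + t ^ 4 * C\<^sup>2) / 2) + t\<^sup>2 * C\<^sup>2 / 2)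
        \<le> K * (T * \<rho>\<^sup>2) + (D * (T * L2) + D * (T * L3) + D * (c * (T * L3) + T * (X * \<rho>\<^sup>2)) + T * (X * \<rho>\<^sup>2))"
        by (intro add_mono a1 a2 a3 a4 a5)
      also have "\<dots> = T * ((D * (1 + c)) * L3 + ((D + 1) * X + K) * \<rho>\<^sup>2 + D * L2)" by (simp add: algebra_simps)
      also have "\<dots> \<le> T * (E * L3 + E * \<rho>\<^sup>2 + E * L2)"
      proof -
        have "D * (1 + c) \<le> E" "(D + 1) * X + K \<le> E" "D \<le> E"
        proof -
          have EX: "E = D * (1 + c) + (D + 1) * X + K" by (simp add: E_def X_def)
          have "0 \<le> (D + 1) * X" "0 \<le> D * c" "D * (1 + c) = D + D * c"
            using D K X by (auto simp: distrib_left)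
          then show "D * (1 + c) \<le> E" "(D + 1) * X + K \<le> E" "D \<le> E" unfolding EX using D K by linarith+
        qed
        then show ?thesis using T L3 L2 by (intro mult_left_mono add_mono mult_right_mono) auto
      qed
      finally have "K * (t\<^sup>2 * \<rho>\<^sup>2) + (D * t\<^sup>2 * L2 / 2 + D * t ^ 3 * L3 / 6 + D / 6 * ((c * (t ^ 3 * L3) + t ^ 4 * C\<^sup>2) / 2) + t\<^sup>2 * C\<^sup>2 / 2)
        \<le> E * (L3 + \<rho>\<^sup>2 + L2) * T" by (simp add: algebra_simps)
      moreover have "a * e + e * b \<le> q * (T * e)" if "a + b \<le> q * T" "0 \<le> e" for a b q e :: real
        using mult_right_mono[OF that] by (simp add: algebra_simps)
      ultimately show ?thesis unfolding T_def[symmetric] by simp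
    qed
    also have "\<dots> \<le> E * (L3 + \<rho>\<^sup>2 + L2) * (G * (t / (1 + t\<^sup>2)))"
      unfolding G_def using polynomial_gauss_le[of t] t E L3 L2 by (intro mult_left_mono) auto
    also have "\<dots> = E * G * ((L3 + \<rho>\<^sup>2 + L2) * (t / (1 + t\<^sup>2)))" by (simp only: mult_ac)
    also have "\<dots> \<le> B * ((L3 + \<rho>\<^sup>2 + L2) * (t / (1 + t\<^sup>2)))"
      using B L3 L2 t by (intro mult_right_mono) auto
    finally show "norm (iexp (- (t * (A_mean n d h + C_corr n d h))) * (twist d (phase h t) n / of_real (ecoef d n))
        - of_real (exp (- t\<^sup>2 / 2))) \<le> B * (third h n + \<rho>\<^sup>2 + L2' n d h) * (t / (1 + t\<^sup>2))"
      unfolding A_def[symmetric] C_def[symmetric] x_def[symmetric] L3_def[symmetric] L2_def[symmetric] exp_of_real[symmetric]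
      by (simp only: mult.assoc)
  qed
qed

end

section \<open>The law of an additive function\<close>

lemma nu_cong:
  assumes "\<And>j. 1 \<le> j \<Longrightarrow> dd j = d j"
  shows "nu n dd = nu n d"
proof -
  have "mult_fun n dd = mult_fun n d"
    unfolding mult_fun_def by (intro ext prod.cong) (use assms in auto)
  then show ?thesis unfolding nu_def by simp
qed

context
  fixes d h :: "nat \<Rightarrow> real" and n :: nat
  assumes d: "\<And>j. 0 < d j"
begin

lemma sum_mult_fun: "(\<Sum>\<tau>\<in>sym_group n. mult_fun n d \<tau>) = fact n * ecoef d n"
proof -
  have "complex_of_real (\<Sum>\<tau>\<in>sym_group n. mult_fun n d \<tau>) = fact n * ecoef (\<lambda>j. complex_of_real (d j)) n"
    using cycle_sum_eq_prod_power[of "\<lambda>j. complex_of_real (d j)" n] cycle_sum_eq_ecoef[of "{1..n}" "\<lambda>j. complex_of_real (d j)"]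
    by (simp add: mult_fun_def)
  also have "\<dots> = complex_of_real (fact n * ecoef d n)" by (simp add: ecoef_of_real)
  finally show ?thesis by (simp only: of_real_eq_iff)
qed

lemma sum_mult_fun_phase:
  "(\<Sum>\<tau>\<in>sym_group n. of_real (mult_fun n d \<tau>) * iexp (t * additive_fun n h \<tau>)) = fact n * twist d (phase h t) n"
proof -
  have "of_real (mult_fun n d \<tau>) * iexp (t * additive_fun n h \<tau>) =
      (\<Prod>j=1..n. (of_real (d j) * phase h t j) ^ cycle_count n j \<tau>)" for \<tau>
  proof -
    have "\<i> * complex_of_real (t * additive_fun n h \<tau>) = (\<Sum>j=1..n. of_nat (cycle_count n j \<tau>) * (\<i> * of_real (t * h j)))"
      unfolding additive_fun_def sum_distrib_left of_real_sum by (intro sum.cong) (auto simp: mult_ac)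
    then have "iexp (t * additive_fun n h \<tau>) = (\<Prod>j=1..n. phase h t j ^ cycle_count n j \<tau>)"
      by (simp only: exp_sum finite_atLeastAtMost exp_of_nat_mult)
    then show ?thesis by (simp add: mult_fun_def power_mult_distrib prod.distrib)
  qed
  then have "(\<Sum>\<tau>\<in>sym_group n. of_real (mult_fun n d \<tau>) * iexp (t * additive_fun n h \<tau>)) = cycle_sum (\<lambda>j. of_real (d j) * phase h t j) {1..n}"
    using cycle_sum_eq_prod_power[of "\<lambda>j. of_real (d j) * phase h t j" n] by simp
  then show ?thesis by (simp add: cycle_sum_eq_ecoef twist_def)
qed

text \<open>The shift will be the mean plus the correction \<open>C\<close>, so that the comparison is with the standard normal law.\<close>

definition shifted_law :: "real \<Rightarrow> real measure" where
  "shifted_law c = distr (nu n d) borel (\<lambda>\<sigma>. additive_fun n h \<sigma> - c)"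

lemma nu_prob_space: "prob_space (nu n d)"
  by (rule prob_space_nu) (rule d)

lemma measurable_nu [measurable]: "f \<in> nu n d \<rightarrow>\<^sub>M borel"
  unfolding nu_def by simp

lemma shifted_law_real_distribution: "real_distribution (shifted_law c)"
  unfolding shifted_law_def by (rule prob_space.real_distribution_distr[OF nu_prob_space]) simp

lemma integral_nu:
  fixes g :: "(nat \<Rightarrow> nat) \<Rightarrow> 'b::{banach, second_countable_topology}"
  shows "integral\<^sup>L (nu n d) g = (\<Sum>\<sigma>\<in>sym_group n. (mult_fun n d \<sigma> / (fact n * ecoef d n)) *\<^sub>R g \<sigma>)"
proof -
  have pos: "0 < mult_fun n d \<sigma>" for \<sigma> using d by (intro mult_fun_pos) auto
  have "0 < (\<Sum>\<tau>\<in>sym_group n. mult_fun n d \<tau>)"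
    using finite_sym_group sym_group_nonempty pos by (intro sum_pos) auto
  then show ?thesis unfolding nu_def sum_mult_fun
    using pos finite_sym_group by (intro lebesgue_integral_point_measure_finite) (auto intro!: divide_nonneg_nonneg less_imp_le)
qed

lemma integrable_nu:
  fixes g :: "(nat \<Rightarrow> nat) \<Rightarrow> 'b::{banach, second_countable_topology}"
  shows "integrable (nu n d) g"
  unfolding nu_def by (rule integrable_point_measure_finite[OF finite_sym_group])

lemma char_shifted_law:
  "char (shifted_law c) t = iexp (- (t * c)) * (twist d (phase h t) n / of_real (ecoef d n))"
proof -
  have "char (shifted_law c) t = (\<Sum>\<sigma>\<in>sym_group n. (mult_fun n d \<sigma> / (fact n * ecoef d n)) *\<^sub>R iexp (t * (additive_fun n h \<sigma> - c)))"
    unfolding char_def shifted_law_def by (subst integral_distr) (auto simp: integral_nu)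
  also have "\<dots> = (\<Sum>\<sigma>\<in>sym_group n. iexp (- (t * c)) / of_real (fact n * ecoef d n) * (of_real (mult_fun n d \<sigma>) * iexp (t * additive_fun n h \<sigma>)))"
  proof (rule sum.cong)
    fix \<sigma>
    have "iexp (t * (additive_fun n h \<sigma> - c)) = iexp (- (t * c)) * iexp (t * additive_fun n h \<sigma>)"
      by (simp add: exp_add[symmetric] algebra_simps)
    then show "(mult_fun n d \<sigma> / (fact n * ecoef d n)) *\<^sub>R iexp (t * (additive_fun n h \<sigma> - c)) =
        iexp (- (t * c)) / of_real (fact n * ecoef d n) * (of_real (mult_fun n d \<sigma>) * iexp (t * additive_fun n h \<sigma>))"
      by (simp add: scaleR_conv_of_real)
  qed simp
  also have "\<dots> = iexp (- (t * c)) / of_real (fact n * ecoef d n) * (fact n * twist d (phase h t) n)"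
    unfolding sum_distrib_left[symmetric] sum_mult_fun_phase ..
  also have "\<dots> = iexp (- (t * c)) * (twist d (phase h t) n / of_real (ecoef d n))" by simp
  finally show ?thesis .
qed

lemma shifted_law_first_moment: "integrable (shifted_law c) (\<lambda>y. y)"
  unfolding shifted_law_def by (subst integrable_distr_eq) (auto intro: integrable_nu)

lemma cdf_shifted_law: "cdf (shifted_law c) y = measure (nu n d) {\<sigma> \<in> space (nu n d). additive_fun n h \<sigma> - c \<le> y}"
  unfolding cdf_def shifted_law_def by (subst measure_distr) (auto intro!: arg_cong[where f="measure _"])

text \<open>The strict inequality in \<open>F_dist\<close> and the non-strict one in a distribution function differ
by a limit from the left, which the Lipschitz continuity of \<open>Phi\<close> absorbs.\<close>

lemma F_dist_near_Phi:
  assumes "\<And>y. \<bar>cdf (shifted_law (A_mean n d h + C)) y - Phi y\<bar> \<le> e"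
  shows "\<bar>F_dist n d h x - Phi (x - C)\<bar> \<le> e"
proof -
  interpret prob_space "nu n d" by (rule nu_prob_space)
  have ms: "{\<sigma> \<in> space (nu n d). P \<sigma>} \<in> sets (nu n d)" for P
    unfolding nu_def by (auto simp: sets_point_measure space_point_measure)
  have up: "F_dist n d h x \<le> Phi (x - C) + e"
  proof -
    have "F_dist n d h x \<le> cdf (shifted_law (A_mean n d h + C)) (x - C)"
      unfolding F_dist_def cdf_shifted_law by (intro finite_measure_mono ms) auto
    then show ?thesis using assms[of "x - C"] by (simp add: abs_le_iff)
  qed
  have "Phi (x - C) - e \<le> F_dist n d h x"
  proof (rule field_le_epsilon)
    fix \<delta> :: real assume \<delta>: "0 < \<delta>"
    have "cdf (shifted_law (A_mean n d h + C)) (x - C - \<delta>) \<le> F_dist n d h x"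
      unfolding F_dist_def cdf_shifted_law using \<delta> by (intro finite_measure_mono ms) auto
    moreover have "Phi (x - C) - Phi (x - C - \<delta>) \<le> \<delta>" using Phi_lipschitz[of "x - C - \<delta>" "x - C"] \<delta> by simp
    ultimately show "Phi (x - C) - e \<le> F_dist n d h x + \<delta>" using assms[of "x - C - \<delta>"] by (simp add: abs_le_iff)
  qed
  then show ?thesis using up by (simp add: abs_le_iff)
qed

end

lemma std_normal_first_moment: "integrable std_normal_distribution (\<lambda>y. y)"
  using integrable_std_normal_moment[of 1] by (subst integrable_density) (auto simp: mult.commute)

text \<open>The law centred at the mean plus \<open>C\<close> is compared with the normal law by \<open>esseen_smoothing\<close> at
\<open>T = c / third h n\<close>, the range in which the estimate of \<open>twist_gauss_approx\<close> holds; the term \<open>16 / T\<close> is then a multiple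
of the third absolute moment. Expanding \<open>Phi (x - C)\<close> produces the correction term with an error \<open>C\<^sup>2\<close>.\<close>

lemma normal_approximation:
  fixes dminus dplus :: real and p :: ereal
  assumes dm: "0 < dminus" "dminus \<le> dplus"
    and p: "ereal (max 2 (1 / dminus)) < p"
  obtains K where "0 < K"
    "\<And>d n h x. (\<And>j. dminus \<le> d j \<and> d j \<le> dplus) \<Longrightarrow> 1 \<le> n \<Longrightarrow>
      (\<Sum>k=1..n. d k * ((h k)\<^sup>2 / real k)) = 1 \<Longrightarrow>
      \<bar>F_dist n d h x - Phi x + 1 / sqrt (2 * pi) * exp (- x\<^sup>2 / 2) * C_corr n d h\<bar>
        \<le> K * (L_sum n h 3 + L_norm_sq n h p + L2' n d h)"
proof -
  \<comment> \<open>the coefficients of \<open>(1 - z) powr (- \<beta>)\<close> decrease for \<open>\<beta> \<le> 1\<close> only, hence the minimum\<close>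
  define \<theta> where "\<theta> = min dminus 1"
  have \<theta>: "0 < \<theta>" "\<theta> \<le> 1" "\<theta> \<le> dminus" "\<theta> \<le> dplus" using dm by (auto simp: \<theta>_def)
  have p': "ereal (max 2 (1 / \<theta>)) < p"
  proof -
    have "max 2 (1 / \<theta>) \<le> max 2 (1 / dminus)" by (cases "dminus \<le> 1") (auto simp: \<theta>_def)
    then show ?thesis using p by (meson ereal_less_eq(3) order_le_less_trans)
  qed
  obtain \<beta> k0 where \<beta>: "0 < \<beta>" "\<beta> < \<theta>" "0 < k0"
    and wb: "\<And>k. 0 < k \<Longrightarrow> k \<le> k0 \<Longrightarrow> \<beta> \<le> 1 \<Longrightarrow> \<exists>R>0. \<forall>n h. 1 \<le> n \<longrightarrow> (\<exists>j\<in>{1..n}. h j \<noteq> 0) \<longrightarrow>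
      weighted_bound k (1 - \<beta> + k) n h (R * sqrt (L_norm_sq n h p))"
    using weighted_bound_L_norm[OF p' \<theta>(1)] by blast
  obtain B c k where B: "0 < B" "0 < c" "0 < k" "k \<le> k0"
    and approx: "\<And>d h n t \<rho>. admissible \<theta> dplus d h n \<Longrightarrow>
      1 \<le> n \<Longrightarrow> weighted_bound k (1 - \<beta> + k) n h \<rho> \<Longrightarrow> 0 < t \<Longrightarrow> t * third h n \<le> c \<Longrightarrow>
      norm (iexp (- (t * (A_mean n d h + C_corr n d h))) * (twist d (phase h t) n / of_real (ecoef d n))
        - of_real (exp (- t\<^sup>2 / 2))) \<le> B * (third h n + \<rho>\<^sup>2 + L2' n d h) * (t / (1 + t\<^sup>2))"
    and Csq: "\<And>d h n \<rho>. admissible \<theta> dplus d h n \<Longrightarrow>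
      1 \<le> n \<Longrightarrow> weighted_bound k (1 - \<beta> + k) n h \<rho> \<Longrightarrow> (C_corr n d h)\<^sup>2 \<le> B * \<rho>\<^sup>2"
    using twist_gauss_approx[OF \<beta>(1,2) \<theta>(2,4) \<beta>(3)] by blast
  obtain R where R: "0 < R" "\<And>n h. 1 \<le> n \<Longrightarrow> (\<exists>j\<in>{1..n}. h j \<noteq> 0) \<Longrightarrow>
      weighted_bound k (1 - \<beta> + k) n h (R * sqrt (L_norm_sq n h p))"
    using wb[OF B(3,4)] \<beta> \<theta> by auto
  define K where "K = 2 * B * (1 + R\<^sup>2) + 16 / c"
  have K: "0 < K" using B by (simp add: K_def add_pos_pos mult_pos_pos add_pos_nonneg)
  show thesis
  proof (rule that[OF K])
    fix d h :: "nat \<Rightarrow> real" and n :: nat and x :: real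
    assume d': "\<And>j. dminus \<le> d j \<and> d j \<le> dplus" and n: "1 \<le> n"
      and u: "(\<Sum>k=1..n. d k * ((h k)\<^sup>2 / real k)) = 1"
    have d: "\<theta> \<le> d j \<and> d j \<le> dplus" for j using d'[of j] \<theta> by auto
    have ad: "admissible \<theta> dplus d h n" using d u by (simp add: admissible_def)
    have dpos: "0 < d j" for j using d[of j] \<theta> by linarith
    have ex: "\<exists>j\<in>{1..n}. h j \<noteq> 0"
    proof (rule ccontr)
      assume "\<not> (\<exists>j\<in>{1..n}. h j \<noteq> 0)"
      then have "(\<Sum>k=1..n. d k * ((h k)\<^sup>2 / real k)) = 0" by (intro sum.neutral) auto
      then show False using u by simp
    qed
    define C where "C = C_corr n d h"
    define \<rho> where "\<rho> = R * sqrt (L_norm_sq n h p)"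
    define L where "L = L_norm_sq n h p"
    have L: "0 \<le> L" by (auto simp: L_def L_norm_sq_def)
    have \<rho>2: "\<rho>\<^sup>2 = R\<^sup>2 * L" using L by (simp add: \<rho>_def L_def power_mult_distrib)
    have w: "weighted_bound k (1 - \<beta> + k) n h \<rho>" unfolding \<rho>_def by (rule R(2)[OF n ex])
    have L3: "third h n = L_sum n h 3" unfolding third_def L_sum_def by (intro sum.cong) auto
    have L3pos: "0 < third h n"
    proof -
      obtain j where j: "j \<in> {1..n}" "h j \<noteq> 0" using ex by auto
      have "0 < \<bar>h j\<bar> ^ 3 / real j" using j by simp
      also have "\<dots> \<le> third h n" unfolding third_def by (rule member_le_sum) (use j in auto)
      finally show ?thesis .
    qed
    have L2: "0 \<le> L2' n d h" unfolding L2'_def by (intro sum_nonneg) auto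
    define \<delta> where "\<delta> = third h n + \<rho>\<^sup>2 + L2' n d h"
    define T where "T = c / third h n"
    have T: "0 < T" using B L3pos by (simp add: T_def)
    have ber: "\<bar>cdf (shifted_law d h n (A_mean n d h + C)) y - cdf std_normal_distribution y\<bar> \<le> B * \<delta> + 16 / T" for y
    proof (rule esseen_smoothing)
      show "real_distribution (shifted_law d h n (A_mean n d h + C))" by (rule shifted_law_real_distribution[OF dpos])
      show "real_distribution std_normal_distribution" by (rule real_dist_normal_dist)
      show "integrable (shifted_law d h n (A_mean n d h + C)) (\<lambda>y. y)" by (rule shifted_law_first_moment[OF dpos])
      show "integrable std_normal_distribution (\<lambda>y. y)" by (rule std_normal_first_moment)
      show "cdf std_normal_distribution y - cdf std_normal_distribution x \<le> y - x" if "x \<le> y" for x y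
        using Phi_lipschitz[OF that] unfolding Phi_eq_cdf .
      show "0 < T" by (rule T)
      fix t assume t: "0 < t" "t < T"
      have tc: "t * third h n \<le> c" using t L3pos by (simp add: T_def field_simps)
      have "norm (char (shifted_law d h n (A_mean n d h + C)) t - char std_normal_distribution t) \<le> B * \<delta> * (t / (1 + t\<^sup>2))"
        unfolding char_shifted_law[OF dpos] char_std_normal_distribution C_def \<delta>_def
        by (rule approx[OF ad n w t(1) tc])
      then show "norm (char (shifted_law d h n (A_mean n d h + C)) t - char std_normal_distribution t) \<le> B * \<delta> * t / (1 + t\<^sup>2)"
        by simp
    qed
    have "\<bar>F_dist n d h x - Phi (x - C)\<bar> \<le> B * \<delta> + 16 / T"
      by (rule F_dist_near_Phi[OF dpos]) (use ber in \<open>simp add: Phi_eq_cdf\<close>)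
    moreover have "\<bar>Phi (x - C) - Phi x + C * std_normal_density x\<bar> \<le> C\<^sup>2" by (rule Phi_taylor)
    moreover have "C\<^sup>2 \<le> B * \<delta>"
    proof -
      have "C\<^sup>2 \<le> B * \<rho>\<^sup>2" unfolding C_def by (rule Csq[OF ad n w])
      also have "\<dots> \<le> B * \<delta>" using B L3pos L2 by (intro mult_left_mono) (auto simp: \<delta>_def)
      finally show ?thesis .
    qed
    moreover have "F_dist n d h x - Phi x + 1 / sqrt (2 * pi) * exp (- x\<^sup>2 / 2) * C_corr n d h =
        (F_dist n d h x - Phi (x - C)) + (Phi (x - C) - Phi x + C * std_normal_density x)"
      by (simp add: std_normal_density_def C_def)
    ultimately have "\<bar>F_dist n d h x - Phi x + 1 / sqrt (2 * pi) * exp (- x\<^sup>2 / 2) * C_corr n d h\<bar> \<le> 2 * B * \<delta> + 16 / T"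
      by linarith
    also have "16 / T = 16 / c * third h n" using B L3pos by (simp add: T_def)
    also have "2 * B * \<delta> + 16 / c * third h n \<le> K * (third h n + L + L2' n d h)"
    proof -
      have "\<delta> \<le> (1 + R\<^sup>2) * (third h n + L + L2' n d h)"
        using L L2 L3pos by (simp add: \<delta>_def \<rho>2 algebra_simps)
      then have "2 * B * \<delta> \<le> 2 * B * ((1 + R\<^sup>2) * (third h n + L + L2' n d h))" using B by (intro mult_left_mono) auto
      moreover have "16 / c * third h n \<le> 16 / c * (third h n + L + L2' n d h)" using B L L2 by (intro mult_left_mono) auto
      ultimately show ?thesis by (simp add: K_def algebra_simps)
    qed
    finally show "\<bar>F_dist n d h x - Phi x + 1 / sqrt (2 * pi) * exp (- x\<^sup>2 / 2) * C_corr n d h\<bar>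
        \<le> K * (L_sum n h 3 + L_norm_sq n h p + L2' n d h)"
      unfolding L_def L3 .
  qed
qed

theorem theorem4:
  fixes dminus dplus :: real and p :: ereal
  assumes "0 < dminus" and "dminus \<le> dplus"
    and "ereal (max 2 (1 / dminus)) < p"
  shows "\<exists>K>0. \<forall>(dd :: nat \<Rightarrow> real) (n :: nat) (hh :: nat \<Rightarrow> real).
    (\<forall>j\<ge>1. dminus \<le> dd j \<and> dd j \<le> dplus) \<longrightarrow>
    n \<ge> 1 \<longrightarrow>
    (\<Sum>k=1..n. dd k * ((hh k)\<^sup>2 / real k)) = 1 \<longrightarrow>
    (SUP x::real. ereal \<bar>F_dist n dd hh x - Phi x
        + 1 / sqrt (2 * pi) * exp (- x\<^sup>2 / 2) * C_corr n dd hh\<bar>)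
      \<le> ereal (K * (L_sum n hh 3 + L_norm_sq n hh p + L2' n dd hh))"
proof -
  obtain K where K: "0 < K"
    "\<And>d n h x. (\<And>j. dminus \<le> d j \<and> d j \<le> dplus) \<Longrightarrow> 1 \<le> n \<Longrightarrow>
      (\<Sum>k=1..n. d k * ((h k)\<^sup>2 / real k)) = 1 \<Longrightarrow>
      \<bar>F_dist n d h x - Phi x + 1 / sqrt (2 * pi) * exp (- x\<^sup>2 / 2) * C_corr n d h\<bar>
        \<le> K * (L_sum n h 3 + L_norm_sq n h p + L2' n d h)"
    using normal_approximation[OF assms] by blast
  show ?thesis
  proof (intro exI[of _ K] conjI allI impI K(1))
    fix dd hh :: "nat \<Rightarrow> real" and n :: nat
    assume dd: "\<forall>j\<ge>1. dminus \<le> dd j \<and> dd j \<le> dplus" and n: "n \<ge> 1"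
      and u: "(\<Sum>k=1..n. dd k * ((hh k)\<^sup>2 / real k)) = 1"
    \<comment> \<open>the hypotheses leave \<open>dd 0\<close> free; a value within the bounds is put in its place\<close>
    define d where "d j = (if j = 0 then dminus else dd j)" for j
    have d: "dminus \<le> d j \<and> d j \<le> dplus" for j using dd assms(2) by (auto simp: d_def)
    have eq: "1 \<le> j \<Longrightarrow> dd j = d j" for j by (simp add: d_def)
    have pc: "p_coeff dd m = p_coeff d m" for m
      unfolding p_coeff_eq_ecoef by (rule ecoef_cong) (use eq in auto)
    have "F_dist n dd hh x = F_dist n d hh x" for x
    proof -
      have "A_mean n dd hh = A_mean n d hh" unfolding A_mean_def by (intro sum.cong) (use eq in auto)
      moreover have "nu n dd = nu n d" by (rule nu_cong) (rule eq)
      ultimately show ?thesis unfolding F_dist_def by simp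
    qed
    moreover have "C_corr n dd hh = C_corr n d hh"
      unfolding C_corr_def pc by (intro sum.cong) (use eq in auto)
    moreover have "L2' n dd hh = L2' n d hh" unfolding L2'_def pc ..
    moreover have "(\<Sum>k=1..n. d k * ((hh k)\<^sup>2 / real k)) = 1"
      unfolding u[symmetric] by (intro sum.cong) (use eq in auto)
    ultimately show "(SUP x::real. ereal \<bar>F_dist n dd hh x - Phi x
        + 1 / sqrt (2 * pi) * exp (- x\<^sup>2 / 2) * C_corr n dd hh\<bar>)
      \<le> ereal (K * (L_sum n hh 3 + L_norm_sq n hh p + L2' n dd hh))"
      using K(2)[OF d n, where h = hh] by (intro SUP_least) simp
  qed
qed

end
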